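(* Let $k$ be a field of characteristic zero, let $D=k[d_1,\dots,d_n]$, and let $M$ be the $D$-module defined by a linear system of partial differential equations with constant coefficients in $k$ which is involutive of order $q$, in solved form, with respect to $d_1,\dots,d_n$ (in this ordering). Assume $cd_D(M)=r$. Then $M$ is $r$-pure if and only if the sequence $$0\longrightarrow M\longrightarrow k(\chi_1,\dots,\chi_{n-r})\otimes M$$ is exact, where the map is the canonical localization map $x\mapsto 1\otimes x$.
   Context: Here $D=k[d_1,\dots,d_n]$ is the (commutative) polynomial ring in $n$ commuting formal derivatives $d_i$, where $k$ is a field of constants; it is identified with $k[\chi_1,\dots,\chi_n]$ by $d_i\leftrightarrow\chi_i$. For $0\le r\le n$, $k(\chi_1,\dots,\chi_{n-r})\otimes M$ denotes the partial localization of $M$, i.e. the tensor product over $k[\chi_1,\dots,\chi_{n-r}]\simeq k[d_1,\dots,d_{n-r}]$ of $M$ with the field of fractions $k(\chi_1,\dots,\chi_{n-r})$ (for $r=n$ this is just $M$). Module defined by a system: let $Dy=Dy^1+\dots+Dy^m\simeq D^m$ be free with basis $y^1,\dots,y^m$ and write $y^k_\mu=d_\mu y^k$ (jets). A system of order $q$ is a finite family $\Phi^\tau\equiv\sum_{k}\sum_{0\le|\mu|\le q}a^{\tau\mu}_k y^k_\mu=0$ with $a^{\tau\mu}_k\in k$, and it defines $M=Dy/D\Phi$, where $D\Phi$ is the submodule generated by the $\Phi^\tau$. Involution: a multi-index $\mu=(\mu_1,\dots,\mu_n)$ (and the jet $y^k_\mu$) is of class $i$ if $\mu_1=\dots=\mu_{i-1}=0$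 and $\mu_i\neq0$. After a linear change of the derivations $d_1,\dots,d_n$ if necessary, one solves the equations of order $q$ for the maximum possible number of jets of order $q$ and class $n$, then the remaining ones for the maximum number of jets of class $n-1$, and so on down to class $1$ (solved form); an equation solved for a jet of class $i$ is called an equation of class $i$. For an equation of order $q$ and class $i$, $d_1,\dots,d_i$ are called multiplicative and $d_{i+1},\dots,d_n$ nonmultiplicative; for an equation of order $\le q-1$ all of $d_1,\dots,d_n$ are nonmultiplicative. The system is involutive if each prolongation $d_j\Phi^\tau$ with respect to a nonmultiplicative $d_j$ is a linear combination over $k$ of the equations of the system and of their prolongations with respect to multiplicative derivations. Codimension: for a nonzero finitely generated $D$-module $N$, $cd_D(N)=n-d(N)$, where $d(N)$ is the (Krull) dimension of $D/\mathrm{ann}_D(N)$; the zero module is regarded as having codimension greater than every $r$. For $0\le r\le n$, $t_r(M)=\{m\in M\mid cd_D(Dm)>r\}$, the greatest $D$-submodule of $M$ of codimension $>r$ (or zero), and $t_{-1}(M)=M$. The module $M$ is called $r$-pure if $t_r(M)=0$ and $t_{r-1}(M)=M$; equivalently $cd_D(Dm)=r$ for all $0\neq m\in M$. *)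

theory Defs
  imports
    "HOL-Algebra.Module"
    "HOL-Algebra.QuotRing"
    "HOL-Algebra.Generated_Groups"
    "HOL-Algebra.Free_Abelian_Groups"
    "HOL-Library.Poly_Mapping"
    "HOL-Library.Extended_Nat"
    "HOL-Computational_Algebra.Fraction_Field"
begin

section \<open>Modules over a commutative ring\<close>

definition submodule_generated ::
    "('a, 'c) ring_scheme \<Rightarrow> ('a, 'b, 'd) module_scheme \<Rightarrow> 'b set \<Rightarrow> 'b set"
  where "submodule_generated R M S = \<Inter>{H. submodule H R M \<and> S \<subseteq> H}"

text \<open>Quotient \<open>M/N\<close>, with cosets of \<open>N\<close> as elements. The fields \<open>mult\<close> and \<open>one\<close>
  are inherited from the ring record and have no meaning for a module.\<close>

definition quotient_module :: "('a, 'b, 'd) module_scheme \<Rightarrow> 'b set \<Rightarrow> ('a, 'b set) module"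
  where "quotient_module M N =
    \<lparr>carrier = a_rcosets\<^bsub>M\<^esub> N, monoid.mult = undefined, one = undefined,
     ring.zero = N, ring.add = set_add M,
     smult = (\<lambda>a C. \<Union>x\<in>C. N +>\<^bsub>M\<^esub> (a \<odot>\<^bsub>M\<^esub> x))\<rparr>"

definition annihilator :: "('a, 'c) ring_scheme \<Rightarrow> ('a, 'b, 'd) module_scheme \<Rightarrow> 'a set"
  where "annihilator R N = {a \<in> carrier R. \<forall>x\<in>carrier N. a \<odot>\<^bsub>N\<^esub> x = \<zero>\<^bsub>N\<^esub>}"

definition cyclic_submodule ::
    "('a, 'c) ring_scheme \<Rightarrow> ('a, 'b) module \<Rightarrow> 'b \<Rightarrow> ('a, 'b) module"
  where "cyclic_submodule R M x = M\<lparr>carrier := {a \<odot>\<^bsub>M\<^esub> x | a. a \<in> carrier R}\<rparr>"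

definition krull_dim :: "('a, 'c) ring_scheme \<Rightarrow> enat"
  where "krull_dim R = Sup {enat l | l. \<exists>P :: nat \<Rightarrow> 'a set.
           (\<forall>i\<le>l. primeideal (P i) R) \<and> (\<forall>i<l. P i \<subset> P (Suc i))}"

text \<open>The tensor product \<open>P \<otimes>\<^sub>A N\<close> as an abelian group: the free abelian group on
  \<open>P \<times> N\<close> modulo the subgroup generated by the bilinearity relations. Like all groups of
  \<^term>\<open>free_Abelian_group\<close> and its quotients, it is a \<open>monoid\<close> record whose \<open>mult\<close> is the
  addition.\<close>

definition tensor_relations ::
    "('a, 'c) ring_scheme \<Rightarrow> ('a, 'p, 'd) module_scheme \<Rightarrow> ('a, 'b, 'e) module_scheme
      \<Rightarrow> ('p \<times> 'b \<Rightarrow>\<^sub>0 int) set"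
  where "tensor_relations A P N =
      {frag_of (p \<oplus>\<^bsub>P\<^esub> p', x) - frag_of (p, x) - frag_of (p', x) | p p' x.
         p \<in> carrier P \<and> p' \<in> carrier P \<and> x \<in> carrier N}
    \<union> {frag_of (p, x \<oplus>\<^bsub>N\<^esub> x') - frag_of (p, x) - frag_of (p, x') | p x x'.
         p \<in> carrier P \<and> x \<in> carrier N \<and> x' \<in> carrier N}
    \<union> {frag_of (a \<odot>\<^bsub>P\<^esub> p, x) - frag_of (p, a \<odot>\<^bsub>N\<^esub> x) | a p x.
         a \<in> carrier A \<and> p \<in> carrier P \<and> x \<in> carrier N}"

definition tensor_null ::
    "('a, 'c) ring_scheme \<Rightarrow> ('a, 'p, 'd) module_scheme \<Rightarrow> ('a, 'b, 'e) module_scheme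
      \<Rightarrow> ('p \<times> 'b \<Rightarrow>\<^sub>0 int) set"
  where "tensor_null A P N =
    generate (free_Abelian_group (carrier P \<times> carrier N)) (tensor_relations A P N)"

definition tensor_product ::
    "('a, 'c) ring_scheme \<Rightarrow> ('a, 'p, 'd) module_scheme \<Rightarrow> ('a, 'b, 'e) module_scheme
      \<Rightarrow> ('p \<times> 'b \<Rightarrow>\<^sub>0 int) set monoid"
  where "tensor_product A P N =
    free_Abelian_group (carrier P \<times> carrier N) Mod tensor_null A P N"

definition tensor_elem ::
    "('a, 'c) ring_scheme \<Rightarrow> ('a, 'p, 'd) module_scheme \<Rightarrow> ('a, 'b, 'e) module_scheme
      \<Rightarrow> 'p \<Rightarrow> 'b \<Rightarrow> ('p \<times> 'b \<Rightarrow>\<^sub>0 int) set"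
  where "tensor_elem A P N p x =
    tensor_null A P N #>\<^bsub>free_Abelian_group (carrier P \<times> carrier N)\<^esub> frag_of (p, x)"

text \<open>\<open>0 \<rightarrow> G \<rightarrow> H\<close> is a sequence of groups, exact at \<open>G\<close>.\<close>

definition left_exact ::
    "('a, 'c) monoid_scheme \<Rightarrow> ('b, 'd) monoid_scheme \<Rightarrow> ('a \<Rightarrow> 'b) \<Rightarrow> bool"
  where "left_exact G H f \<longleftrightarrow> f \<in> hom G H \<and> kernel G H f = {\<one>\<^bsub>G\<^esub>}"


section \<open>The ring of differential operators with constant coefficients\<close>

text \<open>Polynomials in \<open>d\<^sub>1, d\<^sub>2, \<dots>\<close>; a multi-index \<open>\<mu>\<close> assigns to \<open>i\<close> the exponent \<open>\<mu>\<^sub>i\<close> of \<open>d\<^sub>i\<close>.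
  The same type serves all \<open>n\<close>: \<open>diff_ring n\<close> is the subring \<open>k[d\<^sub>1,\<dots>,d\<^sub>n]\<close>, and for \<open>j \<le> n\<close>
  \<open>diff_ring j\<close> is a subring of \<open>diff_ring n\<close>.\<close>

type_synonym multi_index = "nat \<Rightarrow>\<^sub>0 nat"
type_synonym 'k dop = "multi_index \<Rightarrow>\<^sub>0 'k"

definition diff_ring :: "nat \<Rightarrow> 'k::field_char_0 dop ring"
  where "diff_ring n =
    \<lparr>carrier = {P. \<forall>\<mu>\<in>Poly_Mapping.keys P. Poly_Mapping.keys \<mu> \<subseteq> {1..n}},
     monoid.mult = (*), one = 1, ring.zero = 0, ring.add = (+)\<rparr>"

definition der :: "nat \<Rightarrow> 'k::field_char_0 dop"
  where "der i = Poly_Mapping.single (Poly_Mapping.single i 1) 1"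

definition const :: "'k::field_char_0 \<Rightarrow> 'k dop"
  where "const c = Poly_Mapping.single 0 c"

text \<open>\<open>k(\<chi>\<^sub>1,\<dots>,\<chi>\<^sub>j)\<close> as a module over \<open>k[d\<^sub>1,\<dots>,d\<^sub>j]\<close>, realised inside the field of fractions of
  the polynomials in all variables.\<close>

definition chi_field :: "nat \<Rightarrow> ('k::field_char_0 dop, 'k dop fract) module"
  where "chi_field j =
    \<lparr>carrier = {Fract a b | a b. a \<in> carrier (diff_ring j) \<and> b \<in> carrier (diff_ring j) \<and> b \<noteq> 0},
     monoid.mult = (*), one = 1, ring.zero = 0, ring.add = (+),
     smult = (\<lambda>a z. Fract a 1 * z)\<rparr>"

text \<open>\<open>k(\<chi>\<^sub>1,\<dots>,\<chi>\<^sub>j) \<otimes> M\<close> over \<open>k[d\<^sub>1,\<dots>,d\<^sub>j]\<close>, where the \<open>k[d\<^sub>1,\<dots>,d\<^sub>n]\<close>-module \<open>M\<close> is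
  regarded as a module over the subring.\<close>

abbreviation partial_localization ::
    "nat \<Rightarrow> ('k::field_char_0 dop, 'b) module \<Rightarrow> ('k dop fract \<times> 'b \<Rightarrow>\<^sub>0 int) set monoid"
  where "partial_localization j M \<equiv> tensor_product (diff_ring j) (chi_field j) M"

abbreviation localization_map ::
    "nat \<Rightarrow> ('k::field_char_0 dop, 'b) module \<Rightarrow> 'b \<Rightarrow> ('k dop fract \<times> 'b \<Rightarrow>\<^sub>0 int) set"
  where "localization_map j M \<equiv> (\<lambda>x. tensor_elem (diff_ring j) (chi_field j) M 1 x)"


section \<open>Codimension and purity\<close>

text \<open>The codimension of the zero module is \<open>\<infinity>\<close>.\<close>

definition cd :: "nat \<Rightarrow> ('k::field_char_0 dop, 'b) module \<Rightarrow> enat"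
  where "cd n N =
    (if carrier N = {\<zero>\<^bsub>N\<^esub>} then \<infinity>
     else enat n - krull_dim (diff_ring n Quot annihilator (diff_ring n) N))"

text \<open>\<open>t\<^sub>r(M)\<close>; the index is an integer so that \<open>t\<^sub>-\<^sub>1(M) = M\<close> makes sense.\<close>

definition tsub :: "nat \<Rightarrow> int \<Rightarrow> ('k::field_char_0 dop, 'b) module \<Rightarrow> 'b set"
  where "tsub n r M =
    (if r < 0 then carrier M
     else {x \<in> carrier M. cd n (cyclic_submodule (diff_ring n) M x) > enat (nat r)})"

definition is_pure :: "nat \<Rightarrow> nat \<Rightarrow> ('k::field_char_0 dop, 'b) module \<Rightarrow> bool"
  where "is_pure n r M \<longleftrightarrow> tsub n (int r) M = {\<zero>\<^bsub>M\<^esub>} \<and> tsub n (int r - 1) M = carrier M"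


section \<open>Systems and involution\<close>

text \<open>\<open>Dy = Dy\<^sup>1 + \<dots> + Dy\<^sup>m\<close>: the element \<open>\<Sum>\<^sub>k P\<^sub>k y\<^sup>k\<close> is the function \<open>k \<mapsto> P\<^sub>k\<close>, extended by \<open>0\<close>
  outside \<open>{1..m}\<close>. The coefficient of the jet \<open>y\<^sup>k\<^sub>\<mu>\<close> is the coefficient of \<open>d\<^sub>\<mu>\<close> in \<open>P\<^sub>k\<close>.\<close>

type_synonym jet = "nat \<times> multi_index"

definition Dy :: "nat \<Rightarrow> nat \<Rightarrow> ('k::field_char_0 dop, nat \<Rightarrow> 'k dop) module"
  where "Dy n m =
    \<lparr>carrier = {f. (\<forall>k\<in>{1..m}. f k \<in> carrier (diff_ring n)) \<and> (\<forall>k. k \<notin> {1..m} \<longrightarrow> f k = 0)},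
     monoid.mult = undefined, one = undefined,
     ring.zero = (\<lambda>k. 0), ring.add = (\<lambda>f g k. f k + g k),
     smult = (\<lambda>a f k. a * f k)\<rparr>"

definition jet_coeff :: "(nat \<Rightarrow> 'k::field_char_0 dop) \<Rightarrow> jet \<Rightarrow> 'k"
  where "jet_coeff f v = Poly_Mapping.lookup (f (fst v)) (snd v)"

definition jet_order :: "jet \<Rightarrow> nat"
  where "jet_order v = (\<Sum>i\<in>Poly_Mapping.keys (snd v). Poly_Mapping.lookup (snd v) i)"

text \<open>A relation rather than a function, since \<open>\<mu> = 0\<close> has no class.\<close>

definition has_class :: "jet \<Rightarrow> nat \<Rightarrow> bool"
  where "has_class v i \<longleftrightarrow> 1 \<le> i \<and> Poly_Mapping.lookup (snd v) i \<noteq> 0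
           \<and> (\<forall>j. 1 \<le> j \<and> j < i \<longrightarrow> Poly_Mapping.lookup (snd v) j = 0)"

definition system_of_order ::
    "nat \<Rightarrow> nat \<Rightarrow> nat \<Rightarrow> 'i set \<Rightarrow> ('i \<Rightarrow> nat \<Rightarrow> 'k::field_char_0 dop) \<Rightarrow> bool"
  where "system_of_order n m q T \<Phi> \<longleftrightarrow> finite T \<and>
    (\<forall>\<tau>\<in>T. \<Phi> \<tau> \<in> carrier (Dy n m) \<and> (\<forall>v. jet_coeff (\<Phi> \<tau>) v \<noteq> 0 \<longrightarrow> jet_order v \<le> q))"

definition system_module ::
    "nat \<Rightarrow> nat \<Rightarrow> 'i set \<Rightarrow> ('i \<Rightarrow> nat \<Rightarrow> 'k::field_char_0 dop)
      \<Rightarrow> ('k dop, (nat \<Rightarrow> 'k dop) set) module"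
  where "system_module n m T \<Phi> =
    quotient_module (Dy n m) (submodule_generated (diff_ring n) (Dy n m) (\<Phi> ` T))"

text \<open>The equations of a system of order \<open>q\<close> that are of order \<open>q\<close>; all others have order
  \<open>\<le> q - 1\<close>.\<close>

definition top_eqs :: "nat \<Rightarrow> 'i set \<Rightarrow> ('i \<Rightarrow> nat \<Rightarrow> 'k::field_char_0 dop) \<Rightarrow> 'i set"
  where "top_eqs q T \<Phi> = {\<tau>\<in>T. \<exists>v. jet_order v = q \<and> jet_coeff (\<Phi> \<tau>) v \<noteq> 0}"

text \<open>The equation \<open>\<Phi>\<^sup>\<tau>\<close> of order \<open>q\<close> is solved for its principal jet \<open>pri \<tau>\<close>, and principal jets
  do not occur in the other equations. The last condition says that the number of equations
  solved for jets of class \<open>n\<close>, then \<open>n - 1\<close>, and so on, is maximal: the equations remaining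
  after those solved for jets of class \<open>\<ge> i\<close> contain no jet of order \<open>q\<close> and class \<open>\<ge> i\<close>, so that
  no further one can be solved for such a jet.\<close>

definition solved_form ::
    "nat \<Rightarrow> 'i set \<Rightarrow> ('i \<Rightarrow> nat \<Rightarrow> 'k::field_char_0 dop) \<Rightarrow> ('i \<Rightarrow> jet) \<Rightarrow> bool"
  where "solved_form q T \<Phi> pri \<longleftrightarrow> (\<forall>\<tau>\<in>top_eqs q T \<Phi>.
      jet_order (pri \<tau>) = q \<and>
      jet_coeff (\<Phi> \<tau>) (pri \<tau>) = 1 \<and>
      (\<forall>\<sigma>\<in>T. \<sigma> \<noteq> \<tau> \<longrightarrow> jet_coeff (\<Phi> \<sigma>) (pri \<tau>) = 0) \<and>
      (\<exists>i. has_class (pri \<tau>) i \<and>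
        (\<forall>v j. jet_order v = q \<and> has_class v j \<and> i < j \<longrightarrow> jet_coeff (\<Phi> \<tau>) v = 0)))"

text \<open>The indices of the multiplicative derivations of the equation \<open>\<tau>\<close>.\<close>

definition multiplicative ::
    "nat \<Rightarrow> nat \<Rightarrow> 'i set \<Rightarrow> ('i \<Rightarrow> nat \<Rightarrow> 'k::field_char_0 dop) \<Rightarrow> ('i \<Rightarrow> jet) \<Rightarrow> 'i \<Rightarrow> nat set"
  where "multiplicative n q T \<Phi> pri \<tau> =
    {j \<in> {1..n}. \<tau> \<in> top_eqs q T \<Phi> \<and> (\<exists>i. has_class (pri \<tau>) i \<and> j \<le> i)}"

definition involutive_solved ::
    "nat \<Rightarrow> nat \<Rightarrow> nat \<Rightarrow> 'i set \<Rightarrow> ('i \<Rightarrow> nat \<Rightarrow> 'k::field_char_0 dop) \<Rightarrow> bool"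
  where "involutive_solved n m q T \<Phi> \<longleftrightarrow>
    system_of_order n m q T \<Phi> \<and>
    (\<exists>pri. solved_form q T \<Phi> pri \<and>
      (\<forall>\<tau>\<in>T. \<forall>j\<in>{1..n} - multiplicative n q T \<Phi> pri \<tau>.
        \<exists>(a :: 'i \<Rightarrow> 'k) (b :: 'i \<Rightarrow> nat \<Rightarrow> 'k). \<forall>k.
          der j * \<Phi> \<tau> k =
            (\<Sum>\<sigma>\<in>T. const (a \<sigma>) * \<Phi> \<sigma> k)
          + (\<Sum>\<sigma>\<in>T. \<Sum>i\<in>multiplicative n q T \<Phi> pri \<sigma>. const (b \<sigma> i) * (der i * \<Phi> \<sigma> k))))"

end

theory Submission
  imports Defs "HOL-Library.Function_Algebras"
begin

text \<open>Let \<open>j\<close> be the largest class of a jet of order \<open>q\<close> that is not principal. Since all jets of order \<open>q\<close> and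
  higher class are principal, \<open>M\<close> is finitely generated over \<open>k[d\<^sub>1,\<dots>,d\<^sub>j]\<close>. By involution the
  multiplicative prolongations span \<open>D\<Phi>\<close>, so the multiples of that one jet by \<open>k[d\<^sub>1,\<dots>,d\<^sub>j]\<close> are free in \<open>M\<close>
  and no nonzero element of \<open>k[d\<^sub>1,\<dots>,d\<^sub>j]\<close> annihilates \<open>M\<close>. So \<open>D/ann M\<close> is an integral extension of
  \<open>k[d\<^sub>1,\<dots>,d\<^sub>j]\<close>, whence \<open>j = n - r\<close>. For \<open>x \<noteq> 0\<close> in \<open>M\<close>, the ring \<open>D/ann x\<close> is integral over the image of
  \<open>k[d\<^sub>1,\<dots>,d\<^sub>j]\<close>, so its dimension is \<open>j\<close> or smaller than \<open>j\<close> according to whether \<open>x\<close> is torsion-free over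
  \<open>k[d\<^sub>1,\<dots>,d\<^sub>j]\<close>. Hence \<open>t\<^sub>r(M)\<close> is the torsion submodule over \<open>k[d\<^sub>1,\<dots>,d\<^sub>j]\<close>, which is also the kernel of
  the localization map, and \<open>t\<^sub>r\<^sub>-\<^sub>1(M) = M\<close>.\<close>

section \<open>Polynomials and their ideals\<close>

text \<open>The principal jets are singled out class by class, which need not agree with any term
  order, so leading terms need another source. It is the weight in which \<open>d_i\<close> counts
  \<open>i\<close>. A multiplicative prolongation \<open>d_\<nu>\<close> uses only indices up to the
  class of the principal jet, and that jet has only indices from its class upwards. So if the
  prolonged principal jet also arises from a factor of the same degree as \<nu>, that factor has at
  least the weight of \<nu>, with equality only for \<nu> itself. Hence in any combination the
  prolongation of greatest degree, and then of greatest weight, contributes a jet that nothing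
  cancels. Both the rewriting of nonmultiplicative prolongations and the freeness of the parametric
  jet rest on this.

  The dimension \<open>j\<close> of an integral extension has two halves. Chains of primes contract
  to strict chains in \<open>k[d_1,...,d_j]\<close>, where elements separating successive primes are
  algebraically independent. A chain of length \<open>j\<close> is built by adjoining
  \<open>d_j\<close>, then \<open>d_(j-1)\<close>, and so on, each time to a prime that meets the
  ring of the remaining derivations only in 0.\<close>

abbreviation DR :: "nat \<Rightarrow> 'k::field_char_0 dop set"
  where "DR n \<equiv> carrier (diff_ring n)"

lemma DR_iff: "P \<in> DR n \<longleftrightarrow> (\<forall>\<mu>\<in>Poly_Mapping.keys P. Poly_Mapping.keys \<mu> \<subseteq> {1..n})"
  by (simp add: diff_ring_def)

lemma diff_ring_simps [simp]:
  "a \<otimes>\<^bsub>diff_ring n\<^esub> b = a * b" "\<one>\<^bsub>diff_ring n\<^esub> = 1"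
  "\<zero>\<^bsub>diff_ring n\<^esub> = 0" "a \<oplus>\<^bsub>diff_ring n\<^esub> b = a + b"
  by (simp_all add: diff_ring_def)

lemma keys_add_multi_index:
  fixes a b :: multi_index
  shows "Poly_Mapping.keys (a + b) = Poly_Mapping.keys a \<union> Poly_Mapping.keys b"
  by (auto simp: in_keys_iff lookup_add)

lemma DR_zero [simp, intro]: "0 \<in> DR n" and DR_one [simp, intro]: "1 \<in> DR n"
  by (auto simp: DR_iff)

lemma DR_single: "Poly_Mapping.keys \<mu> \<subseteq> {1..n} \<Longrightarrow> Poly_Mapping.single \<mu> c \<in> DR n"
  by (auto simp: DR_iff)

lemma DR_const [simp, intro]: "const c \<in> DR n"
  by (auto simp: DR_iff const_def)

lemma DR_der [simp, intro]: "i \<in> {1..n} \<Longrightarrow> der i \<in> DR n"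
  by (auto simp: DR_iff der_def)

lemma DR_add [intro]: "a \<in> DR n \<Longrightarrow> b \<in> DR n \<Longrightarrow> a + b \<in> DR n"
  using keys_add[of a b] by (auto simp: DR_iff)

lemma DR_uminus [intro]: "a \<in> DR n \<Longrightarrow> - a \<in> DR n"
  by (auto simp: DR_iff)

lemma DR_mult [intro]: "a \<in> DR n \<Longrightarrow> b \<in> DR n \<Longrightarrow> a * b \<in> DR n"
  using keys_mult[of a b] by (fastforce simp: DR_iff keys_add_multi_index)

lemma DR_power [intro]: "a \<in> DR n \<Longrightarrow> a ^ k \<in> DR n"
  by (induction k) auto

lemma DR_sum [intro]: "(\<And>x. x \<in> A \<Longrightarrow> f x \<in> DR n) \<Longrightarrow> sum f A \<in> DR n"
  by (induction A rule: infinite_finite_induct) auto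

lemma DR_mono: "i \<le> j \<Longrightarrow> DR i \<subseteq> DR j"
  by (fastforce simp: DR_iff)

lemma cring_diff_ring: "cring (diff_ring n :: 'k::field_char_0 dop ring)"
proof (rule cringI)
  show "abelian_group (diff_ring n :: 'k dop ring)"
  proof (rule abelian_groupI)
    fix x :: "'k dop" assume "x \<in> DR n"
    then show "\<exists>y\<in>DR n. y \<oplus>\<^bsub>diff_ring n\<^esub> x = \<zero>\<^bsub>diff_ring n\<^esub>"
      by (intro bexI[of _ "- x"]) auto
  qed (auto simp: algebra_simps)
  show "comm_monoid (diff_ring n :: 'k dop ring)"
    by (rule comm_monoidI) (auto simp: algebra_simps)
qed (auto simp: algebra_simps)

lemma poly_mapping_eq_sum_single:
  "P = (\<Sum>\<mu>\<in>Poly_Mapping.keys P. Poly_Mapping.single \<mu> (Poly_Mapping.lookup P \<mu>))"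
proof (rule poly_mapping_eqI)
  fix w
  have "Poly_Mapping.lookup (\<Sum>\<mu>\<in>Poly_Mapping.keys P. Poly_Mapping.single \<mu> (Poly_Mapping.lookup P \<mu>)) w
    = (\<Sum>\<mu>\<in>Poly_Mapping.keys P. if \<mu> = w then Poly_Mapping.lookup P w else 0)"
    by (auto simp: lookup_sum lookup_single when_def intro!: sum.cong)
  also have "\<dots> = Poly_Mapping.lookup P w"
    by (auto simp: in_keys_iff)
  finally show "Poly_Mapping.lookup P w = Poly_Mapping.lookup (\<Sum>\<mu>\<in>Poly_Mapping.keys P. Poly_Mapping.single \<mu> (Poly_Mapping.lookup P \<mu>)) w"
    by simp
qed

lemma lookup_single_mult:
  fixes P :: "'k::field_char_0 dop"
  shows "Poly_Mapping.lookup (Poly_Mapping.single \<nu> c * P) w =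
    (\<Sum>u\<in>Poly_Mapping.keys P. if w = \<nu> + u then c * Poly_Mapping.lookup P u else 0)"
proof -
  have "Poly_Mapping.single \<nu> c * P =
    (\<Sum>u\<in>Poly_Mapping.keys P. Poly_Mapping.single (\<nu> + u) (c * Poly_Mapping.lookup P u))"
    by (subst (1) poly_mapping_eq_sum_single[of P]) (simp add: sum_distrib_left mult_single)
  then show ?thesis
    by (auto simp: lookup_sum lookup_single when_def intro!: sum.cong)
qed

lemma lookup_single_mult_add:
  fixes P :: "'k::field_char_0 dop"
  shows "Poly_Mapping.lookup (Poly_Mapping.single \<nu> c * P) (\<nu> + u) = c * Poly_Mapping.lookup P u"
proof -
  have "Poly_Mapping.lookup (Poly_Mapping.single \<nu> c * P) (\<nu> + u) =
    (\<Sum>u'\<in>Poly_Mapping.keys P. if u = u' then c * Poly_Mapping.lookup P u else 0)"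
    unfolding lookup_single_mult by (intro sum.cong) auto
  then show ?thesis by (auto simp: in_keys_iff)
qed

lemma lookup_single_mult_nonzero:
  fixes P :: "'k::field_char_0 dop"
  assumes "Poly_Mapping.lookup (Poly_Mapping.single \<nu> c * P) w \<noteq> 0"
  obtains u where "w = \<nu> + u" "Poly_Mapping.lookup P u \<noteq> 0"
proof -
  obtain u where "u \<in> Poly_Mapping.keys P" "(if w = \<nu> + u then c * Poly_Mapping.lookup P u else 0) \<noteq> 0"
    using assms unfolding lookup_single_mult by (rule sum.not_neutral_contains_not_neutral)
  then show ?thesis using that by (auto split: if_splits)
qed

lemma const_mult_const: "const (a * b) = const a * const b"
  by (simp add: const_def mult_single)
lemma const_add: "const (a + b) = const a + const b"
  by (simp add: const_def single_add)
lemma const_zero [simp]: "const 0 = 0" by (simp add: const_def)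
lemma const_one [simp]: "const 1 = 1" by (simp add: const_def)
lemma lookup_const_mult: "Poly_Mapping.lookup (const c * P) w = c * Poly_Mapping.lookup (P :: 'k::field_char_0 dop) w"
  using lookup_single_mult_add[of 0 c P w] by (simp add: const_def)

text \<open>Closure conditions in type class arithmetic replace the record-based notion from here
  on. Negatives come for free, as multiples by \<open>- 1\<close>.\<close>

lemma ideal_diff_ring_iff:
  "ideal I (diff_ring n) \<longleftrightarrow> I \<subseteq> DR n \<and> 0 \<in> I \<and> (\<forall>a\<in>I. \<forall>b\<in>I. a + b \<in> I)
     \<and> (\<forall>a\<in>I. \<forall>b\<in>DR n. b * a \<in> (I :: 'k::field_char_0 dop set))"
proof
  interpret cring "diff_ring n :: 'k dop ring" by (rule cring_diff_ring)
  show "I \<subseteq> DR n \<and> 0 \<in> I \<and> (\<forall>a\<in>I. \<forall>b\<in>I. a + b \<in> I) \<and> (\<forall>a\<in>I. \<forall>b\<in>DR n. b * a \<in> I)" if "ideal I (diff_ring n)"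
  proof -
    interpret I: ideal I "diff_ring n" by fact
    show ?thesis using I.a_subset I.a_closed I.I_l_closed I.zero_closed by auto
  qed
  assume I: "I \<subseteq> DR n \<and> 0 \<in> I \<and> (\<forall>a\<in>I. \<forall>b\<in>I. a + b \<in> I) \<and> (\<forall>a\<in>I. \<forall>b\<in>DR n. b * a \<in> I)"
  show "ideal I (diff_ring n)"
  proof (rule idealI)
    show "ring (diff_ring n :: 'k dop ring)" ..
    show "subgroup I (add_monoid (diff_ring n))"
    proof (rule add.subgroupI)
      fix a assume "a \<in> I"
      then have "- 1 * a \<in> I" "a \<in> DR n" using I DR_uminus[OF DR_one] by blast+
      moreover have "\<ominus>\<^bsub>diff_ring n\<^esub> a = - a"
        by (rule minus_equality) (use \<open>a \<in> DR n\<close> in auto)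
      ultimately show "\<ominus>\<^bsub>diff_ring n\<^esub> a \<in> I" by simp
    qed (use I in auto)
  qed (use I in \<open>auto simp: mult.commute\<close>)
qed

lemma primeideal_diff_ring_iff:
  "primeideal P (diff_ring n) \<longleftrightarrow> ideal P (diff_ring n) \<and> 1 \<notin> P \<and>
    (\<forall>a\<in>DR n. \<forall>b\<in>DR n. a * b \<in> P \<longrightarrow> a \<in> P \<or> b \<in> (P :: 'k::field_char_0 dop set))"
proof
  assume "primeideal P (diff_ring n)"
  then interpret P: primeideal P "diff_ring n" .
  have "1 \<notin> P" using P.one_imp_carrier P.I_notcarr by auto
  then show "ideal P (diff_ring n) \<and> 1 \<notin> P \<and>
    (\<forall>a\<in>DR n. \<forall>b\<in>DR n. a * b \<in> P \<longrightarrow> a \<in> P \<or> b \<in> (P :: 'k::field_char_0 dop set))"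
    using P.I_prime P.is_ideal by auto
next
  assume *: "ideal P (diff_ring n) \<and> 1 \<notin> P \<and>
    (\<forall>a\<in>DR n. \<forall>b\<in>DR n. a * b \<in> P \<longrightarrow> a \<in> P \<or> b \<in> (P :: 'k::field_char_0 dop set))"
  show "primeideal P (diff_ring n)"
    by (rule primeidealI) (use * in \<open>auto simp: cring_diff_ring\<close>)
qed

lemma ideal_diff_ring_minus:
  assumes "ideal I (diff_ring n)" "a \<in> I" "b \<in> I"
  shows "a - b \<in> (I :: 'k::field_char_0 dop set)"
proof -
  have "a + (- 1) * b \<in> I"
    using assms DR_uminus[OF DR_one] unfolding ideal_diff_ring_iff by blast
  then show ?thesis by simp
qed

text \<open>Preimage and image under the coset map match the primes of the quotient with the primes
  containing \<open>I\<close>, and both preserve strict inclusion. All later arguments about chains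
  can thus stay inside \<open>diff_ring n\<close>.\<close>

lemma krull_dim_Quot:
  fixes R :: "('a, 'c) ring_scheme" (structure)
  assumes "cring R" and "ideal I R"
  shows "krull_dim (R Quot I) = Sup {enat l | l. \<exists>P :: nat \<Rightarrow> 'a set.
           (\<forall>i\<le>l. primeideal (P i) R \<and> I \<subseteq> P i) \<and> (\<forall>i<l. P i \<subset> P (Suc i))}"
proof -
  interpret cring R by fact
  interpret I: ideal I R by fact
  let ?h = "(+>) I"
  note hom = I.rcos_ring_hom
  have Q: "cring (R Quot I)" by (rule I.quotient_is_cring) (rule is_cring)
  have hmult: "?h (a \<otimes> b) = ?h a \<otimes>\<^bsub>R Quot I\<^esub> ?h b" if "a \<in> carrier R" "b \<in> carrier R" for a b
    using ring_hom_mult[OF hom that] .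
  have surj: "carrier (R Quot I) = ?h ` carrier R"
    by (auto simp: FactRing_def A_RCOSETS_def')
  \<comment> \<open>A prime containing \<open>I\<close> is a union of cosets of \<open>I\<close>, so
    membership can be tested on cosets.\<close>
  have mem: "?h a \<in> ?h ` P \<longleftrightarrow> a \<in> P" if "ideal P R" "I \<subseteq> P" "a \<in> carrier R" for P a
  proof
    interpret P: ideal P R by fact
    assume "?h a \<in> ?h ` P"
    then obtain b where b: "b \<in> P" "I +> a = I +> b" by auto
    have "b \<in> carrier R" using b P.a_subset by auto
    then have "a \<ominus> b \<in> I" using b that(3) quotient_eq_iff_same_a_r_cos[OF assms(2)] by blast
    then have "a \<ominus> b \<in> P" using that by auto
    then have "(a \<ominus> b) \<oplus> b \<in> P" using P.a_closed[OF _ b(1)] by blast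
    moreover have "(a \<ominus> b) \<oplus> b = a"
      using that(3) \<open>b \<in> carrier R\<close> by (simp add: a_minus_def a_assoc l_neg)
    ultimately show "a \<in> P" by simp
  qed auto
  have down: "primeideal {a \<in> carrier R. ?h a \<in> P} R \<and> I \<subseteq> {a \<in> carrier R. ?h a \<in> P}"
    if "primeideal P (R Quot I)" for P
  proof
    interpret P: primeideal P "R Quot I" by fact
    show "primeideal {a \<in> carrier R. ?h a \<in> P} R"
    proof (rule primeidealI)
      show "ideal {a \<in> carrier R. ?h a \<in> P} R"
        using ring_hom_ring.ideal_vimage[OF I.rcos_ring_hom_ring P.is_ideal] .
      show "carrier R \<noteq> {a \<in> carrier R. ?h a \<in> P}"
        using P.I_notcarr P.a_subset surj by auto
      fix a b assume ab: "a \<in> carrier R" "b \<in> carrier R" "a \<otimes> b \<in> {a \<in> carrier R. ?h a \<in> P}"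
      then have "?h a \<otimes>\<^bsub>R Quot I\<^esub> ?h b \<in> P" by (simp add: hmult)
      then show "a \<in> {a \<in> carrier R. ?h a \<in> P} \<or> b \<in> {a \<in> carrier R. ?h a \<in> P}"
        using P.I_prime[of "?h a" "?h b"] ab surj by auto
    qed (rule is_cring)
    show "I \<subseteq> {a \<in> carrier R. ?h a \<in> P}"
    proof
      fix a assume "a \<in> I"
      then have "a \<in> carrier R" "?h a = \<zero>\<^bsub>R Quot I\<^esub>"
        using I.a_subset by (auto simp: FactRing_def I.a_rcos_const)
      moreover have "\<zero>\<^bsub>R Quot I\<^esub> \<in> P" by (rule additive_subgroup.zero_closed[OF ideal.axioms(1)[OF P.is_ideal]])
      ultimately show "a \<in> {a \<in> carrier R. ?h a \<in> P}" by simp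
    qed
  qed
  have up: "primeideal (?h ` P) (R Quot I)" if "primeideal P R" "I \<subseteq> P" for P
  proof -
    interpret P: primeideal P R by fact
    note m = mem[OF P.is_ideal that(2)]
    show ?thesis
    proof (rule primeidealI)
      show "ideal (?h ` P) (R Quot I)" by (rule ring_ideal_imp_quot_ideal[OF assms(2) P.is_ideal])
      show "carrier (R Quot I) \<noteq> ?h ` P"
      proof
        assume "carrier (R Quot I) = ?h ` P"
        then have "?h \<one> \<in> ?h ` P" using surj by blast
        then have "\<one> \<in> P" using m[OF one_closed] by iprover
        then show False using P.I_notcarr P.one_imp_carrier by iprover
      qed
      fix a b assume ab: "a \<in> carrier (R Quot I)" "b \<in> carrier (R Quot I)" "a \<otimes>\<^bsub>R Quot I\<^esub> b \<in> ?h ` P"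
      obtain x y where xy: "x \<in> carrier R" "a = ?h x" "y \<in> carrier R" "b = ?h y"
        using ab(1,2) unfolding surj by blast
      have "?h (x \<otimes> y) \<in> ?h ` P" using ab(3) hmult[OF xy(1,3)] xy(2,4) by simp
      then have "x \<otimes> y \<in> P" using m xy(1,3) by blast
      then have "x \<in> P \<or> y \<in> P" using xy(1,3) P.I_prime by blast
      then show "a \<in> ?h ` P \<or> b \<in> ?h ` P" using xy(2,4) by blast
    qed (rule Q)
  qed
  have "(\<exists>P. (\<forall>i\<le>l. primeideal (P i) (R Quot I)) \<and> (\<forall>i<l. P i \<subset> P (Suc i))) \<longleftrightarrow>
    (\<exists>P. (\<forall>i\<le>l. primeideal (P i) R \<and> I \<subseteq> P i) \<and> (\<forall>i<l. P i \<subset> P (Suc i)))" for l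
  proof
    assume "\<exists>P. (\<forall>i\<le>l. primeideal (P i) (R Quot I)) \<and> (\<forall>i<l. P i \<subset> P (Suc i))"
    then obtain P where P: "\<forall>i\<le>l. primeideal (P i) (R Quot I)" "\<forall>i<l. P i \<subset> P (Suc i)" by auto
    define P' where "P' i = {a \<in> carrier R. ?h a \<in> P i}" for i
    have "P' i \<subset> P' (Suc i)" if i: "i < l" for i
    proof
      show "P' i \<subseteq> P' (Suc i)" using P i by (auto simp: P'_def)
      interpret P: primeideal "P (Suc i)" "R Quot I" using P i by auto
      obtain x where "x \<in> P (Suc i)" "x \<notin> P i" using P i by blast
      moreover have "x \<in> ?h ` carrier R" using \<open>x \<in> P (Suc i)\<close> P.a_subset surj by auto
      ultimately show "P' i \<noteq> P' (Suc i)" by (auto simp: P'_def)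
    qed
    then show "\<exists>P. (\<forall>i\<le>l. primeideal (P i) R \<and> I \<subseteq> P i) \<and> (\<forall>i<l. P i \<subset> P (Suc i))"
      using down P by (intro exI[of _ P']) (auto simp: P'_def)
  next
    assume "\<exists>P. (\<forall>i\<le>l. primeideal (P i) R \<and> I \<subseteq> P i) \<and> (\<forall>i<l. P i \<subset> P (Suc i))"
    then obtain P where P: "\<forall>i\<le>l. primeideal (P i) R \<and> I \<subseteq> P i" "\<forall>i<l. P i \<subset> P (Suc i)" by auto
    have "?h ` P i \<subset> ?h ` P (Suc i)" if i: "i < l" for i
    proof
      show "?h ` P i \<subseteq> ?h ` P (Suc i)" using P i by blast
      interpret P: primeideal "P (Suc i)" R using P i by auto
      interpret P': primeideal "P i" R using P i by auto
      obtain x where "x \<in> P (Suc i)" "x \<notin> P i" using P i by blast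
      then have "?h x \<notin> ?h ` P i" using mem[OF P'.is_ideal] P(1) i P.a_subset by auto
      then show "?h ` P i \<noteq> ?h ` P (Suc i)" using \<open>x \<in> P (Suc i)\<close> by auto
    qed
    then show "\<exists>P. (\<forall>i\<le>l. primeideal (P i) (R Quot I)) \<and> (\<forall>i<l. P i \<subset> P (Suc i))"
      using up P by (intro exI[of _ "\<lambda>i. ?h ` P i"]) auto
  qed
  then show ?thesis by (simp add: krull_dim_def)
qed

section \<open>Dimension of integral extensions\<close>

text \<open>Integrality of \<open>D/I\<close> over the image of \<open>k[d_1,...,d_j]\<close>,
  stated with representatives so that no quotient ring occurs. The degree \<open>N = 0\<close> is
  allowed, but then the relation says \<open>1 \<in> I\<close>.\<close>

definition integral_mod :: "nat \<Rightarrow> nat \<Rightarrow> 'k::field_char_0 dop set \<Rightarrow> bool"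
  where "integral_mod n j I \<longleftrightarrow>
    (\<forall>a\<in>DR n. \<exists>N c. (\<forall>i<N. c i \<in> DR j) \<and> a ^ N + (\<Sum>i<N. c i * a ^ i) \<in> I)"

lemma integral_mod_mono: "integral_mod n j I \<Longrightarrow> I \<subseteq> J \<Longrightarrow> integral_mod n j J"
  unfolding integral_mod_def by blast

text \<open>Incomparability for integral extensions. For \<open>x\<close> in \<open>Q\<close> but
  not in \<open>P\<close>, a monic relation modulo \<open>P\<close> of least degree reads
  \<open>c 0 + x * y \<in> P\<close>. Minimality keeps \<open>y\<close> out of \<open>P\<close>,
  hence also \<open>x * y\<close> and \<open>c 0\<close>, whereas \<open>c 0 \<in> Q\<close> because
  \<open>x \<in> Q\<close>.\<close>

lemma prime_contraction_strict:
  fixes P :: "'k::field_char_0 dop set"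
  assumes P: "primeideal P (diff_ring n)" and Q: "primeideal Q (diff_ring n)"
    and "P \<subset> Q" and int: "integral_mod n j P" and "j \<le> n"
  shows "P \<inter> DR j \<subset> Q \<inter> DR j"
proof -
  have iP: "ideal P (diff_ring n)" and iQ: "ideal Q (diff_ring n)" and "1 \<notin> P"
    using P Q by (auto simp: primeideal_diff_ring_iff)
  have jn: "DR j \<subseteq> (DR n :: 'k dop set)" using \<open>j \<le> n\<close> by (rule DR_mono)
  obtain x where x: "x \<in> Q" "x \<notin> P" using \<open>P \<subset> Q\<close> by blast
  have xn: "x \<in> DR n" using x iQ by (auto simp: ideal_diff_ring_iff)
  let ?R = "\<lambda>N. \<exists>c. (\<forall>i<N. c i \<in> DR j) \<and> x ^ N + (\<Sum>i<N. c i * x ^ i) \<in> P"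
  define N where "N = (LEAST N. ?R N)"
  have "\<exists>N. ?R N" using int xn unfolding integral_mod_def by blast
  then have "?R N" unfolding N_def by (rule LeastI_ex)
  then obtain c where c: "\<forall>i<N. c i \<in> DR j" "x ^ N + (\<Sum>i<N. c i * x ^ i) \<in> P" by auto
  have "N \<noteq> 0"
  proof
    assume "N = 0"
    then show False using c(2) \<open>1 \<notin> P\<close> by simp
  qed
  then obtain K where K: "N = Suc K" by (cases N) auto
  define y where "y = x ^ K + (\<Sum>i<K. c (Suc i) * x ^ i)"
  have "x ^ N + (\<Sum>i<N. c i * x ^ i) = c 0 + x * y"
    unfolding K y_def sum.lessThan_Suc_shift by (simp add: algebra_simps sum_distrib_left)
  then have cy: "c 0 + x * y \<in> P" using c by simp
  have yn: "y \<in> DR n" unfolding y_def using xn c(1) jn K by (intro DR_add DR_power DR_sum DR_mult) auto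
  have "y \<notin> P"
  proof
    assume "y \<in> P"
    then have "?R K" unfolding y_def using c(1) K by (intro exI[of _ "\<lambda>i. c (Suc i)"]) auto
    then have "N \<le> K" unfolding N_def by (rule Least_le)
    then show False using K by simp
  qed
  then have "x * y \<notin> P" using P x xn yn unfolding primeideal_diff_ring_iff by blast
  moreover have "c 0 \<in> P \<Longrightarrow> x * y \<in> P"
    using ideal_diff_ring_minus[OF iP cy, of "c 0"] by simp
  ultimately have "c 0 \<notin> P" by blast
  moreover have "x * y \<in> Q" using iQ x(1) yn unfolding ideal_diff_ring_iff by (metis mult.commute)
  then have "c 0 \<in> Q"
    using ideal_diff_ring_minus[OF iQ, of "c 0 + x * y" "x * y"] cy \<open>P \<subset> Q\<close> by auto
  ultimately show ?thesis using \<open>P \<subset> Q\<close> c(1) K by blast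
qed

lemma primeideal_contraction:
  assumes "primeideal P (diff_ring n)" and "j \<le> n"
  shows "primeideal (P \<inter> DR j) (diff_ring j)"
  using assms DR_mono[OF assms(2)]
  unfolding primeideal_diff_ring_iff ideal_diff_ring_iff by (auto; blast)

lemma primeideal_diff_ring_zero: "primeideal {0} (diff_ring j)"
  unfolding primeideal_diff_ring_iff ideal_diff_ring_iff by auto

lemma primeideal_power:
  assumes "primeideal P (diff_ring n)" "x \<in> DR n" "x ^ k \<in> P"
  shows "x \<in> P"
  using assms(3)
proof (induction k)
  case 0
  then show ?case using assms(1) by (auto simp: primeideal_diff_ring_iff)
next
  case (Suc k)
  then show ?case using assms(1,2) DR_power[OF assms(2), of k]
    unfolding primeideal_diff_ring_iff by (metis power_Suc)
qed

lemma ideal_diff_ring_sum: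
  assumes "ideal I (diff_ring n)" "\<And>x. x \<in> A \<Longrightarrow> f x \<in> I"
  shows "sum f A \<in> I"
  using assms(2)
  by (induction A rule: infinite_finite_induct) (use assms(1) in \<open>auto simp: ideal_diff_ring_iff\<close>)

section \<open>Chains of primes in \<open>k[d_1,...,d_j]\<close> have length at most
  \<open>j\<close>\<close>

fun mon :: "'a::comm_monoid_mult list \<Rightarrow> nat list \<Rightarrow> 'a"
  where "mon (x # xs) (a # as) = x ^ a * mon xs as"
  | "mon _ _ = 1"

lemma DR_mon: "set xs \<subseteq> DR n \<Longrightarrow> mon xs as \<in> DR n"
  by (induction xs as rule: mon.induct) auto

text \<open>Strip the lowest power of the first element and pass to the next prime.\<close>

lemma prime_chain_independent:
  fixes P :: "nat \<Rightarrow> 'k::field_char_0 dop set"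
  assumes "\<And>i. i \<le> length xs \<Longrightarrow> primeideal (P i) (diff_ring n)"
    and "\<And>i. i < length xs \<Longrightarrow> P i \<subseteq> P (Suc i) \<and> xs ! i \<in> P (Suc i) - P i"
    and "finite A" and "A \<subseteq> {as. length as = length xs}"
    and "(\<Sum>as\<in>A. const (c as) * mon xs as) \<in> P 0"
  shows "\<forall>as\<in>A. c as = 0"
  using assms
proof (induction xs arbitrary: P A c)
  case Nil
  show ?case
  proof (rule ccontr)
    assume "\<not> (\<forall>as\<in>A. c as = 0)"
    then have A: "A = {[]}" "c [] \<noteq> 0" using Nil.prems(4) by auto
    then have "const (c []) \<in> P 0" using Nil.prems(5) by simp
    then have "const (1 / c []) * const (c []) \<in> P 0"
      using Nil.prems(1)[of 0] by (simp add: primeideal_diff_ring_iff ideal_diff_ring_iff)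
    then have "1 \<in> P 0" using A by (simp add: const_mult_const[symmetric])
    then show False using Nil.prems(1)[of 0] by (simp add: primeideal_diff_ring_iff)
  qed
next
  case (Cons x xs)
  have pr: "primeideal (P i) (diff_ring n)" if "i \<le> Suc (length xs)" for i using Cons.prems(1) that by simp
  have id: "ideal (P i) (diff_ring n)" if "i \<le> Suc (length xs)" for i
    using pr[OF that] by (simp add: primeideal_diff_ring_iff)
  have sub: "P i \<subseteq> P (Suc i)" "(x # xs) ! i \<in> P (Suc i) - P i" if "i < Suc (length xs)" for i
    using Cons.prems(2) that by auto
  have x: "x \<in> P 1" "x \<notin> P 0" "x \<in> DR n"
    using sub(2)[of 0] id[of 1] by (auto simp: ideal_diff_ring_iff)
  have xs: "set xs \<subseteq> DR n"
  proof
    fix y assume "y \<in> set xs"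
    then obtain i where "i < length xs" "y = xs ! i" by (auto simp: in_set_conv_nth)
    then show "y \<in> DR n" using sub(2)[of "Suc i"] id[of "Suc (Suc i)"] by (auto simp: ideal_diff_ring_iff)
  qed
  show ?case
  proof (rule ccontr)
    assume not: "\<not> (\<forall>as\<in>A. c as = 0)"
    define B where "B = {as \<in> A. c as \<noteq> 0}"
    define a where "a = Min (hd ` B)"
    have finB: "finite B" and "B \<noteq> {}" using not \<open>finite A\<close> by (auto simp: B_def)
    then have amin: "\<And>as. as \<in> B \<Longrightarrow> a \<le> hd as" and "a \<in> hd ` B"
      unfolding a_def by (auto intro!: Min_in)
    have shape: "as = hd as # tl as \<and> length (tl as) = length xs" if "as \<in> B" for as
      using Cons.prems(4) that by (cases as) (auto simp: B_def)
    define B0 where "B0 = {as \<in> B. hd as = a}"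
    define g where "g as = const (c as) * mon xs (tl as)" for as
    define h where "h = (\<Sum>as\<in>B - B0. x ^ (hd as - a - 1) * g as)"
    have g: "g as \<in> DR n" for as unfolding g_def using xs by (intro DR_mult DR_const DR_mon)
    have h: "h \<in> DR n" unfolding h_def using x g by (intro DR_sum DR_mult DR_power)
    have "(\<Sum>as\<in>A. const (c as) * mon (x # xs) as) = (\<Sum>as\<in>B. const (c as) * mon (x # xs) as)"
      by (rule sum.mono_neutral_right) (auto simp: B_def \<open>finite A\<close>)
    also have "\<dots> = (\<Sum>as\<in>B. x ^ hd as * g as)"
    proof (rule sum.cong[OF refl])
      fix as assume "as \<in> B"
      then have "mon (x # xs) as = x ^ hd as * mon xs (tl as)" using shape by (metis mon.simps(1))
      then show "const (c as) * mon (x # xs) as = x ^ hd as * g as" by (simp add: g_def algebra_simps)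
    qed
    also have "\<dots> = (\<Sum>as\<in>B0. x ^ hd as * g as) + (\<Sum>as\<in>B - B0. x ^ hd as * g as)"
      using finB by (subst sum.subset_diff[of B0 B]) (auto simp: B0_def)
    also have "(\<Sum>as\<in>B0. x ^ hd as * g as) = x ^ a * sum g B0"
      by (simp add: sum_distrib_left B0_def)
    also have "(\<Sum>as\<in>B - B0. x ^ hd as * g as) = x ^ a * (x * h)"
      unfolding h_def sum_distrib_left
    proof (rule sum.cong[OF refl])
      fix as assume "as \<in> B - B0"
      then have "a < hd as" using amin[of as] by (auto simp: B0_def)
      then have "hd as = a + Suc (hd as - a - 1)" by simp
      then show "x ^ hd as * g as = x ^ a * (x * (x ^ (hd as - a - 1) * g as))"
        by (metis mult.assoc power_Suc power_add)
    qed
    finally have "x ^ a * (sum g B0 + x * h) \<in> P 0"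
      using Cons.prems(5) by (simp add: algebra_simps)
    \<comment> \<open>As \<open>P 0\<close> is prime and does not contain \<open>x\<close>, the
      common power \<open>x ^ a\<close> cancels. Modulo \<open>P 1\<close>, which contains
      \<open>x\<close>, only the terms of \<open>B0\<close> survive, and they no longer involve
      \<open>x\<close>.\<close>
    moreover have "x ^ a \<notin> P 0" using primeideal_power[OF pr[of 0] x(3)] x(2) by auto
    moreover have "x ^ a \<in> DR n" "sum g B0 + x * h \<in> DR n"
      using x h g by (auto intro!: DR_sum DR_add DR_mult DR_power)
    ultimately have "sum g B0 + x * h \<in> P 0"
      using pr[of 0] by (auto simp: primeideal_diff_ring_iff)
    then have "sum g B0 + x * h \<in> P 1" using sub(1)[of 0] by auto
    moreover have "x * h \<in> P 1" using id[of 1] x(1) h unfolding ideal_diff_ring_iff by (metis One_nat_def le_add1 mult.commute plus_1_eq_Suc)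
    ultimately have "sum g B0 \<in> P 1" using ideal_diff_ring_minus[OF id[of 1]] by fastforce
    also have "sum g B0 = (\<Sum>as\<in>tl ` B0. const (c (a # as)) * mon xs as)"
    proof (subst sum.reindex)
      show "inj_on tl B0" using shape unfolding B0_def inj_on_def by (metis (mono_tags, lifting) mem_Collect_eq)
      have "a # tl as = as" if "as \<in> B0" for as using shape[of as] that by (auto simp: B0_def)
      then show "sum g B0 = sum ((\<lambda>as. const (c (a # as)) * mon xs as) \<circ> tl) B0"
        by (intro sum.cong) (auto simp: g_def)
    qed
    finally have last: "(\<Sum>as\<in>tl ` B0. const (c (a # as)) * mon xs as) \<in> P 1" .
    have "\<forall>as\<in>tl ` B0. c (a # as) = 0"
    proof (rule Cons.IH[of "\<lambda>i. P (Suc i)" "tl ` B0" "\<lambda>as. c (a # as)"])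
      show "tl ` B0 \<subseteq> {as. length as = length xs}" using shape by (auto simp: B0_def)
      show "primeideal (P (Suc i)) (diff_ring n)" if "i \<le> length xs" for i using pr that by simp
      show "P (Suc i) \<subseteq> P (Suc (Suc i)) \<and> xs ! i \<in> P (Suc (Suc i)) - P (Suc i)" if "i < length xs" for i
        using sub[of "Suc i"] that by simp
    qed (use last finB in \<open>auto simp: B0_def\<close>)
    moreover obtain as where as: "as \<in> B" "hd as = a" using \<open>a \<in> hd ` B\<close> by auto
    then have "c (a # tl as) \<noteq> 0" using shape[of as] by (auto simp: B_def)
    ultimately show False using as by (auto simp: B0_def)
  qed
qed

text \<open>Bounding every exponent separately, rather than the total degree, makes the number of
  admissible monomials in \<open>j\<close> variables a plain power.\<close>

definition exp_bounded :: "nat \<Rightarrow> 'k::field_char_0 dop \<Rightarrow> bool"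
  where "exp_bounded K P \<longleftrightarrow> (\<forall>\<mu>\<in>Poly_Mapping.keys P. \<forall>i. Poly_Mapping.lookup \<mu> i \<le> K)"

lemma exp_bounded_mono: "exp_bounded K P \<Longrightarrow> K \<le> L \<Longrightarrow> exp_bounded L P"
  unfolding exp_bounded_def by (meson le_trans)

lemma exp_bounded_one: "exp_bounded K 1"
  by (simp add: exp_bounded_def)

lemma exp_bounded_mult:
  assumes "exp_bounded K P" "exp_bounded L Q"
  shows "exp_bounded (K + L) (P * Q)"
  unfolding exp_bounded_def
proof (intro ballI allI)
  fix \<mu> i assume "\<mu> \<in> Poly_Mapping.keys (P * Q)"
  then obtain a b where "\<mu> = a + b" "a \<in> Poly_Mapping.keys P" "b \<in> Poly_Mapping.keys Q"
    using keys_mult[of P Q] by blast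
  then show "Poly_Mapping.lookup \<mu> i \<le> K + L"
    using assms unfolding exp_bounded_def by (simp add: lookup_add add_mono)
qed

lemma exp_bounded_power: "exp_bounded K P \<Longrightarrow> exp_bounded (a * K) (P ^ a)"
  by (induction a) (auto simp: exp_bounded_one intro: exp_bounded_mult)

lemma ex_exp_bounded: "\<exists>K. exp_bounded K P"
proof -
  have "Poly_Mapping.lookup \<mu> i \<le> (\<Sum>\<mu>\<in>Poly_Mapping.keys P. \<Sum>i\<in>Poly_Mapping.keys \<mu>. Poly_Mapping.lookup \<mu> i)"
    if "\<mu> \<in> Poly_Mapping.keys P" for \<mu> i
  proof (cases "i \<in> Poly_Mapping.keys \<mu>")
    case True
    then have "Poly_Mapping.lookup \<mu> i \<le> (\<Sum>i\<in>Poly_Mapping.keys \<mu>. Poly_Mapping.lookup \<mu> i)"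
      by (intro member_le_sum) auto
    also have "\<dots> \<le> (\<Sum>\<mu>\<in>Poly_Mapping.keys P. \<Sum>i\<in>Poly_Mapping.keys \<mu>. Poly_Mapping.lookup \<mu> i)"
      using that by (intro member_le_sum) auto
    finally show ?thesis .
  qed (simp add: in_keys_iff)
  then show ?thesis unfolding exp_bounded_def by blast
qed

lemma ex_exp_bounded_list: "\<exists>K. \<forall>x\<in>set xs. exp_bounded K x"
proof (induction xs)
  case (Cons x xs)
  then obtain K where "\<forall>x\<in>set xs. exp_bounded K x" by auto
  moreover obtain L where "exp_bounded L x" using ex_exp_bounded by auto
  ultimately have "\<forall>y\<in>set (x # xs). exp_bounded (K + L) y"
    by (auto intro: exp_bounded_mono)
  then show ?case by blast
qed simp

lemma exp_bounded_mon:
  assumes "\<forall>x\<in>set xs. exp_bounded K x" "\<forall>a\<in>set as. a \<le> t"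
  shows "exp_bounded (length xs * (t * K)) (mon xs as)"
  using assms
proof (induction xs as rule: mon.induct)
  case (1 x xs a as)
  have "exp_bounded (a * K) (x ^ a)" using 1 by (intro exp_bounded_power) auto
  then have "exp_bounded (t * K) (x ^ a)" by (rule exp_bounded_mono) (use 1 in auto)
  then show ?case using exp_bounded_mult 1 by fastforce
qed (auto simp: exp_bounded_one)

lemma finite_card_bounded_multi_indices:
  defines "S j K \<equiv> {\<mu> :: multi_index. Poly_Mapping.keys \<mu> \<subseteq> {1..j} \<and> (\<forall>i. Poly_Mapping.lookup \<mu> i \<le> K)}"
  shows "finite (S j K)" and "card (S j K) \<le> (K + 1) ^ j"
proof -
  let ?f = "\<lambda>\<mu> :: multi_index. restrict (Poly_Mapping.lookup \<mu>) {1..j}"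
  let ?T = "PiE {1..j} (\<lambda>_. {..K})"
  have inj: "inj_on ?f (S j K)"
  proof (rule inj_onI)
    fix \<mu> \<nu> assume *: "\<mu> \<in> S j K" "\<nu> \<in> S j K" "?f \<mu> = ?f \<nu>"
    show "\<mu> = \<nu>"
    proof (rule poly_mapping_eqI)
      fix i
      show "Poly_Mapping.lookup \<mu> i = Poly_Mapping.lookup \<nu> i"
      proof (cases "i \<in> {1..j}")
        case True
        then show ?thesis using fun_cong[OF *(3), of i] by simp
      next
        case False
        then have "i \<notin> Poly_Mapping.keys \<mu>" "i \<notin> Poly_Mapping.keys \<nu>" using * by (auto simp: S_def)
        then show ?thesis by (simp add: in_keys_iff)
      qed
    qed
  qed
  have sub: "?f ` S j K \<subseteq> ?T" by (auto simp: S_def)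
  have fin: "finite ?T" by (intro finite_PiE) auto
  show "finite (S j K)" using inj_on_finite[OF inj sub fin] .
  have "card (S j K) \<le> card ?T" using card_inj_on_le[OF inj sub fin] .
  also have "card ?T = (K + 1) ^ j" by (simp add: card_PiE)
  finally show "card (S j K) \<le> (K + 1) ^ j" .
qed

lemma vector_space_dop: "vector_space (\<lambda>c (P :: 'k::field_char_0 dop). const c * P)"
  by unfold_locales (auto simp: algebra_simps const_add const_mult_const)

text \<open>The values of \<open>g\<close> lie in the span of \<open>card S\<close> monomials.
  Linear dependence is a notion for sets of vectors, so a repeated value of \<open>g\<close> is
  treated apart: it yields the relation with coefficients 1 and -1.\<close>

lemma ex_linear_relation:
  fixes g :: "'a \<Rightarrow> 'k::field_char_0 dop"
  assumes "finite A" "finite S" "card S < card A"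
    and keys: "\<And>a. a \<in> A \<Longrightarrow> Poly_Mapping.keys (g a) \<subseteq> S"
  shows "\<exists>c. (\<exists>a\<in>A. c a \<noteq> 0) \<and> (\<Sum>a\<in>A. const (c a) * g a) = 0"
proof (cases "inj_on g A")
  case False
  then obtain a b where ab: "a \<in> A" "b \<in> A" "a \<noteq> b" "g a = g b" by (auto simp: inj_on_def)
  define c where "c x = (if x = a then 1 else if x = b then - 1 else 0 :: 'k)" for x
  have "(\<Sum>x\<in>A. const (c x) * g x) = (\<Sum>x\<in>{a, b}. const (c x) * g x)"
    using ab \<open>finite A\<close> by (intro sum.mono_neutral_right) (auto simp: c_def)
  also have "\<dots> = (const 1 + const (- 1)) * g b" using ab by (simp add: c_def algebra_simps)
  also have "\<dots> = 0" by (simp add: const_add[symmetric] del: const_one)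
  finally show ?thesis using ab by (intro exI[of _ c]) (auto simp: c_def)
next
  case True
  interpret vector_space "\<lambda>c (P :: 'k dop). const c * P" by (rule vector_space_dop)
  let ?m = "\<lambda>\<mu>. Poly_Mapping.single \<mu> 1 :: 'k dop"
  have "g a \<in> span (?m ` S)" if "a \<in> A" for a
  proof -
    have "g a = (\<Sum>\<mu>\<in>Poly_Mapping.keys (g a). const (Poly_Mapping.lookup (g a) \<mu>) * ?m \<mu>)"
      by (subst poly_mapping_eq_sum_single) (simp add: const_def mult_single)
    also have "\<dots> \<in> span (?m ` S)"
      using keys[OF that] by (intro span_sum span_scale span_base) auto
    finally show ?thesis .
  qed
  then have sub: "g ` A \<subseteq> span (?m ` S)" by auto
  have "dependent (g ` A)"
  proof (rule ccontr)
    assume "independent (g ` A)"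
    then have "card (g ` A) \<le> card (?m ` S)"
      using independent_span_bound[OF _ _ sub] \<open>finite S\<close> by auto
    also have "\<dots> \<le> card S" by (rule card_image_le[OF \<open>finite S\<close>])
    finally show False using assms(3) card_image[OF True] by simp
  qed
  then obtain u where "\<exists>v\<in>g ` A. u v \<noteq> 0" "(\<Sum>v\<in>g ` A. const (u v) * v) = 0"
    using dependent_finite[of "g ` A"] \<open>finite A\<close> by auto
  then show ?thesis
    by (intro exI[of _ "u \<circ> g"]) (auto simp: sum.reindex[OF True])
qed

text \<open>Counting monomials, \<open>j + 1\<close> polynomials in \<open>j\<close> variables are algebraically dependent.\<close>

lemma prime_chain_length_le:
  fixes P :: "nat \<Rightarrow> 'k::field_char_0 dop set"
  assumes prime: "\<And>i. i \<le> l \<Longrightarrow> primeideal (P i) (diff_ring j)"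
    and strict: "\<And>i. i < l \<Longrightarrow> P i \<subset> P (Suc i)"
  shows "l \<le> j"
proof (rule ccontr)
  assume "\<not> l \<le> j"
  then have jl: "Suc j \<le> l" by simp
  have "\<exists>x. x \<in> P (Suc i) - P i" if "i < l" for i using strict[OF that] by blast
  then obtain x where x: "\<And>i. i < l \<Longrightarrow> x i \<in> P (Suc i) - P i" by metis
  define xs where "xs = map x [0..<Suc j]"
  have len: "length xs = Suc j" and nth: "\<And>i. i < Suc j \<Longrightarrow> xs ! i = x i"
    by (auto simp: xs_def simp del: upt_Suc)
  have xsj: "set xs \<subseteq> DR j"
  proof
    fix y assume "y \<in> set xs"
    then obtain i where "i < Suc j" "y = x i" by (auto simp: xs_def simp del: upt_Suc)
    then show "y \<in> DR j"
      using x[of i] prime[of "Suc i"] jl by (auto simp: primeideal_diff_ring_iff ideal_diff_ring_iff)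
  qed
  obtain B where B: "\<forall>x\<in>set xs. exp_bounded B x" using ex_exp_bounded_list by blast
  define C where "C = Suc j * B"
  \<comment> \<open>The monomials in \<open>xs\<close> with exponents up to \<open>t\<close> have
    exponents up to \<open>C * t\<close> in the derivations, and
    \<open>(C * t + 1) ^ j \<le> (C + 1) ^ j * (t + 1) ^ j\<close>. With this \<open>t\<close> the
    bound becomes \<open>t * (t + 1) ^ j\<close>, less than the number
    \<open>(t + 1) ^ Suc j\<close> of exponent lists.\<close>
  define t where "t = (C + 1) ^ j"
  define A where "A = {as. set as \<subseteq> {0..t} \<and> length as = Suc j}"
  define S where "S = {\<mu> :: multi_index. Poly_Mapping.keys \<mu> \<subseteq> {1..j} \<and> (\<forall>i. Poly_Mapping.lookup \<mu> i \<le> C * t)}"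
  have finA: "finite A" unfolding A_def by (rule finite_lists_length_eq) simp
  have cardA: "card A = (t + 1) ^ Suc j" unfolding A_def by (subst card_lists_length_eq) auto
  have finS: "finite S" and "card S \<le> (C * t + 1) ^ j"
    unfolding S_def using finite_card_bounded_multi_indices by auto
  note this(2)
  also have "(C * t + 1) ^ j \<le> ((C + 1) * (t + 1)) ^ j" by (intro power_mono) auto
  also have "\<dots> = t * (t + 1) ^ j" by (simp only: power_mult_distrib t_def)
  also have "\<dots> < card A" unfolding cardA by simp
  finally have "card S < card A" .
  moreover have "Poly_Mapping.keys (mon xs as) \<subseteq> S" if "as \<in> A" for as
  proof -
    have "exp_bounded (Suc j * (t * B)) (mon xs as)"
      using exp_bounded_mon[OF B, of as t] that unfolding len A_def by (simp add: subset_iff)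
    then have "exp_bounded (C * t) (mon xs as)" by (simp add: C_def algebra_simps)
    then show ?thesis using DR_mon[OF xsj, of as] unfolding S_def exp_bounded_def DR_iff by auto
  qed
  ultimately obtain c where c: "\<exists>as\<in>A. c as \<noteq> 0" "(\<Sum>as\<in>A. const (c as) * mon xs as) = 0"
    using ex_linear_relation[OF finA finS] by blast
  have "\<forall>as\<in>A. c as = 0"
  proof (rule prime_chain_independent[where P = P and n = j and xs = xs])
    show "(\<Sum>as\<in>A. const (c as) * mon xs as) \<in> P 0"
      unfolding c(2) using prime[of 0] by (simp add: primeideal_diff_ring_iff ideal_diff_ring_iff)
    show "P i \<subseteq> P (Suc i) \<and> xs ! i \<in> P (Suc i) - P i" if "i < length xs" for i
      using strict[of i] x[of i] nth[of i] that len jl by auto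
  qed (use prime len jl finA in \<open>auto simp: A_def\<close>)
  then show False using c by blast
qed

section \<open>Primes avoiding a multiplicative set, and chains that attain the length
  \<open>j\<close>\<close>

lemma ideal_diff_ring_adjoin:
  fixes P :: "'k::field_char_0 dop set"
  assumes P: "ideal P (diff_ring n)" and d: "d \<in> DR n"
  shows "ideal {p + a * d | p a. p \<in> P \<and> a \<in> DR n} (diff_ring n)"
    and "P \<subseteq> {p + a * d | p a. p \<in> P \<and> a \<in> DR n}"
    and "d \<in> {p + a * d | p a. p \<in> P \<and> a \<in> DR n}"
proof -
  let ?J = "{p + a * d | p a. p \<in> P \<and> a \<in> DR n}"
  show sub: "P \<subseteq> ?J"
  proof
    fix p assume "p \<in> P"
    then have "p + 0 * d \<in> ?J" using DR_zero by blast
    then show "p \<in> ?J" by simp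
  qed
  have "0 + 1 * d \<in> ?J" using P DR_one unfolding ideal_diff_ring_iff by blast
  then show "d \<in> ?J" by simp
  show "ideal ?J (diff_ring n)"
    unfolding ideal_diff_ring_iff
  proof (intro conjI ballI)
    show "?J \<subseteq> DR n" using d P by (auto simp: ideal_diff_ring_iff)
    show "0 \<in> ?J" using sub P by (auto simp only: ideal_diff_ring_iff)
    fix x y assume "x \<in> ?J"
    then obtain p r where x: "x = p + r * d" "p \<in> P" "r \<in> DR n" by auto
    show "y * x \<in> ?J" if "y \<in> DR n"
    proof -
      have "y * x = y * p + (y * r) * d" by (simp add: x algebra_simps)
      moreover have "y * p \<in> P" "y * r \<in> DR n" using that x P by (auto simp: ideal_diff_ring_iff)
      ultimately show ?thesis by blast
    qed
    assume "y \<in> ?J"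
    then obtain p' r' where y: "y = p' + r' * d" "p' \<in> P" "r' \<in> DR n" by auto
    have "x + y = (p + p') + (r + r') * d" by (simp add: x y algebra_simps)
    moreover have "p + p' \<in> P" "r + r' \<in> DR n" using x y P by (auto simp: ideal_diff_ring_iff)
    ultimately show "x + y \<in> ?J" by blast
  qed
qed

text \<open>By Zorn there is an ideal maximal among those that contain \<open>I\<close> and avoid
  \<open>S\<close>. It is prime: if \<open>a\<close> and \<open>b\<close> lie outside it, adjoining
  either one makes it meet \<open>S\<close>, and the product of the two elements found in
  \<open>S\<close> lies in the ideal as soon as \<open>a * b\<close> does.\<close>

lemma ex_primeideal_disjoint:
  fixes I :: "'k::field_char_0 dop set"
  assumes I: "ideal I (diff_ring n)" and S: "S \<subseteq> DR n" "1 \<in> S" "\<And>a b. a \<in> S \<Longrightarrow> b \<in> S \<Longrightarrow> a * b \<in> S"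
    and "I \<inter> S = {}"
  shows "\<exists>P. primeideal P (diff_ring n) \<and> I \<subseteq> P \<and> P \<inter> S = {}"
proof -
  define F where "F = {J. ideal J (diff_ring n) \<and> I \<subseteq> J \<and> J \<inter> S = {}}"
  have "\<exists>M\<in>F. \<forall>X\<in>F. M \<subseteq> X \<longrightarrow> X = M"
  proof (rule subset_Zorn_nonempty)
    show "F \<noteq> {}" using assms by (auto simp: F_def)
    fix \<C> assume C: "\<C> \<noteq> {}" "subset.chain F \<C>"
    then have F: "\<And>J. J \<in> \<C> \<Longrightarrow> J \<in> F" and lin: "\<And>J K. J \<in> \<C> \<Longrightarrow> K \<in> \<C> \<Longrightarrow> J \<subseteq> K \<or> K \<subseteq> J"
      by (auto simp: subset.chain_def)
    have "ideal (\<Union> \<C>) (diff_ring n)"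
      unfolding ideal_diff_ring_iff
    proof (intro conjI ballI)
      show "\<Union> \<C> \<subseteq> DR n" using F by (fastforce simp: F_def ideal_diff_ring_iff)
      obtain J where "J \<in> \<C>" using C(1) by blast
      then show "0 \<in> \<Union> \<C>" using F[of J] by (auto simp only: F_def ideal_diff_ring_iff mem_Collect_eq)
      fix a b assume a: "a \<in> \<Union> \<C>"
      have id: "ideal K (diff_ring n)" if "K \<in> \<C>" for K using F[OF that] by (simp add: F_def)
      show "b * a \<in> \<Union> \<C>" if b: "b \<in> DR n"
      proof -
        obtain K where K: "K \<in> \<C>" "a \<in> K" using a by blast
        then have "b * a \<in> K" using id[OF K(1)] b unfolding ideal_diff_ring_iff by blast
        then show ?thesis using K by blast
      qed
      assume "b \<in> \<Union> \<C>"
      then obtain K where K: "K \<in> \<C>" "a \<in> K" "b \<in> K" using a lin by blast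
      then have "a + b \<in> K" using id[OF K(1)] unfolding ideal_diff_ring_iff by blast
      then show "a + b \<in> \<Union> \<C>" using K by blast
    qed
    moreover have "I \<subseteq> \<Union> \<C>" "\<Union> \<C> \<inter> S = {}" using F C(1) unfolding F_def by blast+
    ultimately show "\<Union> \<C> \<in> F" by (simp add: F_def)
  qed
  then obtain P where PF: "P \<in> F" and max: "\<And>X. X \<in> F \<Longrightarrow> P \<subseteq> X \<Longrightarrow> X = P" by blast
  then have P: "ideal P (diff_ring n)" "I \<subseteq> P" "P \<inter> S = {}" by (simp_all add: F_def)
  have meet: "\<exists>p r. p \<in> P \<and> r \<in> DR n \<and> p + r * a \<in> S" if a: "a \<in> DR n" "a \<notin> P" for a
  proof (rule ccontr)
    assume no: "\<not> ?thesis"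
    define J where "J = {p + r * a | p r. p \<in> P \<and> r \<in> DR n}"
    note J = ideal_diff_ring_adjoin[OF P(1) a(1), folded J_def]
    have "J \<inter> S = {}" using no unfolding J_def by blast
    then have "J \<in> F" using J(1,2) P(2) unfolding F_def by blast
    then have "J = P" using max J(2) by blast
    then show False using J(3) a(2) by blast
  qed
  have "primeideal P (diff_ring n)"
    unfolding primeideal_diff_ring_iff
  proof (intro conjI ballI impI)
    show "ideal P (diff_ring n)" "1 \<notin> P" using P S by auto
    fix a b assume ab: "a \<in> DR n" "b \<in> DR n" "a * b \<in> P"
    show "a \<in> P \<or> b \<in> P"
    proof (rule ccontr)
      assume "\<not> (a \<in> P \<or> b \<in> P)"
      then obtain p r q s where *: "p \<in> P" "r \<in> DR n" "p + r * a \<in> S" "q \<in> P" "s \<in> DR n" "q + s * b \<in> S"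
        using meet ab by metis
      then have "(p + r * a) * (q + s * b) \<in> S" using S by blast
      moreover have "(p + r * a) * (q + s * b) = (q + s * b) * p + (r * a) * q + (r * s) * (a * b)"
        by (simp add: algebra_simps)
      moreover have "(q + s * b) * p \<in> P" "(r * a) * q \<in> P" "(r * s) * (a * b) \<in> P"
        using * ab S P(1) unfolding ideal_diff_ring_iff by (blast intro: DR_mult)+
      ultimately have "(p + r * a) * (q + s * b) \<in> P" using P(1) unfolding ideal_diff_ring_iff by simp
      then show False using \<open>(p + r * a) * (q + s * b) \<in> S\<close> P(3) by blast
    qed
  qed
  then show ?thesis using P by blast
qed

lemma der_mult_in_DR_imp_zero:
  fixes Q :: "'k::field_char_0 dop"
  assumes "der (Suc j) * Q \<in> DR j"
  shows "der (Suc j) * Q = 0"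
proof (rule ccontr)
  assume "der (Suc j) * Q \<noteq> 0"
  then obtain w where w: "w \<in> Poly_Mapping.keys (der (Suc j) * Q)" by fastforce
  then obtain u where "w = Poly_Mapping.single (Suc j) 1 + u"
    unfolding der_def in_keys_iff by (elim lookup_single_mult_nonzero)
  then have "Suc j \<in> Poly_Mapping.keys w" by (simp add: in_keys_iff lookup_add)
  then show False using assms w unfolding DR_iff by fastforce
qed

lemma DR_Suc_split:
  fixes c :: "'k::field_char_0 dop"
  assumes "c \<in> DR (Suc j)"
  obtains c0 c1 where "c0 \<in> DR j" "c1 \<in> DR (Suc j)" "c = c0 + c1 * der (Suc j)"
proof -
  let ?s = "\<lambda>\<mu>. Poly_Mapping.single \<mu> (Poly_Mapping.lookup c \<mu>)"
  let ?K = "Poly_Mapping.keys c"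
  let ?Z = "{\<mu> \<in> ?K. Poly_Mapping.lookup \<mu> (Suc j) = 0}"
  let ?e = "Poly_Mapping.single (Suc j) 1 :: multi_index"
  have keys: "\<And>\<mu>. \<mu> \<in> ?K \<Longrightarrow> Poly_Mapping.keys \<mu> \<subseteq> {1..Suc j}" using assms by (simp add: DR_iff)
  have "c = sum ?s ?K" by (rule poly_mapping_eq_sum_single)
  also have "\<dots> = sum ?s ?Z + sum ?s (?K - ?Z)" by (subst add.commute) (rule sum.subset_diff, auto)
  finally have c: "c = sum ?s ?Z + sum ?s (?K - ?Z)" .
  have "sum ?s (?K - ?Z) = (\<Sum>\<mu>\<in>?K - ?Z. Poly_Mapping.single (\<mu> - ?e) (Poly_Mapping.lookup c \<mu>)) * der (Suc j)"
    unfolding sum_distrib_right der_def mult_single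
  proof (rule sum.cong[OF refl])
    fix \<mu> assume "\<mu> \<in> ?K - ?Z"
    then have "Poly_Mapping.lookup \<mu> (Suc j) \<noteq> 0" by auto
    then have "\<mu> - ?e + ?e = \<mu>"
      by (intro poly_mapping_eqI) (auto simp: lookup_add lookup_minus lookup_single when_def)
    then show "?s \<mu> = Poly_Mapping.single (\<mu> - ?e + ?e) (Poly_Mapping.lookup c \<mu> * 1)" by simp
  qed
  moreover have "sum ?s ?Z \<in> DR j"
  proof (intro DR_sum DR_single)
    fix \<mu> assume \<mu>: "\<mu> \<in> ?Z"
    then have "Suc j \<notin> Poly_Mapping.keys \<mu>" by (simp add: in_keys_iff)
    then show "Poly_Mapping.keys \<mu> \<subseteq> {1..j}" using keys[of \<mu>] \<mu> by (force simp: le_Suc_eq)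
  qed
  moreover have "(\<Sum>\<mu>\<in>?K - ?Z. Poly_Mapping.single (\<mu> - ?e) (Poly_Mapping.lookup c \<mu>)) \<in> DR (Suc j)"
  proof (intro DR_sum DR_single)
    fix \<mu> assume \<mu>: "\<mu> \<in> ?K - ?Z"
    have "Poly_Mapping.keys (\<mu> - ?e) \<subseteq> Poly_Mapping.keys \<mu>"
      by (auto simp: in_keys_iff lookup_minus)
    then show "Poly_Mapping.keys (\<mu> - ?e) \<subseteq> {1..Suc j}" using keys[of \<mu>] \<mu> by blast
  qed
  ultimately show ?thesis using that[OF _ _ c[unfolded \<open>sum ?s (?K - ?Z) = _\<close>]] by blast
qed

lemma ideal_diff_ring_power_diff:
  assumes P: "ideal P (diff_ring n)" and "x - y \<in> P" "x \<in> DR n" "y \<in> DR n"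
  shows "x ^ i - y ^ i \<in> (P :: 'k::field_char_0 dop set)"
proof (induction i)
  case 0
  then show ?case using P by (simp add: ideal_diff_ring_iff)
next
  case (Suc i)
  have "x ^ Suc i - y ^ Suc i = x * (x ^ i - y ^ i) + y ^ i * (x - y)" by (simp add: algebra_simps)
  moreover have "x * (x ^ i - y ^ i) \<in> P" "y ^ i * (x - y) \<in> P"
    using Suc assms DR_power[of y n i] unfolding ideal_diff_ring_iff by blast+
  ultimately show ?case using P by (simp add: ideal_diff_ring_iff)
qed

text \<open>Write \<open>d\<close> for \<open>der (Suc j)\<close>. Multiplying a monic relation for
  \<open>a\<close> by \<open>d ^ N\<close> gives a monic relation for \<open>a * d\<close> whose
  lower coefficients are divisible by \<open>d\<close>. As \<open>a * d\<close> is congruent to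
  \<open>s\<close> modulo \<open>P\<close>, the same relation holds for \<open>s\<close>, first
  modulo \<open>P\<close> and then exactly, since it lies in \<open>DR (Suc j)\<close>. So
  \<open>d\<close> divides \<open>s ^ N\<close>, which is free of \<open>d\<close>.\<close>

lemma prime_adjoin_der_contraction:
  fixes P :: "'k::field_char_0 dop set"
  assumes P: "ideal P (diff_ring n)" and int: "integral_mod n (Suc j) P" and jn: "Suc j \<le> n"
    and triv: "P \<inter> DR (Suc j) = {0}"
    and s: "s \<in> DR j" "s = p + a * der (Suc j)" "p \<in> P" "a \<in> DR n"
  shows "s = 0"
proof -
  let ?d = "der (Suc j) :: 'k dop"
  have d: "?d \<in> DR (Suc j)" by auto
  have sub: "DR (Suc j) \<subseteq> (DR n :: 'k dop set)" "DR j \<subseteq> (DR (Suc j) :: 'k dop set)"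
    using jn by (auto intro!: DR_mono)
  obtain N c where c: "\<And>i. i < N \<Longrightarrow> c i \<in> DR (Suc j)" "a ^ N + (\<Sum>i<N. c i * a ^ i) \<in> P"
    using int s(4) unfolding integral_mod_def by blast
  let ?f = "\<lambda>x. x ^ N + (\<Sum>i<N. c i * ?d ^ (N - i) * x ^ i)"
  have "?d ^ N * (a ^ N + (\<Sum>i<N. c i * a ^ i)) = ?f (a * ?d)"
  proof -
    have "?d ^ N * (c i * a ^ i) = c i * ?d ^ (N - i) * (a * ?d) ^ i" if "i < N" for i
    proof -
      have "?d ^ N = ?d ^ (N - i) * ?d ^ i" using that by (simp flip: power_add)
      then show ?thesis by (simp add: power_mult_distrib algebra_simps)
    qed
    then have "(\<Sum>i<N. ?d ^ N * (c i * a ^ i)) = (\<Sum>i<N. c i * ?d ^ (N - i) * (a * ?d) ^ i)"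
      by (intro sum.cong) auto
    then show ?thesis
      by (simp only: distrib_left sum_distrib_left) (simp add: power_mult_distrib mult.commute)
  qed
  moreover have "?d ^ N * (a ^ N + (\<Sum>i<N. c i * a ^ i)) \<in> P"
    using P c(2) DR_power[of ?d n N] d sub(1) unfolding ideal_diff_ring_iff by blast
  ultimately have 1: "?f (a * ?d) \<in> P" by simp
  have mem: "s - a * ?d \<in> P" "s \<in> DR n" "a * ?d \<in> DR n"
    using s(2,3) apply simp
    using s(1) sub apply blast
    using s(4) d sub by (blast intro: DR_mult)
  note pd = ideal_diff_ring_power_diff[OF P this]
  have "c i * ?d ^ (N - i) * (s ^ i - (a * ?d) ^ i) \<in> P" if "i < N" for i
  proof -
    have "c i * ?d ^ (N - i) \<in> DR n" using c(1)[OF that] d sub by (blast intro: DR_mult DR_power)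
    then show ?thesis using pd[of i] P unfolding ideal_diff_ring_iff by blast
  qed
  then have sumP: "(\<Sum>i<N. c i * ?d ^ (N - i) * (s ^ i - (a * ?d) ^ i)) \<in> P"
    by (intro ideal_diff_ring_sum[OF P]) auto
  moreover have eq: "?f s = ?f (a * ?d) + (s ^ N - (a * ?d) ^ N) + (\<Sum>i<N. c i * ?d ^ (N - i) * (s ^ i - (a * ?d) ^ i))"
    by (simp add: algebra_simps sum_subtractf)
  moreover have add: "x + y \<in> P" if "x \<in> P" "y \<in> P" for x y
    using P that unfolding ideal_diff_ring_iff by blast
  ultimately have "?f s \<in> P" using add[OF add[OF 1 pd[of N]] sumP] by (simp only: eq)
  moreover have "?f s \<in> DR (Suc j)" using c(1) d s(1) sub(2) by (intro DR_add DR_sum DR_mult DR_power) auto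
  ultimately have 2: "?f s = 0" using triv by blast
  have sN: "s ^ N = ?d * - (\<Sum>i<N. c i * ?d ^ (N - Suc i) * s ^ i)"
  proof -
    have "(\<Sum>i<N. c i * ?d ^ (N - i) * s ^ i) = ?d * (\<Sum>i<N. c i * ?d ^ (N - Suc i) * s ^ i)"
      unfolding sum_distrib_left
    proof (rule sum.cong[OF refl])
      fix i assume "i \<in> {..<N}"
      then have "N - i = Suc (N - Suc i)" by auto
      then show "c i * ?d ^ (N - i) * s ^ i = ?d * (c i * ?d ^ (N - Suc i) * s ^ i)" by (simp add: algebra_simps)
    qed
    then show ?thesis using 2 by (simp add: add_eq_0_iff2)
  qed
  have "s ^ N \<in> DR j" using s(1) by (rule DR_power)
  then have "s ^ N = 0" using der_mult_in_DR_imp_zero unfolding sN by blast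
  then show "s = 0" by simp
qed

text \<open>In the induction step a prime \<open>P\<close> above \<open>I\<close> is chosen that
  still meets \<open>k[d_1,...,d_(j+1)]\<close> only in 0. Adjoining \<open>d_(j+1)\<close> to it
  gives an ideal \<open>J\<close> that satisfies the hypotheses for \<open>j\<close>, and
  \<open>P\<close> is put in front of the chain above \<open>J\<close>.\<close>

lemma prime_chain_exists:
  fixes I :: "'k::field_char_0 dop set"
  assumes "ideal I (diff_ring n)" and "integral_mod n j I" and "j \<le> n" and "I \<inter> DR j = {0}"
  shows "\<exists>P. (\<forall>i\<le>j. primeideal (P i) (diff_ring n) \<and> I \<subseteq> P i) \<and> (\<forall>i<j. P i \<subset> P (Suc i))"
  using assms
proof (induction j arbitrary: I)
  have prime: "\<exists>P. primeideal P (diff_ring n) \<and> I \<subseteq> P \<and> P \<inter> DR j = {0}"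
    if "ideal I (diff_ring n)" "j \<le> n" "I \<inter> DR j = {0}" for I :: "'k dop set" and j
  proof -
    have "\<exists>P. primeideal P (diff_ring n) \<and> I \<subseteq> P \<and> P \<inter> (DR j - {0}) = {}"
      by (rule ex_primeideal_disjoint) (use that DR_mono[of j n] in auto)
    then obtain P where P: "primeideal P (diff_ring n)" "I \<subseteq> P" "P \<inter> (DR j - {0}) = {}" by blast
    have "0 \<in> P" using P(1) by (auto simp: primeideal_diff_ring_iff ideal_diff_ring_iff)
    then have "P \<inter> DR j = {0}" using P(3) DR_zero by blast
    then show ?thesis using P by blast
  qed
  {
    case 0
    then obtain P where "primeideal P (diff_ring n)" "I \<subseteq> P" using prime[of I 0] by blast
    then show ?case by (intro exI[of _ "\<lambda>_. P"]) auto
  next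
    case (Suc j)
    let ?d = "der (Suc j) :: 'k dop"
    obtain P where P: "primeideal P (diff_ring n)" "I \<subseteq> P" "P \<inter> DR (Suc j) = {0}"
      using prime[OF Suc.prems(1,3,4)] by blast
    have iP: "ideal P (diff_ring n)" using P by (simp add: primeideal_diff_ring_iff)
    have dn: "?d \<in> DR n" using Suc.prems(3) by (intro DR_der) simp
    have sub: "DR (Suc j) \<subseteq> (DR n :: 'k dop set)" using Suc.prems(3) by (rule DR_mono)
    define J where "J = {p + a * ?d | p a. p \<in> P \<and> a \<in> DR n}"
    note J = ideal_diff_ring_adjoin[OF iP dn, folded J_def]
    have "integral_mod n j J"
      unfolding integral_mod_def
    proof
      fix a :: "'k dop" assume a: "a \<in> DR n"
      then obtain N c where c: "\<And>i. i < N \<Longrightarrow> c i \<in> DR (Suc j)" "a ^ N + (\<Sum>i<N. c i * a ^ i) \<in> J"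
        using integral_mod_mono[OF Suc.prems(2), of J] P(2) J(2) unfolding integral_mod_def by blast
      have "\<exists>c0 c1. c0 \<in> DR j \<and> c1 \<in> DR (Suc j) \<and> c i = c0 + c1 * ?d" if "i < N" for i
        using DR_Suc_split[OF c(1)[OF that]] by metis
      then obtain c0 c1 where c01: "\<And>i. i < N \<Longrightarrow> c0 i \<in> DR j \<and> c1 i \<in> DR (Suc j) \<and> c i = c0 i + c1 i * ?d"
        by metis
      \<comment> \<open>Modulo \<open>J\<close> each coefficient may be replaced by its part free of
        \<open>d_(j+1)\<close>, so one variable fewer is needed.\<close>
      have "(\<Sum>i<N. (c1 i * a ^ i) * ?d) \<in> J"
      proof (rule ideal_diff_ring_sum[OF J(1)])
        fix i assume "i \<in> {..<N}"
        then have "c1 i * a ^ i \<in> DR n" using c01 a sub by (blast intro: DR_mult DR_power)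
        then show "(c1 i * a ^ i) * ?d \<in> J" using J(1,3) by (simp add: ideal_diff_ring_iff)
      qed
      then have "a ^ N + (\<Sum>i<N. c i * a ^ i) - (\<Sum>i<N. (c1 i * a ^ i) * ?d) \<in> J"
        using c(2) by (intro ideal_diff_ring_minus[OF J(1)])
      moreover have "(\<Sum>i<N. c i * a ^ i) = (\<Sum>i<N. c0 i * a ^ i) + (\<Sum>i<N. (c1 i * a ^ i) * ?d)"
        using c01 by (simp add: algebra_simps flip: sum.distrib)
      ultimately have "a ^ N + (\<Sum>i<N. c0 i * a ^ i) \<in> J" by (simp add: algebra_simps)
      then show "\<exists>N c. (\<forall>i<N. c i \<in> DR j) \<and> a ^ N + (\<Sum>i<N. c i * a ^ i) \<in> J" using c01 by blast
    qed
    moreover have "J \<inter> DR j = {0}"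
    proof -
      have "s = 0" if "s \<in> J" "s \<in> DR j" for s
        using prime_adjoin_der_contraction[OF iP integral_mod_mono[OF Suc.prems(2) P(2)] Suc.prems(3) P(3)] that
        by (auto simp: J_def)
      moreover have "0 \<in> J" using J(1) by (simp add: ideal_diff_ring_iff)
      ultimately show ?thesis by auto
    qed
    ultimately obtain Q where Q: "\<forall>i\<le>j. primeideal (Q i) (diff_ring n) \<and> J \<subseteq> Q i" "\<forall>i<j. Q i \<subset> Q (Suc i)"
      using Suc.IH[OF J(1)] Suc.prems(3) by auto
    have "?d \<noteq> 0" unfolding der_def by (metis lookup_single_eq lookup_zero zero_neq_one)
    then have "?d \<notin> P" using P(3) DR_der[of "Suc j" "Suc j"] by fastforce
    then have PQ: "P \<subset> Q 0" using J Q by blast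
    show ?case
    proof (intro exI[of _ "case_nat P Q"] conjI allI impI)
      fix i assume "i \<le> Suc j"
      then show "primeideal (case_nat P Q i) (diff_ring n)" "I \<subseteq> case_nat P Q i"
        using P Q J(2) by (cases i; force)+
    next
      fix i assume "i < Suc j"
      then show "case_nat P Q i \<subset> case_nat P Q (Suc i)" using PQ Q by (cases i) auto
    qed
  }
qed

text \<open>Contraction to \<open>k[d_1,...,d_j]\<close> bounds the length of chains by
  \<open>j\<close>, and \<open>prime_chain_exists\<close> attains the bound if \<open>I\<close>
  contracts to 0. Otherwise all contracted primes contain a nonzero element of \<open>I\<close>, so
  \<open>{0}\<close> can be put in front of them and the length is at most
  \<open>j - 1\<close>.\<close>

lemma
  fixes I :: "'k::field_char_0 dop set"
  assumes I: "ideal I (diff_ring n)" and int: "integral_mod n j I" and jn: "j \<le> n"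
  shows krull_dim_Quot_eq: "I \<inter> DR j = {0} \<Longrightarrow> krull_dim (diff_ring n Quot I) = enat j"
    and krull_dim_Quot_less: "1 \<notin> I \<Longrightarrow> I \<inter> DR j \<noteq> {0} \<Longrightarrow> krull_dim (diff_ring n Quot I) < enat j"
proof -
  let ?C = "\<lambda>l P. (\<forall>i\<le>l. primeideal (P i) (diff_ring n) \<and> I \<subseteq> P i) \<and> (\<forall>i<l. P i \<subset> P (Suc i))"
  have dim: "krull_dim (diff_ring n Quot I) = Sup {enat l | l. \<exists>P. ?C l P}"
    by (rule krull_dim_Quot[OF cring_diff_ring I])
  have contr: "primeideal (P i \<inter> DR j) (diff_ring j)" if "?C l P" "i \<le> l" for l P i
    using primeideal_contraction[OF _ jn] that by blast
  have strict: "P i \<inter> DR j \<subset> P (Suc i) \<inter> DR j" if "?C l P" "i < l" for l P i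
    using prime_contraction_strict[of "P i" n "P (Suc i)", OF _ _ _ integral_mod_mono[OF int] jn] that by auto
  show "krull_dim (diff_ring n Quot I) = enat j" if "I \<inter> DR j = {0}"
    unfolding dim
  proof (rule antisym)
    show "Sup {enat l | l. \<exists>P. ?C l P} \<le> enat j"
    proof (rule Sup_least)
      fix z assume "z \<in> {enat l | l. \<exists>P. ?C l P}"
      then obtain l P where z: "z = enat l" and C: "?C l P" by blast
      have "l \<le> j"
        by (rule prime_chain_length_le[where P = "\<lambda>i. P i \<inter> DR j"]) (use contr[OF C] strict[OF C] in auto)
      then show "z \<le> enat j" using z by simp
    qed
    show "enat j \<le> Sup {enat l | l. \<exists>P. ?C l P}"
      using prime_chain_exists[OF I int jn that] by (intro Sup_upper) blast
  qed
  assume "1 \<notin> I" "I \<inter> DR j \<noteq> {0}"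
  have "0 \<in> I \<inter> DR j" using I by (simp add: ideal_diff_ring_iff)
  then obtain f where f: "f \<in> I \<inter> DR j" "f \<noteq> 0" using \<open>I \<inter> DR j \<noteq> {0}\<close> by blast
  have less: "Suc l \<le> j" if C: "?C l P" for l P
  proof (rule prime_chain_length_le[where P = "case_nat {0} (\<lambda>i. P i \<inter> DR j)"])
    fix i assume "i \<le> Suc l"
    then show "primeideal (case_nat {0} (\<lambda>i. P i \<inter> DR j) i) (diff_ring j)"
      using contr[OF C] primeideal_diff_ring_zero by (cases i) auto
  next
    fix i assume i: "i < Suc l"
    show "case_nat {0} (\<lambda>i. P i \<inter> DR j) i \<subset> case_nat {0} (\<lambda>i. P i \<inter> DR j) (Suc i)"
    proof (cases i)
      case 0
      have "I \<subseteq> P 0" using C by blast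
      then show ?thesis using 0 f \<open>0 \<in> I \<inter> DR j\<close> by auto
    next
      case (Suc k)
      then show ?thesis using strict[OF C, of k] i by auto
    qed
  qed
  have "\<exists>P. primeideal P (diff_ring n) \<and> I \<subseteq> P \<and> P \<inter> {1} = {}"
    by (rule ex_primeideal_disjoint[OF I]) (use \<open>1 \<notin> I\<close> in auto)
  then obtain P where "primeideal P (diff_ring n)" "I \<subseteq> P" by blast
  then have "?C 0 (\<lambda>_. P)" by simp
  \<comment> \<open>Some prime contains the proper ideal \<open>I\<close>; its chain of length 0
    shows that \<open>j - 1\<close> below is not truncated.\<close>
  then have "Suc 0 \<le> j" by (rule less)
  have "krull_dim (diff_ring n Quot I) \<le> enat (j - 1)"
    unfolding dim
  proof (rule Sup_least)
    fix z assume "z \<in> {enat l | l. \<exists>P. ?C l P}"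
    then obtain l P where z: "z = enat l" and C: "?C l P" by blast
    have "Suc l \<le> j" by (rule less[OF C])
    then show "z \<le> enat (j - 1)" using z by simp
  qed
  also have "\<dots> < enat j" using \<open>Suc 0 \<le> j\<close> by simp
  finally show "krull_dim (diff_ring n Quot I) < enat j" .
qed

section \<open>Quotients of free modules\<close>

text \<open>On all functions this is a module action of the full type \<open>'k dop\<close>, so
  calculations use type class arithmetic, and carriers enter only through closure
  conditions.\<close>

definition smul :: "'k::field_char_0 dop \<Rightarrow> (nat \<Rightarrow> 'k dop) \<Rightarrow> nat \<Rightarrow> 'k dop"
  where "smul a f = (\<lambda>k. a * f k)"

lemma smul_apply [simp]: "smul a f k = a * f k"
  by (simp add: smul_def)

interpretation smul: Modules.module smul
  by unfold_locales (auto simp: fun_eq_iff algebra_simps)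

abbreviation Dyc :: "nat \<Rightarrow> nat \<Rightarrow> (nat \<Rightarrow> 'k::field_char_0 dop) set"
  where "Dyc n m \<equiv> carrier (Dy n m)"

lemma Dyc_iff: "f \<in> Dyc n m \<longleftrightarrow> (\<forall>k\<in>{1..m}. f k \<in> DR n) \<and> (\<forall>k. k \<notin> {1..m} \<longrightarrow> f k = 0)"
  by (simp add: Dy_def)

lemma Dy_simps [simp]:
  "f \<oplus>\<^bsub>Dy n m\<^esub> g = f + g" "\<zero>\<^bsub>Dy n m\<^esub> = 0" "a \<odot>\<^bsub>Dy n m\<^esub> f = smul a f"
  by (simp_all add: Dy_def plus_fun_def zero_fun_def smul_def)

lemma Dyc_zero: "0 \<in> Dyc n m"
  by (auto simp: Dyc_iff)

lemma Dyc_add: "f \<in> Dyc n m \<Longrightarrow> g \<in> Dyc n m \<Longrightarrow> f + g \<in> Dyc n m"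
  by (auto simp: Dyc_iff)

lemma Dyc_uminus: "f \<in> Dyc n m \<Longrightarrow> - f \<in> Dyc n m"
  by (auto simp: Dyc_iff fun_Compl_def)

lemma Dyc_smul: "a \<in> DR n \<Longrightarrow> f \<in> Dyc n m \<Longrightarrow> smul a f \<in> Dyc n m"
  by (auto simp: Dyc_iff)

definition dop_closed :: "nat \<Rightarrow> (nat \<Rightarrow> 'k::field_char_0 dop) set \<Rightarrow> bool"
  where "dop_closed n H \<longleftrightarrow> 0 \<in> H \<and> (\<forall>f\<in>H. \<forall>g\<in>H. f + g \<in> H) \<and> (\<forall>a\<in>DR n. \<forall>f\<in>H. smul a f \<in> H)"

lemma dop_closed_zero: "dop_closed n H \<Longrightarrow> 0 \<in> H"
  and dop_closed_add: "dop_closed n H \<Longrightarrow> f \<in> H \<Longrightarrow> g \<in> H \<Longrightarrow> f + g \<in> H"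
  and dop_closed_smul: "dop_closed n H \<Longrightarrow> a \<in> DR n \<Longrightarrow> f \<in> H \<Longrightarrow> smul a f \<in> H"
  by (auto simp: dop_closed_def)

lemma dop_closed_uminus:
  fixes H :: "(nat \<Rightarrow> 'k::field_char_0 dop) set"
  assumes "dop_closed n H" "f \<in> H"
  shows "- f \<in> H"
proof -
  have "(- 1 :: 'k dop) \<in> DR n" by (rule DR_uminus) simp
  then show ?thesis using dop_closed_smul[OF assms(1) _ assms(2)] by fastforce
qed

lemma dop_closed_diff: "dop_closed n H \<Longrightarrow> f \<in> H \<Longrightarrow> g \<in> H \<Longrightarrow> f - g \<in> H"
  using dop_closed_add[of n H f "- g"] dop_closed_uminus[of n H g] by simp

lemma dop_closed_sum: "dop_closed n H \<Longrightarrow> (\<And>x. x \<in> A \<Longrightarrow> f x \<in> H) \<Longrightarrow> sum f A \<in> H"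
  by (induction A rule: infinite_finite_induct) (auto simp: dop_closed_zero dop_closed_add)

lemma abelian_group_Dy: "abelian_group (Dy n m :: ('k::field_char_0 dop, nat \<Rightarrow> 'k dop) module)"
proof (rule abelian_groupI)
  fix x :: "nat \<Rightarrow> 'k dop" assume "x \<in> Dyc n m"
  then show "\<exists>y\<in>Dyc n m. y \<oplus>\<^bsub>Dy n m\<^esub> x = \<zero>\<^bsub>Dy n m\<^esub>"
    by (intro bexI[of _ "- x"]) (auto simp: Dyc_uminus)
qed (auto simp: Dyc_zero Dyc_add algebra_simps)

lemma module_Dy: "Module.module (diff_ring n) (Dy n m :: ('k::field_char_0 dop, nat \<Rightarrow> 'k dop) module)"
  by (rule moduleI) (auto simp: cring_diff_ring abelian_group_Dy Dyc_smul smul.scale_left_distrib smul.scale_right_distrib)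

lemma submodule_Dy_iff:
  "submodule H (diff_ring n) (Dy n m) \<longleftrightarrow> H \<subseteq> Dyc n m \<and> dop_closed n (H :: (nat \<Rightarrow> 'k::field_char_0 dop) set)"
proof
  interpret Module.module "diff_ring n" "Dy n m :: ('k dop, nat \<Rightarrow> 'k dop) module" by (rule module_Dy)
  show "H \<subseteq> Dyc n m \<and> dop_closed n H" if "submodule H (diff_ring n) (Dy n m)"
  proof -
    note E = submoduleE[OF that]
    obtain h where "h \<in> H" using E(2) by blast
    then have "0 \<in> H" using E(4)[OF DR_zero] by fastforce
    then show ?thesis using E(1,4,5) unfolding dop_closed_def by auto
  qed
  assume H: "H \<subseteq> Dyc n m \<and> dop_closed n H"
  show "submodule H (diff_ring n) (Dy n m)"
  proof (rule submoduleI)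
    fix a assume "a \<in> H"
    then have "- a \<in> H" "a \<in> Dyc n m" using H by (auto simp: dop_closed_uminus)
    moreover from this have "\<ominus>\<^bsub>Dy n m\<^esub> a = - a"
      by (intro minus_equality) (auto simp: Dyc_uminus)
    ultimately show "\<ominus>\<^bsub>Dy n m\<^esub> a \<in> H" by simp
  qed (use H in \<open>auto simp: dop_closed_def\<close>)
qed

lemma submodule_generated_Dy:
  fixes S :: "(nat \<Rightarrow> 'k::field_char_0 dop) set"
  assumes "S \<subseteq> Dyc n m"
  defines "N \<equiv> submodule_generated (diff_ring n) (Dy n m) S"
  shows "N \<subseteq> Dyc n m" "dop_closed n N" "S \<subseteq> N"
    and "\<And>H. S \<subseteq> H \<Longrightarrow> H \<subseteq> Dyc n m \<Longrightarrow> dop_closed n H \<Longrightarrow> N \<subseteq> H"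
proof -
  have N: "N = \<Inter>{H. (H \<subseteq> Dyc n m \<and> dop_closed n H) \<and> S \<subseteq> H}"
    unfolding N_def submodule_generated_def submodule_Dy_iff ..
  have "dop_closed n (Dyc n m :: (nat \<Rightarrow> 'k dop) set)"
    by (simp add: dop_closed_def Dyc_zero Dyc_add Dyc_smul)
  then show "N \<subseteq> Dyc n m" unfolding N using assms(1) by blast
  show "dop_closed n N" unfolding N dop_closed_def by blast
  show "S \<subseteq> N" unfolding N by blast
  show "N \<subseteq> H" if "S \<subseteq> H" "H \<subseteq> Dyc n m" "dop_closed n H" for H
    unfolding N using that by blast
qed

locale dop_quotient =
  fixes n m :: nat and N :: "(nat \<Rightarrow> 'k::field_char_0 dop) set"
  assumes N_sub: "N \<subseteq> Dyc n m" and N_closed: "dop_closed n N"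
begin

definition coset :: "(nat \<Rightarrow> 'k dop) \<Rightarrow> (nat \<Rightarrow> 'k dop) set"
  where "coset f = (\<lambda>h. h + f) ` N"

abbreviation Q :: "('k dop, (nat \<Rightarrow> 'k dop) set) module"
  where "Q \<equiv> quotient_module (Dy n m) N"

lemma a_r_coset_eq: "N +>\<^bsub>Dy n m\<^esub> f = coset f"
  by (auto simp: a_r_coset_def' coset_def)

lemma self_mem_coset: "f \<in> coset f"
  unfolding coset_def using dop_closed_zero[OF N_closed] by force

lemma mem_coset_iff: "g \<in> coset f \<longleftrightarrow> g - f \<in> N"
  by (auto simp: coset_def algebra_simps intro: image_eqI[of _ _ "g - f"])

lemma coset_eq_iff: "coset f = coset g \<longleftrightarrow> f - g \<in> N"
proof
  assume "coset f = coset g"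
  then show "f - g \<in> N" using self_mem_coset[of f] mem_coset_iff by blast
next
  assume *: "f - g \<in> N"
  have "h - f \<in> N \<longleftrightarrow> h - g \<in> N" for h
    using dop_closed_add[OF N_closed, of "h - f" "f - g"] dop_closed_diff[OF N_closed, of "h - g" "f - g"] *
    by auto
  then show "coset f = coset g" by (auto simp: mem_coset_iff)
qed

lemma carrier_Q: "carrier Q = coset ` Dyc n m"
  by (auto simp: quotient_module_def A_RCOSETS_def' a_r_coset_eq)

lemma zero_Q: "\<zero>\<^bsub>Q\<^esub> = coset 0"
  by (simp add: quotient_module_def coset_def)

lemma coset_eq_zero_iff: "coset f = \<zero>\<^bsub>Q\<^esub> \<longleftrightarrow> f \<in> N"
  by (simp add: zero_Q coset_eq_iff)

lemma add_Q: "coset f \<oplus>\<^bsub>Q\<^esub> coset g = coset (f + g)"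
proof -
  have "coset f \<oplus>\<^bsub>Q\<^esub> coset g = (\<Union>h\<in>coset f. \<Union>k\<in>coset g. {h + k})"
    by (simp add: quotient_module_def set_add_def')
  also have "\<dots> = coset (f + g)"
  proof (intro subset_antisym subsetI)
    fix x assume "x \<in> (\<Union>h\<in>coset f. \<Union>k\<in>coset g. {h + k})"
    then obtain h k where "x = h + k" "h - f \<in> N" "k - g \<in> N" by (auto simp: mem_coset_iff)
    then show "x \<in> coset (f + g)"
      using dop_closed_add[OF N_closed, of "h - f" "k - g"] by (simp add: mem_coset_iff algebra_simps)
  next
    fix x assume "x \<in> coset (f + g)"
    then have "x - g \<in> coset f" by (simp add: mem_coset_iff algebra_simps)
    then show "x \<in> (\<Union>h\<in>coset f. \<Union>k\<in>coset g. {h + k})" using self_mem_coset[of g] by force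
  qed
  finally show ?thesis .
qed

lemma smult_Q:
  assumes "a \<in> DR n"
  shows "a \<odot>\<^bsub>Q\<^esub> coset f = coset (smul a f)"
proof -
  have "a \<odot>\<^bsub>Q\<^esub> coset f = (\<Union>x\<in>coset f. coset (smul a x))"
    by (simp add: quotient_module_def a_r_coset_eq)
  moreover have "coset (smul a x) = coset (smul a f)" if "x \<in> coset f" for x
    using dop_closed_smul[OF N_closed assms, of "x - f"] that
    by (simp add: mem_coset_iff coset_eq_iff smul.scale_right_diff_distrib)
  ultimately show ?thesis using self_mem_coset[of f] by blast
qed

definition ann :: "(nat \<Rightarrow> 'k dop) \<Rightarrow> 'k dop set"
  where "ann f = {a \<in> DR n. smul a f \<in> N}"

lemma ideal_ann: "ideal (ann f) (diff_ring n)"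
  unfolding ideal_diff_ring_iff ann_def
  using dop_closed_zero[OF N_closed] dop_closed_add[OF N_closed] dop_closed_smul[OF N_closed]
  by (auto simp: smul.scale_left_distrib) (auto simp flip: smul.scale_scale)

lemma annihilator_cyclic_submodule:
  assumes "f \<in> Dyc n m"
  shows "annihilator (diff_ring n) (cyclic_submodule (diff_ring n) Q (coset f)) = ann f"
proof -
  have "(\<forall>b\<in>DR n. a \<odot>\<^bsub>Q\<^esub> (b \<odot>\<^bsub>Q\<^esub> coset f) = \<zero>\<^bsub>Q\<^esub>) \<longleftrightarrow> smul a f \<in> N" if a: "a \<in> DR n" for a
  proof -
    have "(\<forall>b\<in>DR n. a \<odot>\<^bsub>Q\<^esub> (b \<odot>\<^bsub>Q\<^esub> coset f) = \<zero>\<^bsub>Q\<^esub>) \<longleftrightarrow> (\<forall>b\<in>DR n. smul b (smul a f) \<in> N)"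
      by (rule ball_cong[OF refl]) (simp add: a smult_Q coset_eq_zero_iff mult.commute)
    also have "\<dots> \<longleftrightarrow> smul a f \<in> N"
      using dop_closed_smul[OF N_closed] DR_one smul.scale_one by metis
    finally show ?thesis .
  qed
  then show ?thesis unfolding annihilator_def cyclic_submodule_def ann_def by auto
qed

lemma carrier_cyclic_submodule_trivial_iff:
  assumes "f \<in> Dyc n m"
  shows "carrier (cyclic_submodule (diff_ring n) Q (coset f)) = {\<zero>\<^bsub>cyclic_submodule (diff_ring n) Q (coset f)\<^esub>}
    \<longleftrightarrow> f \<in> N"
proof -
  have "carrier (cyclic_submodule (diff_ring n) Q (coset f)) = (\<lambda>a. coset (smul a f)) ` DR n"
    unfolding cyclic_submodule_def by (auto simp: smult_Q) (metis smult_Q)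
  moreover have "\<zero>\<^bsub>cyclic_submodule (diff_ring n) Q (coset f)\<^esub> = coset 0"
    by (simp add: cyclic_submodule_def zero_Q)
  moreover have "(\<lambda>a. coset (smul a f)) ` DR n = {coset 0} \<longleftrightarrow> f \<in> N"
  proof
    assume "(\<lambda>a. coset (smul a f)) ` DR n = {coset 0}"
    then have "coset (smul 1 f) = coset 0" using DR_one by blast
    then show "f \<in> N" by (simp add: coset_eq_iff)
  next
    assume f: "f \<in> N"
    have "coset (smul a f) = coset 0" if "a \<in> DR n" for a
      using dop_closed_smul[OF N_closed that f] by (simp add: coset_eq_iff)
    then show "(\<lambda>a. coset (smul a f)) ` DR n = {coset 0}" using DR_one by auto
  qed
  ultimately show ?thesis by simp
qed

lemma carrier_Q_trivial_iff: "carrier Q = {\<zero>\<^bsub>Q\<^esub>} \<longleftrightarrow> Dyc n m \<subseteq> N"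
proof
  assume *: "carrier Q = {\<zero>\<^bsub>Q\<^esub>}"
  show "Dyc n m \<subseteq> N"
  proof
    fix f :: "nat \<Rightarrow> 'k dop" assume "f \<in> Dyc n m"
    then have "coset f = \<zero>\<^bsub>Q\<^esub>" using * carrier_Q by blast
    then show "f \<in> N" by (simp add: coset_eq_zero_iff)
  qed
next
  assume *: "Dyc n m \<subseteq> N"
  have "coset f = \<zero>\<^bsub>Q\<^esub>" if "f \<in> Dyc n m" for f using * that coset_eq_zero_iff by blast
  then show "carrier Q = {\<zero>\<^bsub>Q\<^esub>}" unfolding carrier_Q using Dyc_zero by blast
qed

definition annQ :: "'k dop set"
  where "annQ = {a \<in> DR n. \<forall>f\<in>Dyc n m. smul a f \<in> N}"

lemma annQ_subset_ann: "f \<in> Dyc n m \<Longrightarrow> annQ \<subseteq> ann f"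
  by (auto simp: annQ_def ann_def)

lemma annihilator_Q: "annihilator (diff_ring n) Q = annQ"
proof -
  have "(\<forall>x\<in>carrier Q. a \<odot>\<^bsub>Q\<^esub> x = \<zero>\<^bsub>Q\<^esub>) \<longleftrightarrow> (\<forall>f\<in>Dyc n m. smul a f \<in> N)" if "a \<in> DR n" for a
    using that by (simp add: carrier_Q smult_Q coset_eq_zero_iff)
  then show ?thesis unfolding annihilator_def annQ_def by blast
qed

lemma ideal_annQ: "ideal annQ (diff_ring n)"
  unfolding ideal_diff_ring_iff annQ_def
  using dop_closed_zero[OF N_closed] dop_closed_add[OF N_closed] dop_closed_smul[OF N_closed]
  by (auto simp: smul.scale_left_distrib) (auto simp flip: smul.scale_scale)

end

text \<open>Polynomial expressions in \<open>a\<close> of formal degree below \<open>s\<close> over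
  \<open>k[d_1,...,d_j]\<close>. Accordingly \<open>x - a ^ s \<in> lowers j a s\<close> says that
  \<open>x\<close> is a monic expression of degree \<open>s\<close> in \<open>a\<close>.\<close>

definition lowers :: "nat \<Rightarrow> 'k::field_char_0 dop \<Rightarrow> nat \<Rightarrow> 'k dop set"
  where "lowers j a s = {\<Sum>i<s. c i * a ^ i | c. \<forall>i. c i \<in> DR j}"

lemma lowers_zero: "0 \<in> lowers j a s"
  unfolding lowers_def by (intro CollectI exI[of _ "\<lambda>_. 0"]) auto

lemma lowers_add: "x \<in> lowers j a s \<Longrightarrow> y \<in> lowers j a s \<Longrightarrow> x + y \<in> lowers j a s"
proof -
  assume "x \<in> lowers j a s" "y \<in> lowers j a s"
  then obtain c d where "x = (\<Sum>i<s. c i * a ^ i)" "y = (\<Sum>i<s. d i * a ^ i)" "\<forall>i. c i \<in> DR j" "\<forall>i. d i \<in> DR j"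
    unfolding lowers_def by blast
  then show ?thesis unfolding lowers_def
    by (intro CollectI exI[of _ "\<lambda>i. c i + d i"]) (auto simp: sum.distrib algebra_simps)
qed

lemma lowers_uminus: "x \<in> lowers j a s \<Longrightarrow> - x \<in> lowers j a s"
proof -
  assume "x \<in> lowers j a s"
  then obtain c where "x = (\<Sum>i<s. c i * a ^ i)" "\<forall>i. c i \<in> DR j"
    unfolding lowers_def by blast
  then show ?thesis unfolding lowers_def
    by (intro CollectI exI[of _ "\<lambda>i. - c i"]) (auto simp: sum_negf)
qed

lemma lowers_diff: "x \<in> lowers j a s \<Longrightarrow> y \<in> lowers j a s \<Longrightarrow> x - y \<in> lowers j a s"
  using lowers_add[of x j a s "- y"] lowers_uminus[of y j a s] by simp

lemma lowers_sum: "(\<And>x. x \<in> A \<Longrightarrow> f x \<in> lowers j a s) \<Longrightarrow> sum f A \<in> lowers j a s"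
  by (induction A rule: infinite_finite_induct) (auto simp: lowers_zero lowers_add)

lemma lowers_single: "c \<in> DR j \<Longrightarrow> i < s \<Longrightarrow> c * a ^ i \<in> lowers j a s"
proof -
  assume "c \<in> DR j" "i < s"
  moreover have "(\<Sum>k<s. (if k = i then c else 0) * a ^ k) = (\<Sum>k<s. if k = i then c * a ^ i else 0)"
    by (rule sum.cong) auto
  ultimately show ?thesis unfolding lowers_def
    by (intro CollectI exI[of _ "\<lambda>k. if k = i then c else 0"]) auto
qed

lemma lowers_mult:
  assumes "x \<in> lowers j a s" "y \<in> lowers j a t"
  shows "x * y \<in> lowers j a (s + t)"
proof -
  obtain c d where x: "x = (\<Sum>i<s. c i * a ^ i)" and y: "y = (\<Sum>i<t. d i * a ^ i)"
    and cd: "\<forall>i. c i \<in> DR j" "\<forall>i. d i \<in> DR j"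
    using assms unfolding lowers_def by blast
  have "x * y = (\<Sum>i<s. \<Sum>k<t. (c i * d k) * a ^ (i + k))"
    unfolding x y sum_product by (simp add: power_add algebra_simps)
  also have "\<dots> \<in> lowers j a (s + t)"
    using cd by (intro lowers_sum lowers_single) auto
  finally show ?thesis .
qed

lemma lowers_power_mult:
  assumes "y \<in> lowers j a t"
  shows "a ^ s * y \<in> lowers j a (s + t)"
proof -
  obtain d where y: "y = (\<Sum>i<t. d i * a ^ i)" and d: "\<forall>i. d i \<in> DR j"
    using assms unfolding lowers_def by blast
  have "a ^ s * y = (\<Sum>k<t. d k * a ^ (s + k))"
    unfolding y sum_distrib_left by (simp add: power_add algebra_simps)
  also have "\<dots> \<in> lowers j a (s + t)"
    using d by (intro lowers_sum lowers_single) auto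
  finally show ?thesis .
qed

lemma monic_mult_lowers:
  assumes "x - a ^ s \<in> lowers j a s" "y \<in> lowers j a t"
  shows "x * y \<in> lowers j a (s + t)"
proof -
  have "x * y = (x - a ^ s) * y + a ^ s * y" by (simp add: algebra_simps)
  then show ?thesis using lowers_add[OF lowers_mult[OF assms] lowers_power_mult[OF assms(2), of s]] by simp
qed

lemma monic_mult:
  assumes "x - a ^ s \<in> lowers j a s" "y - a ^ t \<in> lowers j a t"
  shows "x * y - a ^ (s + t) \<in> lowers j a (s + t)"
proof -
  have "x * y - a ^ (s + t) = x * (y - a ^ t) + a ^ t * (x - a ^ s)" by (simp add: algebra_simps power_add)
  then show ?thesis
    using lowers_add[OF monic_mult_lowers[OF assms] lowers_power_mult[OF assms(1), of t, unfolded add.commute[of t s]]]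
    by simp
qed

lemma lowers_subset_DR:
  assumes "a \<in> DR n" "j \<le> n"
  shows "lowers j a s \<subseteq> DR n"
proof
  fix x assume "x \<in> lowers j a s"
  then obtain c where "x = (\<Sum>i<s. c i * a ^ i)" "\<forall>i. c i \<in> DR j" unfolding lowers_def by blast
  then show "x \<in> DR n" using assms DR_mono[OF assms(2)] by (auto intro!: DR_sum DR_mult DR_power)
qed

lemma monic_in_DR:
  assumes "a \<in> DR n" "j \<le> n" "x - a ^ s \<in> lowers j a s"
  shows "x \<in> DR n"
proof -
  have "(x - a ^ s) + a ^ s \<in> DR n"
    using lowers_subset_DR[OF assms(1,2)] assms(1,3) by (intro DR_add DR_power) auto
  then show ?thesis by simp
qed

text \<open>Gaussian elimination without division replaces the determinant trick: a square system whose diagonal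
  is monic of degree \<open>s\<close> in \<open>a\<close> and whose other entries have lower degree keeps this shape, with \<open>2s\<close>
  in place of \<open>s\<close>, when one unknown is eliminated.\<close>

lemma monic_annihilator_of_square_system:
  fixes e :: "'b \<Rightarrow> nat \<Rightarrow> 'k::field_char_0 dop"
  assumes N: "dop_closed n N" and a: "a \<in> DR n" and jn: "j \<le> n"
    and "finite B" "b0 \<in> B"
    and "\<And>b. b \<in> B \<Longrightarrow> \<beta> b b - a ^ s \<in> lowers j a s"
    and "\<And>b b'. b \<in> B \<Longrightarrow> b' \<in> B \<Longrightarrow> b \<noteq> b' \<Longrightarrow> \<beta> b b' \<in> lowers j a s"
    and "\<And>b. b \<in> B \<Longrightarrow> (\<Sum>b'\<in>B. smul (\<beta> b b') (e b')) \<in> N"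
  shows "\<exists>t p. p - a ^ t \<in> lowers j a t \<and> smul p (e b0) \<in> N"
  using assms(4-)
proof (induction "card B" arbitrary: B \<beta> s)
  case 0
  then show ?case by simp
next
  case (Suc c)
  show ?case
  proof (cases "B = {b0}")
    case True
    then show ?thesis using Suc.prems(3)[of b0] Suc.prems(5)[of b0] by auto
  next
    case False
    then obtain g where g: "g \<in> B" "g \<noteq> b0" using \<open>b0 \<in> B\<close> by blast
    define B' where "B' = B - {g}"
    \<comment> \<open>Row \<open>b\<close> times the pivot minus row \<open>g\<close> times
      \<open>\<beta> b g\<close>: the column of \<open>g\<close> vanishes without any division. The
      diagonal is monic of degree \<open>2s\<close> up to a product of two lower entries.\<close>
    define \<beta>' where "\<beta>' b b' = \<beta> g g * \<beta> b b' - \<beta> b g * \<beta> g b'" for b b'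
    note monic = Suc.prems(3) and low = Suc.prems(4) and sys = Suc.prems(5)
    have B: "b \<in> B" "b \<noteq> g" if "b \<in> B'" for b using that by (auto simp: B'_def)
    have DR: "\<beta> b b' \<in> DR n" if "b \<in> B" "b' \<in> B" for b b'
      using monic_in_DR[OF a jn monic[OF that(1)]] low[OF that] lowers_subset_DR[OF a jn] by (cases "b = b'") auto
    show ?thesis
    proof (rule Suc.hyps(1)[of B' \<beta>' "s + s"])
      show "c = card B'" using Suc.hyps(2) g by (simp add: B'_def)
      show "finite B'" "b0 \<in> B'" using Suc.prems(1,2) g by (auto simp: B'_def)
      show "\<beta>' b b - a ^ (s + s) \<in> lowers j a (s + s)" if "b \<in> B'" for b
      proof -
        have eq: "\<beta>' b b - a ^ (s + s) = (\<beta> g g * \<beta> b b - a ^ (s + s)) - \<beta> b g * \<beta> g b"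
          by (simp add: \<beta>'_def)
        show ?thesis unfolding eq
          by (rule lowers_diff[OF monic_mult[OF monic[OF g(1)] monic[OF B(1)[OF that]]]
              lowers_mult[OF low[OF B(1)[OF that] g(1) B(2)[OF that]] low[OF g(1) B(1)[OF that] B(2)[OF that, symmetric]]]])
      qed
      show "\<beta>' b b' \<in> lowers j a (s + s)" if "b \<in> B'" "b' \<in> B'" "b \<noteq> b'" for b b'
        unfolding \<beta>'_def
        using lowers_diff[OF monic_mult_lowers[OF monic[OF g(1)] low] lowers_mult[OF low low]]
          B[OF that(1)] B[OF that(2)] that(3) g(1) by metis
      show "(\<Sum>b'\<in>B'. smul (\<beta>' b b') (e b')) \<in> N" if "b \<in> B'" for b
      proof -
        have "(\<Sum>b'\<in>B'. smul (\<beta>' b b') (e b')) = (\<Sum>b'\<in>B. smul (\<beta>' b b') (e b'))"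
          unfolding B'_def using Suc.prems(1) by (intro sum.mono_neutral_left) (auto simp: \<beta>'_def)
        also have "\<dots> = smul (\<beta> g g) (\<Sum>b'\<in>B. smul (\<beta> b b') (e b')) - smul (\<beta> b g) (\<Sum>b'\<in>B. smul (\<beta> g b') (e b'))"
          unfolding smul.scale_sum_right sum_subtractf[symmetric]
          by (rule sum.cong) (auto simp: \<beta>'_def smul.scale_left_diff_distrib)
        also have "\<dots> \<in> N"
          using B[OF that] g(1) sys DR by (intro dop_closed_diff[OF N] dop_closed_smul[OF N]) auto
        finally show ?thesis .
      qed
    qed
  qed
qed

context dop_quotient
begin

text \<open>Multiplication by \<open>a\<close> acts on the generators by a matrix \<open>C\<close>
  over \<open>k[d_1,...,d_j]\<close>, so the entries \<beta> of \<open>a\<close> times the identity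
  minus \<open>C\<close> form a system with monic diagonal. Elimination yields for every generator a
  monic expression in \<open>a\<close> that kills it, and the product of these is monic and kills
  the whole module.\<close>

lemma integral_mod_annQ:
  fixes e :: "'b \<Rightarrow> nat \<Rightarrow> 'k dop"
  assumes jn: "j \<le> n" and B: "finite B" and e: "\<And>b. b \<in> B \<Longrightarrow> e b \<in> Dyc n m"
    and gen: "\<And>f. f \<in> Dyc n m \<Longrightarrow> \<exists>c. (\<forall>b\<in>B. c b \<in> DR j) \<and> f - (\<Sum>b\<in>B. smul (c b) (e b)) \<in> N"
  shows "integral_mod n j annQ"
  unfolding integral_mod_def
proof
  fix a :: "'k dop" assume a: "a \<in> DR n"
  have "\<exists>c. (\<forall>b'\<in>B. c b' \<in> DR j) \<and> smul a (e b) - (\<Sum>b'\<in>B. smul (c b') (e b')) \<in> N" if "b \<in> B" for b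
    using gen[OF Dyc_smul[OF a e[OF that]]] .
  then have "\<exists>C. \<forall>b\<in>B. (\<forall>b'\<in>B. C b b' \<in> DR j) \<and> smul a (e b) - (\<Sum>b'\<in>B. smul (C b b') (e b')) \<in> N"
    by (intro bchoice ballI)
  then obtain C where C: "\<And>b b'. b \<in> B \<Longrightarrow> b' \<in> B \<Longrightarrow> C b b' \<in> DR j"
    "\<And>b. b \<in> B \<Longrightarrow> smul a (e b) - (\<Sum>b'\<in>B. smul (C b b') (e b')) \<in> N" by blast
  define \<beta> where "\<beta> b b' = (if b = b' then a else 0) - C b b'" for b b'
  have low: "- C b b' \<in> lowers j a 1" if "b \<in> B" "b' \<in> B" for b b'
    using lowers_single[of "- C b b'" j 0 1 a] C(1)[OF that] by auto
  have "\<exists>t p. p - a ^ t \<in> lowers j a t \<and> smul p (e b) \<in> N" if "b \<in> B" for b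
  proof (rule monic_annihilator_of_square_system[where \<beta> = \<beta> and s = 1, OF N_closed a jn B that])
    fix b assume b: "b \<in> B"
    show "\<beta> b b - a ^ 1 \<in> lowers j a 1" using low[OF b b] by (simp add: \<beta>_def)
    have "(\<Sum>b'\<in>B. smul (\<beta> b b') (e b')) = (\<Sum>b'\<in>B. if b' = b then smul a (e b) else 0) - (\<Sum>b'\<in>B. smul (C b b') (e b'))"
      unfolding sum_subtractf[symmetric] by (rule sum.cong) (auto simp: \<beta>_def smul.scale_left_diff_distrib)
    also have "\<dots> = smul a (e b) - (\<Sum>b'\<in>B. smul (C b b') (e b'))" using B b by simp
    finally show "(\<Sum>b'\<in>B. smul (\<beta> b b') (e b')) \<in> N" using C(2)[OF b] by simp
  next
    fix b b' assume "b \<in> B" "b' \<in> B" "b \<noteq> b'"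
    then show "\<beta> b b' \<in> lowers j a 1" using low by (simp add: \<beta>_def)
  qed
  then obtain t p where tp: "\<And>b. b \<in> B \<Longrightarrow> p b - a ^ t b \<in> lowers j a (t b)" "\<And>b. b \<in> B \<Longrightarrow> smul (p b) (e b) \<in> N"
    by metis
  have pDR: "p b \<in> DR n" if "b \<in> B" for b using monic_in_DR[OF a jn tp(1)[OF that]] .
  have "prod p A - a ^ sum t A \<in> lowers j a (sum t A) \<and> prod p A \<in> DR n \<and> (\<forall>b\<in>A. smul (prod p A) (e b) \<in> N)"
    if "A \<subseteq> B" for A
    using finite_subset[OF that B] that
  proof (induction A rule: finite_induct)
    case empty
    then show ?case by (simp add: lowers_zero)
  next
    case (insert b A)
    have sub: "A \<subseteq> B" and b: "b \<in> B" using insert.prems by auto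
    have IH: "prod p A - a ^ sum t A \<in> lowers j a (sum t A)" "prod p A \<in> DR n"
      "\<And>b. b \<in> A \<Longrightarrow> smul (prod p A) (e b) \<in> N"
      using insert.IH[OF sub] by blast+
    have "smul (p b * prod p A) (e b') \<in> N" if "b' \<in> insert b A" for b'
    proof (cases "b' = b")
      case True
      have "smul (prod p A) (smul (p b) (e b)) \<in> N" using dop_closed_smul[OF N_closed IH(2) tp(2)[OF b]] .
      then show ?thesis using True by (simp add: mult.commute)
    next
      case False
      then have "smul (p b) (smul (prod p A) (e b')) \<in> N"
        using that dop_closed_smul[OF N_closed pDR[OF b] IH(3)] by auto
      then show ?thesis by simp
    qed
    moreover have "prod p (insert b A) = p b * prod p A" "sum t (insert b A) = t b + sum t A"
      using insert.hyps by simp_all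
    ultimately show ?case
      using monic_mult[OF tp(1)[OF b] IH(1)] DR_mult[OF pDR[OF b] IH(2)] by metis
  qed
  from this[OF subset_refl] have P: "prod p B - a ^ sum t B \<in> lowers j a (sum t B)" "prod p B \<in> DR n"
    "\<And>b. b \<in> B \<Longrightarrow> smul (prod p B) (e b) \<in> N" by blast+
  have "smul (prod p B) f \<in> N" if f: "f \<in> Dyc n m" for f
  proof -
    obtain c where c: "\<forall>b\<in>B. c b \<in> DR j" "f - (\<Sum>b\<in>B. smul (c b) (e b)) \<in> N" using gen[OF f] by blast
    have cN: "smul (c b) (smul (prod p B) (e b)) \<in> N" if "b \<in> B" for b
      by (rule dop_closed_smul[OF N_closed]) (use c(1) P(3)[OF that] DR_mono[OF jn] that in auto)
    have "smul (prod p B) f = smul (prod p B) (f - (\<Sum>b\<in>B. smul (c b) (e b))) + (\<Sum>b\<in>B. smul (c b) (smul (prod p B) (e b)))"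
      by (simp add: smul.scale_right_diff_distrib smul.scale_sum_right mult.commute)
    also have "\<dots> \<in> N"
      by (rule dop_closed_add[OF N_closed dop_closed_smul[OF N_closed P(2) c(2)] dop_closed_sum[OF N_closed cN]])
    finally show ?thesis .
  qed
  then have "prod p B \<in> annQ" using P(2) by (simp add: annQ_def)
  moreover obtain c where "prod p B - a ^ sum t B = (\<Sum>i<sum t B. c i * a ^ i)" "\<forall>i. c i \<in> DR j"
    using P(1) unfolding lowers_def by blast
  ultimately have "(\<forall>i<sum t B. c i \<in> DR j) \<and> a ^ sum t B + (\<Sum>i<sum t B. c i * a ^ i) \<in> annQ"
    by (metis add.commute diff_add_cancel)
  then show "\<exists>N c. (\<forall>i<N. c i \<in> DR j) \<and> a ^ N + (\<Sum>i<N. c i * a ^ i) \<in> annQ" by blast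
qed

end

section \<open>Involutive systems\<close>

text \<open>Keeps the exponent in \<open>Poly_Mapping.single i 1\<close> literal, since rules such
  as \<open>wsum_single\<close> are stated with \<open>1\<close> and not with
  \<open>Suc 0\<close>.\<close>

declare One_nat_def [simp del]

text \<open>Covers both the total degree and the weight in which \<open>d_i\<close> counts
  \<open>i\<close>. The latter grows when, at equal degree, a derivation is exchanged for one of
  larger index.\<close>

definition wsum :: "(nat \<Rightarrow> nat) \<Rightarrow> multi_index \<Rightarrow> nat"
  where "wsum h \<mu> = (\<Sum>i\<in>Poly_Mapping.keys \<mu>. h i * Poly_Mapping.lookup \<mu> i)"

lemma wsum_superset:
  assumes "finite K" "Poly_Mapping.keys \<mu> \<subseteq> K"
  shows "wsum h \<mu> = (\<Sum>i\<in>K. h i * Poly_Mapping.lookup \<mu> i)"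
  unfolding wsum_def using assms by (intro sum.mono_neutral_left) (auto simp: in_keys_iff)

lemma wsum_add: "wsum h (\<mu> + \<nu>) = wsum h \<mu> + wsum h \<nu>"
proof -
  let ?K = "Poly_Mapping.keys \<mu> \<union> Poly_Mapping.keys \<nu>"
  have "wsum h (\<mu> + \<nu>) = (\<Sum>i\<in>?K. h i * Poly_Mapping.lookup (\<mu> + \<nu>) i)"
    by (rule wsum_superset) (auto simp: keys_add_multi_index)
  also have "\<dots> = (\<Sum>i\<in>?K. h i * Poly_Mapping.lookup \<mu> i) + (\<Sum>i\<in>?K. h i * Poly_Mapping.lookup \<nu> i)"
    by (simp add: lookup_add algebra_simps sum.distrib)
  also have "\<dots> = wsum h \<mu> + wsum h \<nu>"
    using wsum_superset[of ?K \<mu> h] wsum_superset[of ?K \<nu> h] by simp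
  finally show ?thesis .
qed

lemma wsum_single [simp]: "wsum h (Poly_Mapping.single i 1) = h i"
  by (simp add: wsum_def)

lemma wsum_zero [simp]: "wsum h 0 = 0"
  by (simp add: wsum_def)

abbreviation mdeg :: "multi_index \<Rightarrow> nat" where "mdeg \<equiv> wsum (\<lambda>_. 1)"
abbreviation weight :: "multi_index \<Rightarrow> nat" where "weight \<equiv> wsum (\<lambda>i. i)"

lemma jet_order_eq: "jet_order v = mdeg (snd v)"
  by (simp add: jet_order_def wsum_def)

lemma mdeg_eq_0_iff: "mdeg \<mu> = 0 \<longleftrightarrow> \<mu> = 0"
  by (auto simp: wsum_def in_keys_iff poly_mapping_eq_iff fun_eq_iff)

lemma single_add_minus:
  fixes \<mu> :: multi_index
  assumes "i \<in> Poly_Mapping.keys \<mu>"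
  shows "Poly_Mapping.single i 1 + (\<mu> - Poly_Mapping.single i 1) = \<mu>"
  using assms by (intro poly_mapping_eqI) (auto simp: lookup_add lookup_minus lookup_single when_def in_keys_iff)

lemma keys_minus_single: "Poly_Mapping.keys (\<mu> - Poly_Mapping.single i 1 :: multi_index) \<subseteq> Poly_Mapping.keys \<mu>"
  by (auto simp: in_keys_iff lookup_minus)

text \<open>Stands in for a term order: the principal jets need not be leading jets of one.\<close>

lemma weight_minimal:
  assumes eq: "u\<^sub>0 + \<nu>\<^sub>0 = u + (\<nu> :: multi_index)" and deg: "mdeg \<nu> = mdeg \<nu>\<^sub>0"
    and "Poly_Mapping.keys \<nu>\<^sub>0 \<subseteq> {..c}" "Poly_Mapping.keys u\<^sub>0 \<subseteq> {c..}"
  shows "weight \<nu>\<^sub>0 \<le> weight \<nu>" and "weight \<nu> = weight \<nu>\<^sub>0 \<Longrightarrow> \<nu> = \<nu>\<^sub>0"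
proof -
  let ?K = "insert c (Poly_Mapping.keys \<nu> \<union> Poly_Mapping.keys \<nu>\<^sub>0)"
  let ?a = "\<lambda>i. int (Poly_Mapping.lookup \<nu> i)" and ?b = "\<lambda>i. int (Poly_Mapping.lookup \<nu>\<^sub>0 i)"
  \<comment> \<open>Each term is nonnegative: below \<open>c\<close> the multi-index
    \<open>u\<^sub>0\<close> vanishes, so \<nu> is at most \<open>\<nu>\<^sub>0\<close> there, and
    above \<open>c\<close> the multi-index \<open>\<nu>\<^sub>0\<close> vanishes. Since the degrees
    agree, the shift by \<open>c\<close> drops out and the sum is the difference of the
    weights.\<close>
  let ?t = "\<lambda>i. (int i - int c) * (?a i - ?b i)"
  have nonneg: "0 \<le> ?t i" for i
  proof (cases "i < c")
    case True
    then have "i \<notin> Poly_Mapping.keys u\<^sub>0" using assms(4) by auto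
    then have "Poly_Mapping.lookup u\<^sub>0 i = 0" by (simp add: in_keys_iff)
    then have "Poly_Mapping.lookup \<nu> i \<le> Poly_Mapping.lookup \<nu>\<^sub>0 i"
      using arg_cong[OF eq, of "\<lambda>x. Poly_Mapping.lookup x i"] by (simp add: lookup_add)
    then show ?thesis using True by (intro mult_nonpos_nonpos) auto
  next
    case False
    show ?thesis
    proof (cases "i = c")
      case False
      then have "i \<notin> Poly_Mapping.keys \<nu>\<^sub>0" using assms(3) \<open>\<not> i < c\<close> by auto
      then have "Poly_Mapping.lookup \<nu>\<^sub>0 i = 0" by (simp add: in_keys_iff)
      then show ?thesis using \<open>\<not> i < c\<close> by simp
    qed simp
  qed
  have d: "int (wsum h \<nu>) = (\<Sum>i\<in>?K. int (h i) * ?a i)" "int (wsum h \<nu>\<^sub>0) = (\<Sum>i\<in>?K. int (h i) * ?b i)" for h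
    by (subst wsum_superset[of ?K], auto)+
  have s: "(\<Sum>i\<in>?K. ?a i) = (\<Sum>i\<in>?K. ?b i)"
    using d[of "\<lambda>_. 1"] deg by simp
  have "(\<Sum>i\<in>?K. ?t i) = ((\<Sum>i\<in>?K. int i * ?a i) - (\<Sum>i\<in>?K. int i * ?b i)) - int c * ((\<Sum>i\<in>?K. ?a i) - (\<Sum>i\<in>?K. ?b i))"
    unfolding sum_distrib_left sum_subtractf[symmetric] by (rule sum.cong) (auto simp: algebra_simps)
  then have w: "(\<Sum>i\<in>?K. ?t i) = int (weight \<nu>) - int (weight \<nu>\<^sub>0)"
    unfolding s d by simp
  have "0 \<le> (\<Sum>i\<in>?K. ?t i)" using nonneg by (intro sum_nonneg)
  then show "weight \<nu>\<^sub>0 \<le> weight \<nu>" using w by simp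
  show "\<nu> = \<nu>\<^sub>0" if "weight \<nu> = weight \<nu>\<^sub>0"
  proof -
    have "(\<Sum>i\<in>?K. ?t i) = 0" using w that by simp
    then have "\<forall>i\<in>?K. ?t i = 0" using nonneg by (subst (asm) sum_nonneg_eq_0_iff) auto
    then have ne: "?a i = ?b i" if "i \<in> ?K" "i \<noteq> c" for i using that by auto
    have "?a c + (\<Sum>i\<in>?K - {c}. ?a i) = ?b c + (\<Sum>i\<in>?K - {c}. ?b i)"
      using s by (subst (asm) (1 2) sum.remove[of _ c]) auto
    moreover have "(\<Sum>i\<in>?K - {c}. ?a i) = (\<Sum>i\<in>?K - {c}. ?b i)"
      using ne by (intro sum.cong) auto
    ultimately have "?a c = ?b c" by simp
    then have "?a i = ?b i" for i using ne by (cases "i \<in> ?K") (auto simp: in_keys_iff)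
    then show ?thesis by (intro poly_mapping_eqI) simp
  qed
qed

lemma const_uminus: "const (- c) = - const c"
  by (simp add: const_def single_uminus)

lemma sum_fun_apply: "(\<Sum>x\<in>A. f x) k = (\<Sum>x\<in>A. f x k)"
  by (induction A rule: infinite_finite_induct) auto

interpretation dyv: vector_space "\<lambda>c (f :: nat \<Rightarrow> 'k::field_char_0 dop). smul (const c) f"
  by unfold_locales
    (auto simp: smul.scale_right_distrib smul.scale_left_distrib const_add const_mult_const)

lemma jet_coeff_add: "jet_coeff (f + g) v = jet_coeff f v + jet_coeff g v"
  by (simp add: jet_coeff_def lookup_add)

lemma jet_coeff_sum: "jet_coeff (\<Sum>x\<in>A. f x) v = (\<Sum>x\<in>A. jet_coeff (f x) v)"
  by (simp add: jet_coeff_def sum_fun_apply lookup_sum)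

lemma jet_coeff_const: "jet_coeff (smul (const c) f) v = c * jet_coeff f v"
  by (simp add: jet_coeff_def lookup_const_mult)

lemma jet_coeff_single:
  "jet_coeff (smul (Poly_Mapping.single \<nu> 1) f) (k, \<nu> + \<mu>) = jet_coeff f (k, \<mu>)"
  using lookup_single_mult_add[of \<nu> 1] by (simp add: jet_coeff_def)

lemma jet_coeff_single_nonzero:
  assumes "jet_coeff (smul (Poly_Mapping.single \<nu> 1) f) (k, w) \<noteq> 0"
  obtains \<mu> where "w = \<nu> + \<mu>" "jet_coeff f (k, \<mu>) \<noteq> 0"
proof -
  have "Poly_Mapping.lookup (Poly_Mapping.single \<nu> 1 * f k) w \<noteq> 0" using assms by (simp add: jet_coeff_def)
  then show ?thesis using that by (elim lookup_single_mult_nonzero) (simp add: jet_coeff_def)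
qed

text \<open>The jet \<open>y^k_\<mu>\<close> as an element of \<open>Dy\<close>.\<close>

definition jetel :: "nat \<Rightarrow> multi_index \<Rightarrow> nat \<Rightarrow> 'k::field_char_0 dop"
  where "jetel k \<mu> = (\<lambda>k'. if k' = k then Poly_Mapping.single \<mu> 1 else 0)"

lemma jetel_Dyc: "k \<in> {1..m} \<Longrightarrow> Poly_Mapping.keys \<mu> \<subseteq> {1..n} \<Longrightarrow> jetel k \<mu> \<in> Dyc n m"
  by (auto simp: Dyc_iff jetel_def DR_single)

lemma der_jetel: "smul (der l) (jetel k \<mu>) = jetel k (Poly_Mapping.single l 1 + \<mu>)"
  by (auto simp: jetel_def der_def mult_single fun_eq_iff)

lemma Dyc_expansion:
  assumes "f \<in> Dyc n m"
  shows "f = (\<Sum>v\<in>(SIGMA k:{1..m}. Poly_Mapping.keys (f k)). smul (const (jet_coeff f v)) (jetel (fst v) (snd v)))"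
proof
  fix k
  have "(\<Sum>v\<in>(SIGMA k:{1..m}. Poly_Mapping.keys (f k)). smul (const (jet_coeff f v)) (jetel (fst v) (snd v))) k
    = (\<Sum>k'\<in>{1..m}. \<Sum>\<mu>\<in>Poly_Mapping.keys (f k'). if k' = k then Poly_Mapping.single \<mu> (Poly_Mapping.lookup (f k) \<mu>) else 0)"
    unfolding sum_fun_apply
    by (subst sum.Sigma) (auto simp: jetel_def const_def mult_single jet_coeff_def intro!: sum.cong)
  also have "\<dots> = (\<Sum>k'\<in>{1..m}. if k' = k then f k else 0)"
    by (rule sum.cong) (auto simp: poly_mapping_eq_sum_single[symmetric])
  also have "\<dots> = f k" using assms by (auto simp: Dyc_iff)
  finally show "f k = (\<Sum>v\<in>(SIGMA k:{1..m}. Poly_Mapping.keys (f k)). smul (const (jet_coeff f v)) (jetel (fst v) (snd v))) k" ..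
qed

lemma has_class_unique: "has_class v i \<Longrightarrow> has_class v j \<Longrightarrow> i = j"
  unfolding has_class_def by (metis linorder_neqE_nat)

lemma has_class_Min:
  assumes "Poly_Mapping.keys \<mu> \<subseteq> {1..n}" "\<mu> \<noteq> 0"
  shows "has_class (k, \<mu>) (Min (Poly_Mapping.keys \<mu>))" and "Min (Poly_Mapping.keys \<mu>) \<in> Poly_Mapping.keys \<mu>"
proof -
  show *: "Min (Poly_Mapping.keys \<mu>) \<in> Poly_Mapping.keys \<mu>" using assms by (intro Min_in) auto
  have "j \<notin> Poly_Mapping.keys \<mu>" if "j < Min (Poly_Mapping.keys \<mu>)" for j
    using that Min_le[of "Poly_Mapping.keys \<mu>" j] by fastforce
  then show "has_class (k, \<mu>) (Min (Poly_Mapping.keys \<mu>))"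
    using * assms unfolding has_class_def in_keys_iff by fastforce
qed

lemma finite_ex_max:
  assumes "finite A" "A \<noteq> {}"
  shows "\<exists>x\<in>A. \<forall>y\<in>A. (f y :: nat) \<le> f x"
proof -
  have "Max (f ` A) \<in> f ` A" using assms by (intro Max_in) auto
  then obtain x where "x \<in> A" "Max (f ` A) = f x" by auto
  then show ?thesis using assms Max_ge[of "f ` A"] by fastforce
qed

section \<open>Leading jets in combinations of prolongations\<close>

locale involutive =
  fixes n m q :: nat and T :: "'i set" and \<Phi> :: "'i \<Rightarrow> nat \<Rightarrow> 'k::field_char_0 dop" and pri :: "'i \<Rightarrow> jet"
  assumes sys: "system_of_order n m q T \<Phi>" and solved: "solved_form q T \<Phi> pri"
    and prol: "\<forall>\<tau>\<in>T. \<forall>j\<in>{1..n} - multiplicative n q T \<Phi> pri \<tau>.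
        \<exists>(a :: 'i \<Rightarrow> 'k) (b :: 'i \<Rightarrow> nat \<Rightarrow> 'k). \<forall>k.
          der j * \<Phi> \<tau> k =
            (\<Sum>\<sigma>\<in>T. const (a \<sigma>) * \<Phi> \<sigma> k)
          + (\<Sum>\<sigma>\<in>T. \<Sum>i\<in>multiplicative n q T \<Phi> pri \<sigma>. const (b \<sigma> i) * (der i * \<Phi> \<sigma> k))"
begin

abbreviation top where "top \<equiv> top_eqs q T \<Phi>"
abbreviation mult where "mult \<equiv> multiplicative n q T \<Phi> pri"

definition cls :: "'i \<Rightarrow> nat" where "cls \<sigma> = (THE i. has_class (pri \<sigma>) i)"

lemma finT: "finite T" and Phi_Dyc: "\<sigma> \<in> T \<Longrightarrow> \<Phi> \<sigma> \<in> Dyc n m"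
  and Phi_order: "\<sigma> \<in> T \<Longrightarrow> jet_coeff (\<Phi> \<sigma>) v \<noteq> 0 \<Longrightarrow> mdeg (snd v) \<le> q"
  using sys unfolding system_of_order_def jet_order_eq by blast+

lemma top_sub: "top \<subseteq> T"
  by (auto simp: top_eqs_def)

lemma Phi_lower: "\<sigma> \<in> T \<Longrightarrow> \<sigma> \<notin> top \<Longrightarrow> jet_coeff (\<Phi> \<sigma>) v \<noteq> 0 \<Longrightarrow> mdeg (snd v) < q"
  using Phi_order[of \<sigma> v] unfolding top_eqs_def jet_order_eq le_less by blast

lemma Phi_supp:
  assumes "\<sigma> \<in> T" "jet_coeff (\<Phi> \<sigma>) v \<noteq> 0"
  shows "fst v \<in> {1..m}" "Poly_Mapping.keys (snd v) \<subseteq> {1..n}"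
proof -
  have *: "Poly_Mapping.lookup (\<Phi> \<sigma> (fst v)) (snd v) \<noteq> 0" using assms by (simp add: jet_coeff_def)
  show "fst v \<in> {1..m}"
  proof (rule ccontr)
    assume "fst v \<notin> {1..m}"
    then have "\<Phi> \<sigma> (fst v) = 0" using Phi_Dyc[OF assms(1)] by (auto simp: Dyc_iff)
    then show False using * by simp
  qed
  then have "\<Phi> \<sigma> (fst v) \<in> DR n" using Phi_Dyc[OF assms(1)] by (auto simp: Dyc_iff)
  then show "Poly_Mapping.keys (snd v) \<subseteq> {1..n}" using * by (auto simp: DR_iff in_keys_iff)
qed

lemma pri_props:
  assumes "\<sigma> \<in> top"
  shows "mdeg (snd (pri \<sigma>)) = q" "jet_coeff (\<Phi> \<sigma>) (pri \<sigma>) = 1"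
    "\<And>\<tau>. \<tau> \<in> T \<Longrightarrow> jet_coeff (\<Phi> \<tau>) (pri \<sigma>) \<noteq> 0 \<Longrightarrow> \<tau> = \<sigma>"
    "has_class (pri \<sigma>) (cls \<sigma>)" "fst (pri \<sigma>) \<in> {1..m}" "Poly_Mapping.keys (snd (pri \<sigma>)) \<subseteq> {1..n}"
    "Poly_Mapping.keys (snd (pri \<sigma>)) \<subseteq> {cls \<sigma>..}" "cls \<sigma> \<le> n" "1 \<le> q"
    "mult \<sigma> = {1..cls \<sigma>}"
proof -
  have T: "\<sigma> \<in> T" using assms top_sub by blast
  show "mdeg (snd (pri \<sigma>)) = q" "jet_coeff (\<Phi> \<sigma>) (pri \<sigma>) = 1"
    "\<And>\<tau>. \<tau> \<in> T \<Longrightarrow> jet_coeff (\<Phi> \<tau>) (pri \<sigma>) \<noteq> 0 \<Longrightarrow> \<tau> = \<sigma>"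
    using solved assms by (auto simp: solved_form_def jet_order_eq)
  obtain i where i: "has_class (pri \<sigma>) i" using solved assms by (auto simp: solved_form_def)
  then have "cls \<sigma> = i" unfolding cls_def using has_class_unique by blast
  then show cls: "has_class (pri \<sigma>) (cls \<sigma>)" using i by simp
  have "jet_coeff (\<Phi> \<sigma>) (pri \<sigma>) \<noteq> 0" using solved assms by (auto simp: solved_form_def)
  note supp = Phi_supp[OF T this]
  then show "fst (pri \<sigma>) \<in> {1..m}" "Poly_Mapping.keys (snd (pri \<sigma>)) \<subseteq> {1..n}" by auto
  show "Poly_Mapping.keys (snd (pri \<sigma>)) \<subseteq> {cls \<sigma>..}"
  proof
    fix j assume j: "j \<in> Poly_Mapping.keys (snd (pri \<sigma>))"
    then have "1 \<le> j" using supp by auto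
    then show "j \<in> {cls \<sigma>..}" using j cls unfolding has_class_def in_keys_iff by (metis atLeast_iff not_le)
  qed
  have "cls \<sigma> \<in> Poly_Mapping.keys (snd (pri \<sigma>))" using cls by (auto simp: has_class_def in_keys_iff)
  then show "cls \<sigma> \<le> n" using supp by auto
  \<comment> \<open>A jet with a class is not of order 0. So for \<open>q = 0\<close> there are no
    equations in \<open>top\<close>, which settles that case in
    \<open>noether_normalization\<close>.\<close>
  have "snd (pri \<sigma>) \<noteq> 0" using \<open>cls \<sigma> \<in> _\<close> by auto
  then show "1 \<le> q" using \<open>mdeg (snd (pri \<sigma>)) = q\<close> mdeg_eq_0_iff[of "snd (pri \<sigma>)"] by linarith
  show "mult \<sigma> = {1..cls \<sigma>}"
    unfolding multiplicative_def using assms cls \<open>cls \<sigma> \<le> n\<close> has_class_unique by fastforce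
qed

lemma mult_not_top: "\<sigma> \<notin> top \<Longrightarrow> mult \<sigma> = {}"
  by (auto simp: multiplicative_def)

definition gen :: "'i \<Rightarrow> multi_index \<Rightarrow> nat \<Rightarrow> 'k dop"
  where "gen \<sigma> \<nu> = smul (Poly_Mapping.single \<nu> 1) (\<Phi> \<sigma>)"

lemma gen_zero [simp]: "gen \<sigma> 0 = \<Phi> \<sigma>"
  by (simp add: gen_def)

lemma gen_single [simp]: "gen \<sigma> (Poly_Mapping.single i 1) = smul (der i) (\<Phi> \<sigma>)"
  by (simp add: gen_def der_def)

lemma gen_add: "smul (Poly_Mapping.single \<mu> 1) (gen \<sigma> \<nu>) = gen \<sigma> (\<mu> + \<nu>)"
  by (simp add: gen_def mult_single)

text \<open>Indices of the equations of order \<open>q\<close> together with all their iterated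
  multiplicative prolongations; \<nu> = 0 stands for the equation itself.\<close>

definition AdmT :: "('i \<times> multi_index) set"
  where "AdmT = {(\<sigma>, \<nu>). \<sigma> \<in> top \<and> Poly_Mapping.keys \<nu> \<subseteq> {1..cls \<sigma>}}"

text \<open>Take \<nu> of greatest degree and, within that degree, of greatest weight. If another
  term, with factor \<nu>', contains the prolonged principal jet, it does so through a jet of order
  at most \<open>q\<close>, so \<nu>' has the degree of \<nu>. By \<open>weight_minimal\<close> its
  weight is at least that of \<nu>, so maximality forces \<nu>' = \<nu>. The jet used is then
  \<open>pri \<sigma>\<close>, which occurs in no other equation. The rest \<open>R\<close> has too
  low an order to interfere.\<close>

lemma leading_jet:
  assumes "finite A" "A \<subseteq> AdmT" "A \<noteq> {}" and c: "\<forall>p\<in>A. c p \<noteq> 0"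
    and R: "\<forall>v. jet_coeff R v \<noteq> 0 \<longrightarrow> mdeg (snd v) < q"
  obtains \<sigma> \<nu> where "(\<sigma>, \<nu>) \<in> A"
    "jet_coeff (R + (\<Sum>p\<in>A. smul (const (c p)) (case_prod gen p))) (fst (pri \<sigma>), \<nu> + snd (pri \<sigma>)) \<noteq> 0"
    "\<And>\<sigma>' \<nu>'. (\<sigma>', \<nu>') \<in> A \<Longrightarrow> mdeg \<nu>' \<le> mdeg \<nu>"
    "\<And>\<sigma>' \<nu>'. (\<sigma>', \<nu>') \<in> A \<Longrightarrow> mdeg \<nu>' = mdeg \<nu> \<Longrightarrow> weight \<nu>' \<le> weight \<nu>"
proof -
  obtain p1 where p1: "p1 \<in> A" "\<And>p. p \<in> A \<Longrightarrow> mdeg (snd p) \<le> mdeg (snd p1)"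
    using finite_ex_max[OF assms(1,3), of "\<lambda>p. mdeg (snd p)"] by blast
  define A' where "A' = {p \<in> A. mdeg (snd p) = mdeg (snd p1)}"
  have "p1 \<in> A'" "finite A'" using assms(1) p1 by (simp_all add: A'_def)
  then have "finite A'" "A' \<noteq> {}" by auto
  then obtain p0 where p0: "p0 \<in> A'" "\<And>p. p \<in> A' \<Longrightarrow> weight (snd p) \<le> weight (snd p0)"
    using finite_ex_max[of A' "\<lambda>p. weight (snd p)"] by blast
  obtain \<sigma> \<nu> where \<sigma>\<nu>: "p0 = (\<sigma>, \<nu>)" by force
  have mem: "(\<sigma>, \<nu>) \<in> A" and deg: "mdeg \<nu> = mdeg (snd p1)" using p0(1) by (auto simp: A'_def \<sigma>\<nu>)
  have maxdeg: "mdeg \<nu>' \<le> mdeg \<nu>" if "(\<sigma>', \<nu>') \<in> A" for \<sigma>' \<nu>' using p1(2)[OF that] deg by simp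
  have maxw: "weight \<nu>' \<le> weight \<nu>" if "(\<sigma>', \<nu>') \<in> A" "mdeg \<nu>' = mdeg \<nu>" for \<sigma>' \<nu>'
    using p0(2)[of "(\<sigma>', \<nu>')"] that deg by (auto simp: A'_def \<sigma>\<nu>)
  have \<sigma>: "\<sigma> \<in> top" "Poly_Mapping.keys \<nu> \<subseteq> {1..cls \<sigma>}" using mem assms(2) by (auto simp: AdmT_def)
  note pr = pri_props[OF \<sigma>(1)]
  let ?w = "(fst (pri \<sigma>), \<nu> + snd (pri \<sigma>))"
  have others: "jet_coeff (gen \<sigma>' \<nu>') ?w = 0" if "(\<sigma>', \<nu>') \<in> A" "(\<sigma>', \<nu>') \<noteq> (\<sigma>, \<nu>)" for \<sigma>' \<nu>'
  proof (rule ccontr)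
    assume "jet_coeff (gen \<sigma>' \<nu>') ?w \<noteq> 0"
    then obtain u where u: "\<nu> + snd (pri \<sigma>) = \<nu>' + u" "jet_coeff (\<Phi> \<sigma>') (fst (pri \<sigma>), u) \<noteq> 0"
      unfolding gen_def by (rule jet_coeff_single_nonzero)
    have \<sigma>': "\<sigma>' \<in> T" using that(1) assms(2) top_sub by (auto simp: AdmT_def)
    have "mdeg u \<le> q" using Phi_order[OF \<sigma>' u(2)] by simp
    moreover have "mdeg \<nu> + q = mdeg \<nu>' + mdeg u"
      using arg_cong[OF u(1), of mdeg] pr(1) by (simp add: wsum_add)
    ultimately have d: "mdeg \<nu>' = mdeg \<nu>" using maxdeg[OF that(1)] by linarith
    have eq: "snd (pri \<sigma>) + \<nu> = u + \<nu>'" using u(1) by (simp add: add.commute)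
    have "Poly_Mapping.keys \<nu> \<subseteq> {..cls \<sigma>}" using \<sigma>(2) by auto
    note wm = weight_minimal[OF eq d this pr(7)]
    have "\<nu>' = \<nu>" using wm maxw[OF that(1) d] by linarith
    then have "u = snd (pri \<sigma>)" using eq by simp
    then have "\<sigma>' = \<sigma>" using pr(3)[OF \<sigma>'] u(2) by simp
    then show False using \<open>\<nu>' = \<nu>\<close> that by simp
  qed
  have R0: "jet_coeff R ?w = 0" using R pr(1) by (metis le_add2 not_le snd_conv wsum_add)
  have "jet_coeff (R + (\<Sum>p\<in>A. smul (const (c p)) (case_prod gen p))) ?w
    = (\<Sum>p\<in>A. c p * jet_coeff (case_prod gen p) ?w)"
    by (simp add: jet_coeff_add jet_coeff_sum jet_coeff_const R0)
  also have "\<dots> = c (\<sigma>, \<nu>) * jet_coeff (gen \<sigma> \<nu>) ?w + (\<Sum>p\<in>A - {(\<sigma>, \<nu>)}. c p * jet_coeff (case_prod gen p) ?w)"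
    using sum.remove[OF assms(1) mem, of "\<lambda>p. c p * jet_coeff (case_prod gen p) ?w"] by simp
  also have "(\<Sum>p\<in>A - {(\<sigma>, \<nu>)}. c p * jet_coeff (case_prod gen p) ?w) = 0"
    using others by (intro sum.neutral) auto
  also have "jet_coeff (gen \<sigma> \<nu>) ?w = 1"
    unfolding gen_def jet_coeff_single using pr(2) by simp
  finally have val: "jet_coeff (R + (\<Sum>p\<in>A. smul (const (c p)) (case_prod gen p))) ?w = c (\<sigma>, \<nu>) * 1 + 0" .
  have "jet_coeff (R + (\<Sum>p\<in>A. smul (const (c p)) (case_prod gen p))) ?w \<noteq> 0"
    unfolding val using c mem by simp
  then show ?thesis using that mem maxdeg maxw by blast
qed

text \<open>The bound \<open>i < j\<close> is what makes the rewriting of nonmultiplicative prolongations terminate.\<close>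

lemma prolongation_span:
  assumes \<tau>: "\<tau> \<in> T" and j: "j \<in> {1..n}" "j \<notin> mult \<tau>"
  shows "smul (der j) (\<Phi> \<tau>) \<in> dyv.span (\<Phi> ` T \<union> {smul (der i) (\<Phi> \<sigma>) | \<sigma> i. \<sigma> \<in> T \<and> 1 \<le> i \<and> i < j})"
proof -
  obtain a b where ab: "\<And>k. der j * \<Phi> \<tau> k = (\<Sum>\<sigma>\<in>T. const (a \<sigma>) * \<Phi> \<sigma> k)
      + (\<Sum>\<sigma>\<in>T. \<Sum>i\<in>mult \<sigma>. const (b \<sigma> i) * (der i * \<Phi> \<sigma> k))"
    using prol \<tau> j by blast
  define E where "E = {p \<in> Sigma T mult. b (fst p) (snd p) \<noteq> 0}"
  have finmult: "finite (mult \<sigma>)" for \<sigma> by (rule finite_subset[of _ "{1..n}"]) (auto simp: multiplicative_def)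
  have finE: "finite E" by (rule finite_subset[of _ "Sigma T mult"]) (use finT finmult in \<open>auto simp: E_def\<close>)
  have eq1: "smul (der j) (\<Phi> \<tau>) = (\<Sum>\<sigma>\<in>T. smul (const (a \<sigma>)) (\<Phi> \<sigma>))
      + (\<Sum>p\<in>E. smul (const (b (fst p) (snd p))) (smul (der (snd p)) (\<Phi> (fst p))))"
  proof
    fix k
    have "(\<Sum>\<sigma>\<in>T. \<Sum>i\<in>mult \<sigma>. const (b \<sigma> i) * (der i * \<Phi> \<sigma> k))
      = (\<Sum>p\<in>Sigma T mult. const (b (fst p) (snd p)) * (der (snd p) * \<Phi> (fst p) k))"
      using finT finmult by (subst sum.Sigma) (auto simp: case_prod_beta)
    also have "\<dots> = (\<Sum>p\<in>E. const (b (fst p) (snd p)) * (der (snd p) * \<Phi> (fst p) k))"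
      unfolding E_def using finT finmult by (intro sum.mono_neutral_right finite_SigmaI) auto
    finally show "smul (der j) (\<Phi> \<tau>) k = ((\<Sum>\<sigma>\<in>T. smul (const (a \<sigma>)) (\<Phi> \<sigma>))
      + (\<Sum>p\<in>E. smul (const (b (fst p) (snd p))) (smul (der (snd p)) (\<Phi> (fst p))))) k"
      using ab[of k] by (simp add: sum_fun_apply mult.assoc)
  qed
  have topE: "fst p \<in> top" "snd p \<in> {1..cls (fst p)}" if "p \<in> E" for p
    using that mult_not_top[of "fst p"] pri_props(10)[of "fst p"] by (cases "fst p \<in> top"; auto simp: E_def)+
  \<comment> \<open>The jet supplied by \<open>leading_jet\<close> for the right-hand side must
    occur in the left-hand side \<open>d_j \<Phi>\<close>. Comparing weights gives
    \<open>i \<le> j\<close> for the largest index \<open>i\<close> of a prolongation on the right.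
    Equality would identify the leading equation with \<tau> and make \<open>d_j\<close>
    multiplicative for it.\<close>
  have less: "snd p < j" if "p \<in> E" for p
  proof -
    define B where "B = {\<sigma> \<in> top. a \<sigma> \<noteq> 0}"
    define A1 where "A1 = (\<lambda>p. (fst p, Poly_Mapping.single (snd p) 1 :: multi_index)) ` E"
    define A2 where "A2 = (\<lambda>\<sigma>. (\<sigma>, 0 :: multi_index)) ` B"
    \<comment> \<open>Merges both coefficient families into one on pairs; \<open>Min\<close>
      recovers \<open>i\<close> from the keys of \<open>single i 1\<close>.\<close>
    define c where "c p = (if snd p = 0 then a (fst p) else b (fst p) (Min (Poly_Mapping.keys (snd p))))" for p :: "'i \<times> multi_index"
    define R where "R = (\<Sum>\<sigma>\<in>T - B. smul (const (a \<sigma>)) (\<Phi> \<sigma>))"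
    have BT: "B \<subseteq> T" using top_sub by (auto simp: B_def)
    have finB: "finite B" using finite_subset[OF BT finT] .
    have nz: "Poly_Mapping.single i (1::nat) \<noteq> (0 :: multi_index)" for i
      by (metis lookup_single_eq lookup_zero zero_neq_one)
    have inj1: "inj_on (\<lambda>p. (fst p, Poly_Mapping.single (snd p) 1 :: multi_index)) E"
    proof (rule inj_onI)
      fix p p' assume *: "(fst p, Poly_Mapping.single (snd p) 1 :: multi_index) = (fst p', Poly_Mapping.single (snd p') 1)"
      then have "Poly_Mapping.keys (Poly_Mapping.single (snd p) (1::nat)) = Poly_Mapping.keys (Poly_Mapping.single (snd p') (1::nat))" by simp
      then show "p = p'" using * by (simp add: prod_eq_iff)
    qed
    have eq2: "smul (der j) (\<Phi> \<tau>) = R + (\<Sum>p\<in>A1 \<union> A2. smul (const (c p)) (case_prod gen p))"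
    proof -
      have "(\<Sum>p\<in>A1 \<union> A2. smul (const (c p)) (case_prod gen p))
        = (\<Sum>p\<in>A1. smul (const (c p)) (case_prod gen p)) + (\<Sum>p\<in>A2. smul (const (c p)) (case_prod gen p))"
        using finE finB nz by (intro sum.union_disjoint) (auto simp: A1_def A2_def)
      also have "(\<Sum>p\<in>A1. smul (const (c p)) (case_prod gen p)) = (\<Sum>p\<in>E. smul (const (b (fst p) (snd p))) (smul (der (snd p)) (\<Phi> (fst p))))"
        unfolding A1_def by (subst sum.reindex[OF inj1]) (simp add: c_def nz o_def del: smul.scale_scale)
      also have "(\<Sum>p\<in>A2. smul (const (c p)) (case_prod gen p)) = (\<Sum>\<sigma>\<in>B. smul (const (a \<sigma>)) (\<Phi> \<sigma>))"
        unfolding A2_def by (subst sum.reindex) (auto simp: c_def inj_on_def)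
      finally show ?thesis
        unfolding eq1 R_def sum.subset_diff[OF BT finT, of "\<lambda>\<sigma>. smul (const (a \<sigma>)) (\<Phi> \<sigma>)"] by (simp only: add_ac)
    qed
    have R: "\<forall>v. jet_coeff R v \<noteq> 0 \<longrightarrow> mdeg (snd v) < q"
    proof (intro allI impI)
      fix v assume v: "jet_coeff R v \<noteq> 0"
      have "(\<Sum>\<sigma>\<in>T - B. a \<sigma> * jet_coeff (\<Phi> \<sigma>) v) \<noteq> 0"
        using v by (simp add: R_def jet_coeff_sum jet_coeff_const)
      then obtain \<sigma> where "\<sigma> \<in> T - B" "a \<sigma> * jet_coeff (\<Phi> \<sigma>) v \<noteq> 0" by (rule sum.not_neutral_contains_not_neutral)
      then show "mdeg (snd v) < q" using Phi_lower[of \<sigma> v] by (auto simp: B_def)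
    qed
    have sub: "A1 \<union> A2 \<subseteq> AdmT" using topE by (auto simp: A1_def A2_def AdmT_def B_def)
    have cne: "\<forall>p\<in>A1 \<union> A2. c p \<noteq> 0"
      using nz by (auto simp: A1_def A2_def c_def E_def B_def)
    have fin: "finite (A1 \<union> A2)" using finE finB by (simp add: A1_def A2_def)
    have ne: "A1 \<union> A2 \<noteq> {}" using that by (auto simp: A1_def)
    obtain \<sigma> \<nu> where \<sigma>\<nu>: "(\<sigma>, \<nu>) \<in> A1 \<union> A2"
      and coef: "jet_coeff (smul (der j) (\<Phi> \<tau>)) (fst (pri \<sigma>), \<nu> + snd (pri \<sigma>)) \<noteq> 0"
      and maxdeg: "\<And>\<sigma>' \<nu>'. (\<sigma>', \<nu>') \<in> A1 \<union> A2 \<Longrightarrow> mdeg \<nu>' \<le> mdeg \<nu>"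
      and maxw: "\<And>\<sigma>' \<nu>'. (\<sigma>', \<nu>') \<in> A1 \<union> A2 \<Longrightarrow> mdeg \<nu>' = mdeg \<nu> \<Longrightarrow> weight \<nu>' \<le> weight \<nu>"
      using leading_jet[OF fin sub ne cne R, folded eq2] by blast
    have pA: "(fst p, Poly_Mapping.single (snd p) 1) \<in> A1 \<union> A2" using that by (auto simp: A1_def)
    have "\<nu> \<noteq> 0" using maxdeg[OF pA] by auto
    then obtain i where i: "(\<sigma>, i) \<in> E" "\<nu> = Poly_Mapping.single i 1" using \<sigma>\<nu> by (auto simp: A1_def A2_def)
    have \<sigma>: "\<sigma> \<in> top" "i \<in> {1..cls \<sigma>}" using topE[OF i(1)] by auto
    note pr = pri_props[OF \<sigma>(1)]
    obtain u where u: "\<nu> + snd (pri \<sigma>) = Poly_Mapping.single j 1 + u" "jet_coeff (\<Phi> \<tau>) (fst (pri \<sigma>), u) \<noteq> 0"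
      using coef unfolding der_def by (rule jet_coeff_single_nonzero)
    have eq: "snd (pri \<sigma>) + \<nu> = u + Poly_Mapping.single j 1" using u(1) by (simp add: add.commute)
    have "mdeg (Poly_Mapping.single j 1) = mdeg \<nu>" using i by simp
    moreover have "Poly_Mapping.keys \<nu> \<subseteq> {..cls \<sigma>}" using i \<sigma> by simp
    ultimately have wm: "weight \<nu> \<le> weight (Poly_Mapping.single j 1)"
      "weight (Poly_Mapping.single j 1) = weight \<nu> \<Longrightarrow> Poly_Mapping.single j 1 = \<nu>"
      using weight_minimal[OF eq _ _ pr(7)] by blast+
    have "i \<noteq> j"
    proof
      assume "i = j"
      then have "u = snd (pri \<sigma>)" using eq i by simp
      then have "\<tau> = \<sigma>" using pr(3)[OF \<tau>] u(2) by simp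
      then show False using \<open>i = j\<close> \<sigma>(2) pr(10) j by simp
    qed
    then have "i < j" using wm(1) i by simp
    moreover have "snd p \<le> i" using maxw[OF pA] i by simp
    ultimately show ?thesis by simp
  qed
  have memE: "fst p \<in> T \<and> 1 \<le> snd p" if "p \<in> E" for p using topE[OF that] top_sub by auto
  show ?thesis
    unfolding eq1
  proof (intro dyv.span_add dyv.span_sum dyv.span_scale)
    fix \<sigma> assume "\<sigma> \<in> T"
    then show "\<Phi> \<sigma> \<in> dyv.span (\<Phi> ` T \<union> {smul (der i) (\<Phi> \<sigma>) | \<sigma> i. \<sigma> \<in> T \<and> 1 \<le> i \<and> i < j})"
      by (intro dyv.span_base) auto
  next
    fix p assume "p \<in> E"
    then show "smul (der (snd p)) (\<Phi> (fst p)) \<in> dyv.span (\<Phi> ` T \<union> {smul (der i) (\<Phi> \<sigma>) | \<sigma> i. \<sigma> \<in> T \<and> 1 \<le> i \<and> i < j})"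
      using less memE by (intro dyv.span_base) blast
  qed
qed

section \<open>Multiplicative prolongations span the submodule of the system\<close>

definition Adm :: "('i \<times> multi_index) set"
  where "Adm = AdmT \<union> (T - top) \<times> {0}"

text \<open>A span over the field \<open>k\<close> only. Its closure under \<open>D\<close> is the
  content of involution and is proved in \<open>W_smul\<close>.\<close>

definition W :: "(nat \<Rightarrow> 'k dop) set"
  where "W = dyv.span (case_prod gen ` Adm)"

lemma subspace_smul_vimage: "dyv.subspace {f. smul a f \<in> W}"
proof -
  have "smul a (smul (const c) f) = smul (const c) (smul a f)" for c f by (simp add: mult.commute)
  then show ?thesis unfolding dyv.subspace_def W_def
    by (auto simp: smul.scale_right_distrib dyv.span_zero intro: dyv.span_add simp del: smul.scale_scale intro!: dyv.span_scale)
qed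

text \<open>If \<nu> contains a nonmultiplicative \<open>d_j\<close>, then
  \<open>prolongation_span\<close> replaces it by nothing or by some \<open>d_i\<close> with
  \<open>i < j\<close>. Either way the weight drops, whatever equation appears, so the induction
  runs on the weight for all equations at once.\<close>

lemma gen_in_W:
  assumes "\<sigma> \<in> T" "Poly_Mapping.keys \<nu> \<subseteq> {1..n}"
  shows "gen \<sigma> \<nu> \<in> W"
  using assms
proof (induction "weight \<nu>" arbitrary: \<sigma> \<nu> rule: less_induct)
  case less
  show ?case
  proof (cases "(\<sigma>, \<nu>) \<in> Adm")
    case True
    then show ?thesis unfolding W_def by (intro dyv.span_base) force
  next
    case False
    have "\<exists>j\<in>Poly_Mapping.keys \<nu>. j \<notin> mult \<sigma>"
    proof (cases "\<sigma> \<in> top")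
      case True
      then show ?thesis using False pri_props(10)[OF True] by (auto simp: Adm_def AdmT_def)
    next
      case nt: False
      then have "\<nu> \<noteq> 0" using False less.prems by (auto simp: Adm_def)
      then show ?thesis using mult_not_top[OF nt] by (auto simp: poly_mapping_eq_iff fun_eq_iff in_keys_iff)
    qed
    then obtain j where j: "j \<in> Poly_Mapping.keys \<nu>" "j \<notin> mult \<sigma>" by blast
    then have jn: "j \<in> {1..n}" using less.prems by blast
    define \<nu>' where "\<nu>' = \<nu> - Poly_Mapping.single j 1"
    have \<nu>: "\<nu> = Poly_Mapping.single j 1 + \<nu>'" unfolding \<nu>'_def using single_add_minus[OF j(1)] by simp
    have k\<nu>': "Poly_Mapping.keys \<nu>' \<subseteq> {1..n}" using keys_minus_single less.prems(2) unfolding \<nu>'_def by blast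
    have w: "weight \<nu> = j + weight \<nu>'" unfolding \<nu> by (simp add: wsum_add)
    let ?S = "\<Phi> ` T \<union> {smul (der i) (\<Phi> \<sigma>) | \<sigma> i. \<sigma> \<in> T \<and> 1 \<le> i \<and> i < j}"
    have "?S \<subseteq> {f. smul (Poly_Mapping.single \<nu>' 1) f \<in> W}"
    proof
      fix f assume "f \<in> ?S"
      then consider \<sigma>' where "\<sigma>' \<in> T" "f = \<Phi> \<sigma>'"
        | \<sigma>' i where "\<sigma>' \<in> T" "1 \<le> i" "i < j" "f = smul (der i) (\<Phi> \<sigma>')" by blast
      then show "f \<in> {f. smul (Poly_Mapping.single \<nu>' 1) f \<in> W}"
      proof cases
        case 1
        have "gen \<sigma>' \<nu>' \<in> W" using less.hyps[of \<nu>' \<sigma>'] w jn 1(1) k\<nu>' by simp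
        then show ?thesis using 1 by (simp add: gen_def)
      next
        case 2
        have "weight (\<nu>' + Poly_Mapping.single i 1) < weight \<nu>" using w 2 by (simp add: wsum_add)
        moreover have "Poly_Mapping.keys (\<nu>' + Poly_Mapping.single i 1) \<subseteq> {1..n}"
          using k\<nu>' 2 jn by (auto simp: keys_add_multi_index)
        ultimately have "gen \<sigma>' (\<nu>' + Poly_Mapping.single i 1) \<in> W" using less.hyps 2 by blast
        then show ?thesis using 2 gen_add[of \<nu>' \<sigma>' "Poly_Mapping.single i 1"] by simp
      qed
    qed
    then have "dyv.span ?S \<subseteq> {f. smul (Poly_Mapping.single \<nu>' 1) f \<in> W}"
      by (rule dyv.span_minimal) (rule subspace_smul_vimage)
    then have "smul (Poly_Mapping.single \<nu>' 1) (smul (der j) (\<Phi> \<sigma>)) \<in> W"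
      using prolongation_span[OF less.prems(1) jn j(2)] by blast
    then show ?thesis using gen_add[of \<nu>' \<sigma> "Poly_Mapping.single j 1"] \<nu> by (simp add: add.commute)
  qed
qed

lemma Adm_props: "(\<sigma>, \<nu>) \<in> Adm \<Longrightarrow> \<sigma> \<in> T \<and> Poly_Mapping.keys \<nu> \<subseteq> {1..n}"
  using top_sub pri_props(8) by (fastforce simp: Adm_def AdmT_def)

lemma W_smul:
  assumes "a \<in> DR n" "f \<in> W"
  shows "smul a f \<in> W"
proof -
  have single: "smul (Poly_Mapping.single \<mu> 1) f \<in> W" if "Poly_Mapping.keys \<mu> \<subseteq> {1..n}" for \<mu>
  proof -
    have "case_prod gen ` Adm \<subseteq> {f. smul (Poly_Mapping.single \<mu> 1) f \<in> W}"
    proof clarify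
      fix \<sigma> \<nu> assume "(\<sigma>, \<nu>) \<in> Adm"
      then have "\<sigma> \<in> T" "Poly_Mapping.keys (\<mu> + \<nu>) \<subseteq> {1..n}"
        using Adm_props that by (auto simp: keys_add_multi_index)
      then show "smul (Poly_Mapping.single \<mu> 1) (gen \<sigma> \<nu>) \<in> W" unfolding gen_add by (rule gen_in_W)
    qed
    then have "W \<subseteq> {f. smul (Poly_Mapping.single \<mu> 1) f \<in> W}"
      unfolding W_def[of] by (rule dyv.span_minimal) (rule subspace_smul_vimage[unfolded W_def])
    then show ?thesis using assms(2) by blast
  qed
  have "smul a f = (\<Sum>\<mu>\<in>Poly_Mapping.keys a. smul (const (Poly_Mapping.lookup a \<mu>)) (smul (Poly_Mapping.single \<mu> 1) f))"
  proof -
    have "a = (\<Sum>\<mu>\<in>Poly_Mapping.keys a. const (Poly_Mapping.lookup a \<mu>) * Poly_Mapping.single \<mu> 1)"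
      by (subst (1) poly_mapping_eq_sum_single) (simp add: const_def mult_single)
    then have "smul a f = smul (\<Sum>\<mu>\<in>Poly_Mapping.keys a. const (Poly_Mapping.lookup a \<mu>) * Poly_Mapping.single \<mu> 1) f"
      by simp
    then show ?thesis by (simp add: smul.scale_sum_left)
  qed
  also have "\<dots> \<in> W"
    using single assms(1) unfolding W_def DR_iff by (intro dyv.span_sum dyv.span_scale) blast
  finally show ?thesis .
qed

definition N :: "(nat \<Rightarrow> 'k dop) set"
  where "N = submodule_generated (diff_ring n) (Dy n m) (\<Phi> ` T)"

lemma Phi_sub: "\<Phi> ` T \<subseteq> Dyc n m"
  using Phi_Dyc by blast

sublocale dop_quotient n m N
  by unfold_locales (use submodule_generated_Dy[OF Phi_sub] in \<open>auto simp: N_def\<close>)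

lemma Phi_N: "\<sigma> \<in> T \<Longrightarrow> \<Phi> \<sigma> \<in> N"
  using submodule_generated_Dy(3)[OF Phi_sub] by (auto simp: N_def)

lemma W_add: "f \<in> W \<Longrightarrow> g \<in> W \<Longrightarrow> f + g \<in> W"
  unfolding W_def by (rule dyv.span_add)

text \<open>\<open>W\<close> contains the equations and is stable under \<open>D\<close>, so it
  contains everything they generate.\<close>

lemma N_sub_W: "N \<subseteq> W"
proof -
  have "N \<subseteq> W \<inter> Dyc n m"
    unfolding N_def
  proof (rule submodule_generated_Dy(4)[OF Phi_sub])
    have "\<Phi> \<sigma> \<in> W" if "\<sigma> \<in> T" for \<sigma> using gen_in_W[OF that, of 0] by simp
    then show "\<Phi> ` T \<subseteq> W \<inter> Dyc n m" using Phi_Dyc by blast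
    show "dop_closed n (W \<inter> Dyc n m)"
      unfolding dop_closed_def
    proof (intro conjI ballI)
      show "0 \<in> W \<inter> Dyc n m" by (simp add: W_def dyv.span_zero Dyc_zero)
      show "f + g \<in> W \<inter> Dyc n m" if "f \<in> W \<inter> Dyc n m" "g \<in> W \<inter> Dyc n m" for f g
        using that Dyc_add W_add by blast
      show "smul a f \<in> W \<inter> Dyc n m" if "a \<in> DR n" "f \<in> W \<inter> Dyc n m" for a f
        using that W_smul[of a f] Dyc_smul[of a n f m] by simp
    qed
  qed simp
  then show ?thesis by blast
qed

text \<open>Suppose that a prolongation of a top equation occurs in the expansion of
  \<open>smul P (jetel k \<mu>)\<close> in \<open>W\<close>. The jet from \<open>leading_jet\<close>
  then splits both as principal jet plus \<nu>0 and as \<mu> plus a \<nu> from \<open>P\<close>.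
  Both splittings satisfy the hypotheses of \<open>weight_minimal\<close>, so they coincide and the
  jet would be principal. Hence no such prolongation occurs and only jets of order below
  \<open>q\<close> remain, whereas those of \<open>smul P (jetel k \<mu>)\<close> have order at
  least \<open>q\<close>.\<close>

lemma parametric_jet_free:
  assumes P: "P \<in> DR i" and v: "mdeg \<mu> = q" "has_class (k, \<mu>) i" "Poly_Mapping.keys \<mu> \<subseteq> {1..n}"
    and np: "(k, \<mu>) \<notin> pri ` top"
    and N: "smul P (jetel k \<mu>) \<in> N"
  shows "P = 0"
proof -
  let ?f = "smul P (jetel k \<mu>)"
  have coef: "jet_coeff ?f (k', w) \<noteq> 0 \<Longrightarrow> k' = k \<and> (\<exists>\<nu>\<in>Poly_Mapping.keys P. w = \<mu> + \<nu>)" for k' w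
  proof -
    assume *: "jet_coeff ?f (k', w) \<noteq> 0"
    then have "k' = k" by (auto simp: jet_coeff_def jetel_def split: if_splits)
    moreover from * this have "Poly_Mapping.lookup (Poly_Mapping.single \<mu> 1 * P) w \<noteq> 0"
      by (simp add: jet_coeff_def jetel_def mult.commute)
    ultimately show "k' = k \<and> (\<exists>\<nu>\<in>Poly_Mapping.keys P. w = \<mu> + \<nu>)"
      by (elim lookup_single_mult_nonzero) (auto simp: in_keys_iff)
  qed
  have kP: "Poly_Mapping.keys \<nu> \<subseteq> {..i}" if "\<nu> \<in> Poly_Mapping.keys P" for \<nu>
  proof -
    have "Poly_Mapping.keys \<nu> \<subseteq> {1..i}" using P that by (simp add: DR_iff)
    then show ?thesis by auto
  qed
  have k\<mu>: "Poly_Mapping.keys \<mu> \<subseteq> {i..}"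
  proof
    fix l assume l: "l \<in> Poly_Mapping.keys \<mu>"
    then have "1 \<le> l" using v(3) by auto
    then show "l \<in> {i..}" using l v(2) unfolding has_class_def in_keys_iff by (metis atLeast_iff not_le snd_conv)
  qed
  have "?f \<in> dyv.span (case_prod gen ` Adm)" using N N_sub_W by (auto simp: W_def)
  then obtain t r where t: "finite t" "t \<subseteq> case_prod gen ` Adm" "?f = (\<Sum>g\<in>t. smul (const (r g)) g)"
    unfolding dyv.span_explicit by blast
  \<comment> \<open>The span refers to a set of elements, and different index pairs may give the
    same one; \<open>U\<close> keeps one pair for each.\<close>
  obtain U where U: "U \<subseteq> Adm" "inj_on (case_prod gen) U" "t = case_prod gen ` U"
    using t(2) unfolding subset_image_inj by blast
  have finU: "finite U" using finite_imageD[OF t(1)[unfolded U(3)] U(2)] .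
  define c where "c p = r (case_prod gen p)" for p
  have f: "?f = (\<Sum>p\<in>U. smul (const (c p)) (case_prod gen p))"
    unfolding t(3) U(3) by (subst sum.reindex[OF U(2)]) (simp add: c_def)
  define A where "A = {p \<in> U. p \<in> AdmT \<and> c p \<noteq> 0}"
  define R where "R = (\<Sum>p\<in>U - A. smul (const (c p)) (case_prod gen p))"
  have AU: "A \<subseteq> U" by (auto simp: A_def)
  have f2: "?f = R + (\<Sum>p\<in>A. smul (const (c p)) (case_prod gen p))"
    unfolding f R_def by (rule sum.subset_diff[OF AU finU])
  have R: "\<forall>v. jet_coeff R v \<noteq> 0 \<longrightarrow> mdeg (snd v) < q"
  proof (intro allI impI)
    fix v assume v: "jet_coeff R v \<noteq> 0"
    have "(\<Sum>p\<in>U - A. c p * jet_coeff (case_prod gen p) v) \<noteq> 0"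
      using v by (simp add: R_def jet_coeff_sum jet_coeff_const)
    then obtain p where p: "p \<in> U - A" "c p * jet_coeff (case_prod gen p) v \<noteq> 0"
      by (rule sum.not_neutral_contains_not_neutral)
    then have "p \<in> (T - top) \<times> {0}" using U(1) by (auto simp: A_def Adm_def)
    then obtain \<sigma> where "p = (\<sigma>, 0)" "\<sigma> \<in> T" "\<sigma> \<notin> top" by auto
    then show "mdeg (snd v) < q" using Phi_lower[of \<sigma> v] p(2) by simp
  qed
  have "A = {}"
  proof (rule ccontr)
    assume "A \<noteq> {}"
    have "finite A" using finite_subset[OF AU finU] .
    have "A \<subseteq> AdmT" "\<forall>p\<in>A. c p \<noteq> 0" by (auto simp: A_def)
    obtain \<sigma> \<nu>0 where *: "(\<sigma>, \<nu>0) \<in> A" "jet_coeff ?f (fst (pri \<sigma>), \<nu>0 + snd (pri \<sigma>)) \<noteq> 0"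
      by (rule leading_jet[OF \<open>finite A\<close> \<open>A \<subseteq> AdmT\<close> \<open>A \<noteq> {}\<close> \<open>\<forall>p\<in>A. c p \<noteq> 0\<close> R, folded f2])
    have \<sigma>: "\<sigma> \<in> top" "Poly_Mapping.keys \<nu>0 \<subseteq> {..cls \<sigma>}" using *(1) by (auto simp: A_def AdmT_def)
    note pr = pri_props[OF \<sigma>(1)]
    obtain \<nu> where \<nu>: "fst (pri \<sigma>) = k" "\<nu> \<in> Poly_Mapping.keys P" "snd (pri \<sigma>) + \<nu>0 = \<mu> + \<nu>"
      using coef[OF *(2)] by (auto simp: add.commute)
    have d: "mdeg \<nu> = mdeg \<nu>0" using arg_cong[OF \<nu>(3), of mdeg] pr(1) v(1) by (simp add: wsum_add)
    have "weight \<nu>0 \<le> weight \<nu>" using weight_minimal(1)[OF \<nu>(3) d \<sigma>(2) pr(7)] .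
    moreover have "weight \<nu> \<le> weight \<nu>0" using weight_minimal(1)[OF \<nu>(3)[symmetric] d[symmetric] kP[OF \<nu>(2)] k\<mu>] .
    ultimately have "\<nu> = \<nu>0" using weight_minimal(2)[OF \<nu>(3) d \<sigma>(2) pr(7)] by simp
    then have "pri \<sigma> = (k, \<mu>)" using \<nu> by (simp add: prod_eq_iff)
    then show False using np \<sigma>(1) by force
  qed
  then have "?f = R" using f2 by simp
  show "P = 0"
  proof (rule ccontr)
    assume "P \<noteq> 0"
    then obtain \<nu> where \<nu>: "\<nu> \<in> Poly_Mapping.keys P" by fastforce
    have "jet_coeff ?f (k, \<mu> + \<nu>) = Poly_Mapping.lookup P \<nu>"
      using lookup_single_mult_add[of \<mu> 1 P \<nu>] by (simp add: jet_coeff_def jetel_def mult.commute)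
    then have "mdeg (\<mu> + \<nu>) < q" using R \<open>?f = R\<close> \<nu> by (metis in_keys_iff snd_conv)
    then show False using v(1) by (simp add: wsum_add)
  qed
qed

section \<open>Finite generation over \<open>k[d_1,...,d_j]\<close> and the choice of
  \<open>j\<close>\<close>

definition Jets :: "(nat \<times> multi_index) set"
  where "Jets = {(k, \<mu>). k \<in> {1..m} \<and> Poly_Mapping.keys \<mu> \<subseteq> {1..n} \<and> mdeg \<mu> \<le> q}"

lemma finite_Jets: "finite Jets"
proof -
  let ?S = "{\<mu> :: multi_index. Poly_Mapping.keys \<mu> \<subseteq> {1..n} \<and> (\<forall>i. Poly_Mapping.lookup \<mu> i \<le> q)}"
  have "Poly_Mapping.lookup \<mu> i \<le> mdeg \<mu>" for \<mu> :: multi_index and i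
  proof (cases "i \<in> Poly_Mapping.keys \<mu>")
    case True
    then show ?thesis unfolding wsum_def by (simp add: member_le_sum)
  qed (simp add: in_keys_iff)
  then have "Jets \<subseteq> {1..m} \<times> ?S" unfolding Jets_def by (auto intro: order_trans)
  then show ?thesis using finite_card_bounded_multi_indices(1)[of n q] by (auto intro: finite_subset)
qed

definition generated :: "nat \<Rightarrow> (nat \<Rightarrow> 'k dop) set"
  where "generated j = {f. \<exists>c. (\<forall>b\<in>Jets. c b \<in> DR j) \<and> f - (\<Sum>b\<in>Jets. smul (c b) (jetel (fst b) (snd b))) \<in> N}"

lemma generated_N: "f \<in> N \<Longrightarrow> f \<in> generated j"
  unfolding generated_def by (intro CollectI exI[of _ "\<lambda>_. 0"]) auto

lemma generated_add:
  assumes "f \<in> generated j" "g \<in> generated j"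
  shows "f + g \<in> generated j"
proof -
  let ?s = "\<lambda>c. \<Sum>b\<in>Jets. smul (c b) (jetel (fst b) (snd b))"
  obtain c d where cd: "\<forall>b\<in>Jets. c b \<in> DR j" "f - ?s c \<in> N" "\<forall>b\<in>Jets. d b \<in> DR j" "g - ?s d \<in> N"
    using assms unfolding generated_def by blast
  have "f + g - ?s (\<lambda>b. c b + d b) = (f - ?s c) + (g - ?s d)"
    by (simp add: smul.scale_left_distrib sum.distrib)
  also have "\<dots> \<in> N" using dop_closed_add[OF N_closed cd(2,4)] .
  finally show ?thesis unfolding generated_def
    by (intro CollectI exI[of _ "\<lambda>b. c b + d b"]) (use cd in auto)
qed

lemma generated_smul:
  assumes "f \<in> generated j" "a \<in> DR j" "j \<le> n"
  shows "smul a f \<in> generated j"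
proof -
  let ?s = "\<lambda>c. \<Sum>b\<in>Jets. smul (c b) (jetel (fst b) (snd b))"
  obtain c where c: "\<forall>b\<in>Jets. c b \<in> DR j" "f - ?s c \<in> N"
    using assms unfolding generated_def by blast
  have "smul a f - ?s (\<lambda>b. a * c b) = smul a (f - ?s c)"
    by (simp add: smul.scale_right_diff_distrib smul.scale_sum_right)
  also have "\<dots> \<in> N" using dop_closed_smul[OF N_closed _ c(2)] assms DR_mono by blast
  finally show ?thesis unfolding generated_def
    by (intro CollectI exI[of _ "\<lambda>b. a * c b"]) (use c assms in auto)
qed

lemma generated_sum: "(\<And>x. x \<in> A \<Longrightarrow> f x \<in> generated j) \<Longrightarrow> sum f A \<in> generated j"
  by (induction A rule: infinite_finite_induct)
    (auto simp: generated_N dop_closed_zero[OF N_closed] generated_add)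

lemma generated_const: "f \<in> generated j \<Longrightarrow> j \<le> n \<Longrightarrow> smul (const c) f \<in> generated j"
  by (rule generated_smul) auto

lemma generated_Jets:
  assumes "k \<in> {1..m}" "Poly_Mapping.keys \<mu> \<subseteq> {1..n}" "mdeg \<mu> \<le> q"
  shows "jetel k \<mu> \<in> generated j"
proof -
  have "(\<Sum>b\<in>Jets. smul (if b = (k, \<mu>) then 1 else 0 :: 'k dop) (jetel (fst b) (snd b))) = (\<Sum>b\<in>Jets. if b = (k, \<mu>) then jetel k \<mu> else 0)"
    by (rule sum.cong) auto
  also have "\<dots> = jetel k \<mu>" using finite_Jets assms by (simp add: Jets_def)
  finally have "jetel k \<mu> - (\<Sum>b\<in>Jets. smul (if b = (k, \<mu>) then 1 else 0) (jetel (fst b) (snd b))) \<in> N"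
    using dop_closed_zero[OF N_closed] by simp
  moreover have "\<forall>b\<in>Jets. (if b = (k, \<mu>) then 1 else 0 :: 'k dop) \<in> DR j" by simp
  ultimately show ?thesis
    unfolding generated_def by (intro CollectI exI[of _ "\<lambda>b. if b = (k, \<mu>) then 1 else 0"] conjI)
qed

text \<open>A jet of order \<open>q + 1\<close> is written as \<open>d_c\<close> of a jet
  \<open>w'\<close> of order \<open>q\<close>, with \<open>c\<close> its smallest index. For
  \<open>c \<le> j\<close> this is already a combination of the required kind. For
  \<open>c > j\<close> the jet \<open>w'\<close> has class above \<open>j\<close>, hence is
  principal, and its equation replaces it by other jets, each of which is then treated under
  \<open>d_c\<close>. For \<open>q = 0\<close> the assumption \<open>j = n\<close> leaves only the
  first case.\<close>

lemma generated_der_jetel: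
  assumes jn: "j \<le> n" and qj: "1 \<le> q \<or> j = n"
    and pr: "\<And>k \<mu> i. k \<in> {1..m} \<Longrightarrow> Poly_Mapping.keys \<mu> \<subseteq> {1..n} \<Longrightarrow> mdeg \<mu> = q \<Longrightarrow> has_class (k, \<mu>) i
      \<Longrightarrow> j < i \<Longrightarrow> (k, \<mu>) \<in> pri ` top"
    and k: "k \<in> {1..m}" "Poly_Mapping.keys \<mu> \<subseteq> {1..n}" "mdeg \<mu> \<le> q" and l: "l \<in> {1..n}"
  shows "smul (der l) (jetel k \<mu>) \<in> generated j"
proof (cases "mdeg \<mu> = q")
  case False
  then show ?thesis unfolding der_jetel using k l
    by (intro generated_Jets) (auto simp: keys_add_multi_index wsum_add)
next
  case q: True
  define w where "w = Poly_Mapping.single l 1 + \<mu>"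
  define c where "c = Min (Poly_Mapping.keys w)"
  define w' where "w' = w - Poly_Mapping.single c 1"
  have kw: "Poly_Mapping.keys w \<subseteq> {1..n}" using k l by (auto simp: w_def keys_add_multi_index)
  have "w \<noteq> 0" using mdeg_eq_0_iff[of w] by (auto simp: w_def wsum_add)
  then have c: "c \<in> Poly_Mapping.keys w" unfolding c_def using has_class_Min(2)[OF kw] by blast
  have w: "w = Poly_Mapping.single c 1 + w'" unfolding w'_def using single_add_minus[OF c] by simp
  have kw': "Poly_Mapping.keys w' \<subseteq> Poly_Mapping.keys w" unfolding w'_def by (rule keys_minus_single)
  have "mdeg w = Suc q" using q by (simp add: w_def wsum_add)
  then have qw': "mdeg w' = q" unfolding w by (simp add: wsum_add)
  have eq: "smul (der l) (jetel k \<mu>) = smul (der c) (jetel k w')"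
    unfolding der_jetel w_def[symmetric] w[symmetric] ..
  have cn: "c \<in> {1..n}" using c kw by blast
  show ?thesis
  proof (cases "c \<le> j")
    case True
    then show ?thesis unfolding eq
      using generated_smul[OF generated_Jets[OF k(1)] _ jn] kw kw' qw' cn by auto
  next
    case False
    then have "1 \<le> q" using qj cn by auto
    have nz: "\<mu>' \<noteq> 0" if "mdeg \<mu>' = q" for \<mu>' using that \<open>1 \<le> q\<close> by (auto simp: mdeg_eq_0_iff[symmetric])
    have cl: "has_class (k', \<mu>') (Min (Poly_Mapping.keys \<mu>'))" "Min (Poly_Mapping.keys \<mu>') \<in> Poly_Mapping.keys \<mu>'"
      if "Poly_Mapping.keys \<mu>' \<subseteq> {1..n}" "mdeg \<mu>' = q" for k' \<mu>'
      using has_class_Min[OF that(1) nz[OF that(2)]] by auto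
    have "c \<le> Min (Poly_Mapping.keys w')"
      using cl(2)[of w'] kw kw' qw' unfolding c_def by (intro Min_le) auto
    then have "(k, w') \<in> pri ` top"
      using pr[OF k(1) _ qw' cl(1)] kw kw' qw' False by force
    then obtain \<sigma> where \<sigma>: "\<sigma> \<in> top" "pri \<sigma> = (k, w')" by auto
    have \<sigma>T: "\<sigma> \<in> T" using \<sigma> top_sub by blast
    note p\<sigma> = pri_props[OF \<sigma>(1)]
    let ?V = "SIGMA k:{1..m}. Poly_Mapping.keys (\<Phi> \<sigma> k)"
    let ?g = "\<lambda>v. smul (const (jet_coeff (\<Phi> \<sigma>) v)) (jetel (fst v) (snd v))"
    have finV: "finite ?V" by (intro finite_SigmaI) auto
    have mem: "(k, w') \<in> ?V" using p\<sigma>(2,5) \<sigma>(2) by (auto simp: jet_coeff_def in_keys_iff)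
    have "\<Phi> \<sigma> = sum ?g ?V" by (rule Dyc_expansion[OF Phi_Dyc[OF \<sigma>T]])
    also have "\<dots> = ?g (k, w') + sum ?g (?V - {(k, w')})" by (rule sum.remove[OF finV mem])
    also have "?g (k, w') = jetel k w'" using p\<sigma>(2) \<sigma>(2) by simp
    finally have a: "jetel k w' + sum ?g (?V - {(k, w')}) = \<Phi> \<sigma>" ..
    have neg: "(\<Sum>v\<in>?V - {(k, w')}. smul (const (- jet_coeff (\<Phi> \<sigma>) v)) (jetel (fst v) (snd v))) = - sum ?g (?V - {(k, w')})"
      by (simp add: const_uminus sum_negf)
    have "jetel k w' = \<Phi> \<sigma> + (\<Sum>v\<in>?V - {(k, w')}. smul (const (- jet_coeff (\<Phi> \<sigma>) v)) (jetel (fst v) (snd v)))"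
      unfolding neg diff_conv_add_uminus[symmetric] eq_diff_eq by (rule a)
    then have "smul (der c) (jetel k w') = smul (der c) (\<Phi> \<sigma> + (\<Sum>v\<in>?V - {(k, w')}. smul (const (- jet_coeff (\<Phi> \<sigma>) v)) (jetel (fst v) (snd v))))"
      by simp
    also have "\<dots> = smul (der c) (\<Phi> \<sigma>) +
        (\<Sum>v\<in>?V - {(k, w')}. smul (const (- jet_coeff (\<Phi> \<sigma>) v)) (smul (der c) (jetel (fst v) (snd v))))"
      by (simp add: smul.scale_right_distrib smul.scale_sum_right mult.commute const_uminus)
    also have "\<dots> \<in> generated j"
    proof (intro generated_add generated_sum generated_const jn)
      show "smul (der c) (\<Phi> \<sigma>) \<in> generated j"
        using dop_closed_smul[OF N_closed DR_der[OF cn] Phi_N[OF \<sigma>T]] by (rule generated_N)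
      fix v assume v: "v \<in> ?V - {(k, w')}"
      then have nzv: "jet_coeff (\<Phi> \<sigma>) v \<noteq> 0" by (auto simp: jet_coeff_def in_keys_iff)
      note supp = Phi_supp[OF \<sigma>T nzv]
      show "smul (der c) (jetel (fst v) (snd v)) \<in> generated j"
      proof (cases "mdeg (snd v) = q")
        case False
        then have "mdeg (snd v) < q" using Phi_order[OF \<sigma>T nzv] by simp
        then show ?thesis unfolding der_jetel using supp cn
          by (intro generated_Jets) (auto simp: keys_add_multi_index wsum_add)
      next
        case True
        define i where "i = Min (Poly_Mapping.keys (snd v))"
        note i = cl[OF supp(2) True, folded i_def]
        have "v \<notin> pri ` top"
        proof
          assume "v \<in> pri ` top"
          then obtain \<sigma>' where "\<sigma>' \<in> top" "v = pri \<sigma>'" by blast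
          then show False using pri_props(3)[OF _ \<sigma>T] nzv v \<sigma>(2) by auto
        qed
        then have "i \<le> j" using pr[OF supp True i(1)] by (cases "i \<le> j") auto
        \<comment> \<open>The remaining jet is parametric of class \<open>i \<le> j\<close>. Moving
          \<open>d_i\<close> out and \<open>d_c\<close> in leaves a jet of order \<open>q\<close>
          under a derivation from \<open>k[d_1,...,d_j]\<close>.\<close>
        have "Poly_Mapping.single c 1 + snd v = Poly_Mapping.single i 1 + (Poly_Mapping.single c 1 + (snd v - Poly_Mapping.single i 1))"
          using single_add_minus[OF i(2)] by (metis add.left_commute)
        then have "smul (der c) (jetel (fst v) (snd v) :: nat \<Rightarrow> 'k dop) = smul (der i) (jetel (fst v) (Poly_Mapping.single c 1 + (snd v - Poly_Mapping.single i 1)))"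
          unfolding der_jetel by simp
        moreover have "jetel (fst v) (Poly_Mapping.single c 1 + (snd v - Poly_Mapping.single i 1)) \<in> generated j"
        proof (rule generated_Jets)
          show "fst v \<in> {1..m}" by (rule supp(1))
          show "Poly_Mapping.keys (Poly_Mapping.single c 1 + (snd v - Poly_Mapping.single i 1)) \<subseteq> {1..n}"
            using supp(2) cn keys_minus_single[of "snd v" i] unfolding keys_add_multi_index by auto
          have "mdeg (snd v) = 1 + mdeg (snd v - Poly_Mapping.single i 1)"
            using arg_cong[OF single_add_minus[OF i(2)], of mdeg] by (simp add: wsum_add)
          then show "mdeg (Poly_Mapping.single c 1 + (snd v - Poly_Mapping.single i 1)) \<le> q"
            using True by (simp add: wsum_add)
        qed
        moreover have "der i \<in> DR j" using \<open>i \<le> j\<close> i(2) supp(2) by (intro DR_der) auto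
        ultimately show ?thesis using generated_smul[OF _ _ jn] by simp
      qed
    qed
    finally show ?thesis unfolding eq .
  qed
qed

lemma generated_all:
  assumes jn: "j \<le> n" and qj: "1 \<le> q \<or> j = n"
    and pr: "\<And>k \<mu> i. k \<in> {1..m} \<Longrightarrow> Poly_Mapping.keys \<mu> \<subseteq> {1..n} \<Longrightarrow> mdeg \<mu> = q \<Longrightarrow> has_class (k, \<mu>) i
      \<Longrightarrow> j < i \<Longrightarrow> (k, \<mu>) \<in> pri ` top"
    and f: "f \<in> Dyc n m"
  shows "f \<in> generated j"
proof -
  have step: "smul (der l) f \<in> generated j" if g: "f \<in> generated j" and l: "l \<in> {1..n}" for f l
  proof -
    let ?s = "\<lambda>c. \<Sum>b\<in>Jets. smul (c b) (jetel (fst b) (snd b))"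
    obtain c where c: "\<forall>b\<in>Jets. c b \<in> DR j" "f - ?s c \<in> N"
      using g unfolding generated_def by blast
    have "smul (der l) f = smul (der l) (f - ?s c) + (\<Sum>b\<in>Jets. smul (c b) (smul (der l) (jetel (fst b) (snd b))))"
      by (simp add: smul.scale_right_diff_distrib smul.scale_sum_right mult.commute)
    also have "\<dots> \<in> generated j"
    proof (intro generated_add generated_sum)
      show "smul (der l) (f - ?s c) \<in> generated j"
        using dop_closed_smul[OF N_closed DR_der[OF l] c(2)] by (rule generated_N)
      fix b assume b: "b \<in> Jets"
      then have "smul (der l) (jetel (fst b) (snd b)) \<in> generated j"
        using l by (intro generated_der_jetel[OF jn qj pr]) (auto simp: Jets_def)
      then show "smul (c b) (smul (der l) (jetel (fst b) (snd b))) \<in> generated j"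
        using generated_smul[OF _ _ jn] c(1) b by blast
    qed
    finally show ?thesis .
  qed
  have jet: "jetel k \<mu> \<in> generated j" if "k \<in> {1..m}" "Poly_Mapping.keys \<mu> \<subseteq> {1..n}" for k \<mu>
    using that(2)
  proof (induction "mdeg \<mu>" arbitrary: \<mu>)
    case 0
    then show ?case using that(1) by (intro generated_Jets) auto
  next
    case (Suc d)
    then have "\<mu> \<noteq> 0" by auto
    then have l: "Min (Poly_Mapping.keys \<mu>) \<in> Poly_Mapping.keys \<mu>" using has_class_Min(2)[OF Suc.prems] by blast
    let ?l = "Min (Poly_Mapping.keys \<mu>)"
    have e: "Poly_Mapping.single ?l 1 + (\<mu> - Poly_Mapping.single ?l 1) = \<mu>" by (rule single_add_minus[OF l])
    have "jetel k (\<mu> - Poly_Mapping.single ?l 1) \<in> generated j"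
    proof (rule Suc.hyps(1))
      show "d = mdeg (\<mu> - Poly_Mapping.single ?l 1)"
        using arg_cong[OF e, of mdeg] Suc.hyps(2) by (simp add: wsum_add)
      show "Poly_Mapping.keys (\<mu> - Poly_Mapping.single ?l 1) \<subseteq> {1..n}"
        using keys_minus_single Suc.prems by blast
    qed
    then have "smul (der ?l) (jetel k (\<mu> - Poly_Mapping.single ?l 1)) \<in> generated j"
      using step l Suc.prems by blast
    then show ?case unfolding der_jetel e .
  qed
  have "f = (\<Sum>v\<in>(SIGMA k:{1..m}. Poly_Mapping.keys (f k)). smul (const (jet_coeff f v)) (jetel (fst v) (snd v)))"
    by (rule Dyc_expansion[OF f])
  also have "\<dots> \<in> generated j"
    using f jet jn by (intro generated_sum generated_const) (auto simp: Dyc_iff DR_iff)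
  finally show ?thesis .
qed

text \<open>The index found here is the largest class of a parametric jet of order \<open>q\<close>; for \<open>q = 0\<close>, where these
  jets have no class, it is \<open>n\<close>.\<close>

theorem noether_normalization:
  assumes "\<not> Dyc n m \<subseteq> N"
  obtains j where "j \<le> n" "integral_mod n j annQ" "annQ \<inter> DR j = {0}"
proof -
  define S where "S = {i. \<exists>k \<mu>. k \<in> {1..m} \<and> Poly_Mapping.keys \<mu> \<subseteq> {1..n} \<and> mdeg \<mu> = q \<and>
    has_class (k, \<mu>) i \<and> (k, \<mu>) \<notin> pri ` top}"
  have S: "S \<subseteq> {1..n}"
  proof
    fix i assume "i \<in> S"
    then obtain k \<mu> where "Poly_Mapping.keys \<mu> \<subseteq> {1..n}" "has_class (k, \<mu>) i" by (auto simp: S_def)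
    moreover from this have "i \<in> Poly_Mapping.keys \<mu>" by (simp add: has_class_def in_keys_iff)
    ultimately show "i \<in> {1..n}" by blast
  qed
  then have finS: "finite S" using finite_subset by blast
  \<comment> \<open>If \<open>1 \<le> q\<close> and \<open>S\<close> is empty, all jets of order
    \<open>q\<close> are principal and the module is finite-dimensional over \<open>k\<close>, so
    \<open>j\<close> is 0.\<close>
  define j where "j = (if q = 0 then n else if S = {} then 0 else Max S)"
  have jn: "j \<le> n" using S finS Max_in[OF finS] by (auto simp: j_def)
  have gen: "f \<in> generated j" if "f \<in> Dyc n m" for f
  proof (rule generated_all[OF jn _ _ that])
    show "1 \<le> q \<or> j = n" by (auto simp: j_def)
    fix k \<mu> i assume *: "k \<in> {1..m}" "Poly_Mapping.keys \<mu> \<subseteq> {1..n}" "mdeg \<mu> = q" "has_class (k, \<mu>) i" "j < i"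
    show "(k, \<mu>) \<in> pri ` top"
    proof (rule ccontr)
      assume "(k, \<mu>) \<notin> pri ` top"
      then have "i \<in> S" using * by (auto simp: S_def)
      then show False using * S finS Max_ge[OF finS] by (auto simp: j_def split: if_splits)
    qed
  qed
  have int: "integral_mod n j annQ"
  proof (rule integral_mod_annQ[OF jn finite_Jets, of "\<lambda>b. jetel (fst b) (snd b)"])
    show "jetel (fst b) (snd b) \<in> Dyc n m" if "b \<in> Jets" for b
      using that by (intro jetel_Dyc) (auto simp: Jets_def)
    show "\<exists>c. (\<forall>b\<in>Jets. c b \<in> DR j) \<and> f - (\<Sum>b\<in>Jets. smul (c b) (jetel (fst b) (snd b))) \<in> N" if "f \<in> Dyc n m" for f
      using gen[OF that] by (simp add: generated_def)
  qed
  have zero: "P = 0" if P: "P \<in> annQ" "P \<in> DR j" for P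
  proof (cases "q = 0")
    case True
    \<comment> \<open>With no top equations, an equation would have only jets of negative order. So
      the system is trivial, the module is free, and \<open>y^1\<close> has annihilator 0.\<close>
    have "\<Phi> \<sigma> = 0" if "\<sigma> \<in> T" for \<sigma>
    proof -
      have "jet_coeff (\<Phi> \<sigma>) v = 0" for v
        using Phi_lower[OF that, of v] pri_props(9)[of \<sigma>] True by auto
      then have "\<Phi> \<sigma> k = 0" for k
        by (intro poly_mapping_eqI) (metis fst_conv jet_coeff_def lookup_zero snd_conv)
      then show ?thesis by auto
    qed
    then have "\<Phi> ` T \<subseteq> {0}" by auto
    then have "N \<subseteq> {0}" unfolding N_def
      by (rule submodule_generated_Dy(4)[OF Phi_sub]) (auto simp: Dyc_zero dop_closed_def)
    have "m \<noteq> 0"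
    proof
      assume "m = 0"
      then have "Dyc n m \<subseteq> {0 :: nat \<Rightarrow> 'k dop}" by (auto simp: Dyc_iff)
      then show False using assms dop_closed_zero[OF N_closed] by blast
    qed
    then have "smul P (jetel 1 0) \<in> N" using P(1) jetel_Dyc[of 1 m 0 n] by (auto simp: annQ_def)
    then have "smul P (jetel 1 0) = 0" using \<open>N \<subseteq> {0}\<close> by blast
    then have "smul P (jetel 1 0) 1 = 0" by (simp only: zero_fun_apply)
    then show ?thesis by (simp add: jetel_def)
  next
    case q: False
    show ?thesis
    proof (cases "S = {}")
      case True
      \<comment> \<open>Here \<open>P\<close> is a constant; if nonzero it is invertible, and the
        module it annihilates would be zero.\<close>
      then have "P \<in> DR 0" using P(2) q by (simp add: j_def)
      then have "Poly_Mapping.keys P \<subseteq> {0}" by (auto simp: DR_iff)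
      then have Pc: "P = const (Poly_Mapping.lookup P 0)"
        by (intro poly_mapping_eqI) (auto simp: const_def lookup_single when_def in_keys_iff)
      show ?thesis
      proof (rule ccontr)
        assume "P \<noteq> 0"
        then have "Poly_Mapping.lookup P 0 \<noteq> 0" using Pc by (metis const_zero)
        then have inv: "const (1 / Poly_Mapping.lookup P 0) * P = 1"
          by (subst Pc) (simp add: const_mult_const[symmetric])
        have "f \<in> N" if "f \<in> Dyc n m" for f
        proof -
          have "smul (const (1 / Poly_Mapping.lookup P 0)) (smul P f) \<in> N"
            by (rule dop_closed_smul[OF N_closed]) (use P(1) that in \<open>auto simp: annQ_def\<close>)
          then show ?thesis using inv by simp
        qed
        then show False using assms by blast
      qed
    next
      case False
      then have "j \<in> S" using q Max_in[OF finS] by (simp add: j_def)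
      then obtain k \<mu> where "k \<in> {1..m}" "Poly_Mapping.keys \<mu> \<subseteq> {1..n}" "mdeg \<mu> = q"
        "has_class (k, \<mu>) j" "(k, \<mu>) \<notin> pri ` top" by (auto simp: S_def)
      then show ?thesis
        using parametric_jet_free[OF P(2)] P(1) jetel_Dyc by (fastforce simp: annQ_def)
    qed
  qed
  have "0 \<in> annQ" using ideal_annQ by (simp add: ideal_diff_ring_iff)
  then have "annQ \<inter> DR j = {0}" using zero by auto
  then show ?thesis using that jn int by blast
qed

end

section \<open>Torsion and localization\<close>

lemma tensor_relations_cases:
  assumes "z \<in> tensor_relations A P N"
  obtains
    (add_left) p p' x where "z = frag_of (p \<oplus>\<^bsub>P\<^esub> p', x) - frag_of (p, x) - frag_of (p', x)"
      "p \<in> carrier P" "p' \<in> carrier P" "x \<in> carrier N"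
  | (add_right) p x x' where "z = frag_of (p, x \<oplus>\<^bsub>N\<^esub> x') - frag_of (p, x) - frag_of (p, x')"
      "p \<in> carrier P" "x \<in> carrier N" "x' \<in> carrier N"
  | (smult) a p x where "z = frag_of (a \<odot>\<^bsub>P\<^esub> p, x) - frag_of (p, a \<odot>\<^bsub>N\<^esub> x)"
      "a \<in> carrier A" "p \<in> carrier P" "x \<in> carrier N"
  using assms unfolding tensor_relations_def by blast

context dop_quotient
begin

text \<open>The preimage in \<open>Dy\<close> of the torsion submodule of \<open>Q\<close> over
  \<open>k[d_1,...,d_j]\<close>.\<close>

definition torsion :: "nat \<Rightarrow> (nat \<Rightarrow> 'k dop) set"
  where "torsion j = {f \<in> Dyc n m. \<exists>u\<in>DR j. u \<noteq> 0 \<and> smul u f \<in> N}"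

text \<open>\<open>s\<close> is a denominator of the fraction \<open>p\<close>, with
  \<open>num j s p\<close> below as the resulting numerator \<open>s * p\<close> in
  \<open>k[d_1,...,d_j]\<close>.\<close>

definition den :: "nat \<Rightarrow> 'k dop \<Rightarrow> 'k dop fract \<Rightarrow> bool"
  where "den j s p \<longleftrightarrow> (\<exists>a\<in>DR j. Fract a 1 = Fract s 1 * p)"

definition num :: "nat \<Rightarrow> 'k dop \<Rightarrow> 'k dop fract \<Rightarrow> 'k dop"
  where "num j s p = (SOME a. a \<in> DR j \<and> Fract a 1 = Fract s 1 * p)"

lemma num_spec: "den j s p \<Longrightarrow> num j s p \<in> DR j \<and> Fract (num j s p) 1 = Fract s 1 * p"
  unfolding den_def num_def by (rule someI_ex) blast

lemma num_eqI:
  assumes "a \<in> DR j" "Fract a 1 = Fract s 1 * p"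
  shows "num j s p = a"
proof -
  have "Fract (num j s p) 1 = Fract a 1" using num_spec[of j s p] assms by (auto simp: den_def)
  then show ?thesis by (simp add: eq_fract)
qed

text \<open>These choices respect addition and scalars only modulo \<open>N\<close>, which is
  harmless because values are judged up to \<open>torsion\<close>, a set containing
  \<open>N\<close>.\<close>

definition rep :: "(nat \<Rightarrow> 'k dop) set \<Rightarrow> nat \<Rightarrow> 'k dop"
  where "rep X = (SOME f. f \<in> Dyc n m \<and> X = coset f)"

lemma rep_spec:
  assumes "X \<in> carrier Q"
  shows "rep X \<in> Dyc n m" "coset (rep X) = X"
proof -
  have "\<exists>f. f \<in> Dyc n m \<and> X = coset f" using assms unfolding carrier_Q by blast
  then have *: "rep X \<in> Dyc n m \<and> X = coset (rep X)"
    unfolding rep_def by (rule someI_ex)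
  show "rep X \<in> Dyc n m" by (rule conjunct1[OF *])
  show "coset (rep X) = X" by (rule conjunct2[OF *, symmetric])
qed

lemma Q_add_closed:
  assumes "x \<in> carrier Q" "y \<in> carrier Q"
  shows "x \<oplus>\<^bsub>Q\<^esub> y \<in> carrier Q"
proof -
  obtain f g where fg: "f \<in> Dyc n m" "g \<in> Dyc n m" "x = coset f" "y = coset g"
    using assms unfolding carrier_Q by blast
  show ?thesis unfolding fg(3,4) add_Q carrier_Q using Dyc_add[OF fg(1,2)] by blast
qed

text \<open>Substitute for the map from the tensor product to a localization of \<open>M\<close>, which is not constructed:
  clear denominators with \<open>s\<close> and evaluate the formal sum in \<open>Dy\<close>. The value is meaningful only if \<open>s\<close> is
  a common denominator (otherwise \<^const>\<open>num\<close> is arbitrary), hence the multiples of a suitable \<open>s\<close>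
  in \<open>eval_torsion\<close>.\<close>

definition evalf :: "nat \<Rightarrow> 'k dop \<Rightarrow> ('k dop fract \<times> (nat \<Rightarrow> 'k dop) set \<Rightarrow>\<^sub>0 int) \<Rightarrow> nat \<Rightarrow> 'k dop"
  where "evalf j s z = (\<Sum>w\<in>Poly_Mapping.keys z.
    smul (of_int (Poly_Mapping.lookup z w) * num j s (fst w)) (rep (snd w)))"

lemma evalf_superset:
  assumes "finite K" "Poly_Mapping.keys z \<subseteq> K"
  shows "evalf j s z = (\<Sum>w\<in>K. smul (of_int (Poly_Mapping.lookup z w) * num j s (fst w)) (rep (snd w)))"
  unfolding evalf_def using assms by (intro sum.mono_neutral_left) (auto simp: in_keys_iff)

lemma evalf_add: "evalf j s (y + z) = evalf j s y + evalf j s z"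
proof -
  let ?K = "Poly_Mapping.keys y \<union> Poly_Mapping.keys z"
  have "evalf j s (y + z) = (\<Sum>w\<in>?K. smul (of_int (Poly_Mapping.lookup (y + z) w) * num j s (fst w)) (rep (snd w)))"
    by (rule evalf_superset) (use keys_add[of y z] in auto)
  also have "\<dots> = (\<Sum>w\<in>?K. smul (of_int (Poly_Mapping.lookup y w) * num j s (fst w)) (rep (snd w)))
      + (\<Sum>w\<in>?K. smul (of_int (Poly_Mapping.lookup z w) * num j s (fst w)) (rep (snd w)))"
    by (simp add: lookup_add distrib_right smul.scale_left_distrib sum.distrib)
  also have "\<dots> = evalf j s y + evalf j s z"
    using evalf_superset[of ?K y j s] evalf_superset[of ?K z j s] by simp
  finally show ?thesis .
qed

lemma evalf_uminus: "evalf j s (- z) = - evalf j s z"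
proof -
  have "evalf j s 0 = 0" by (simp add: evalf_def)
  then have "evalf j s (- z) + evalf j s z = 0" using evalf_add[of j s "- z" z] by simp
  then show ?thesis by (simp add: eq_neg_iff_add_eq_0)
qed

lemma evalf_diff: "evalf j s (y - z) = evalf j s y - evalf j s z"
  using evalf_add[of j s y "- z"] by (simp add: evalf_uminus)

lemma evalf_frag_of: "evalf j s (frag_of (p, x)) = smul (num j s p) (rep x)"
  by (simp add: evalf_def keys_frag_of)

lemma torsionI: "f \<in> Dyc n m \<Longrightarrow> u \<in> DR j \<Longrightarrow> u \<noteq> 0 \<Longrightarrow> smul u f \<in> N \<Longrightarrow> f \<in> torsion j"
  unfolding torsion_def by blast

lemma torsion_N:
  assumes "f \<in> N"
  shows "f \<in> torsion j"
proof (rule torsionI)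
  show "f \<in> Dyc n m" using assms N_sub by blast
  show "smul 1 f \<in> N" using assms by simp
qed simp_all

lemma coset_torsion_trivial_iff: "coset ` torsion j = {\<zero>\<^bsub>Q\<^esub>} \<longleftrightarrow> torsion j = N"
proof
  assume *: "coset ` torsion j = {\<zero>\<^bsub>Q\<^esub>}"
  have "f \<in> N" if "f \<in> torsion j" for f
  proof -
    have "coset f = \<zero>\<^bsub>Q\<^esub>" using * that by blast
    then show ?thesis by (simp only: coset_eq_zero_iff)
  qed
  then show "torsion j = N" using torsion_N by blast
next
  assume *: "torsion j = N"
  have "coset f = \<zero>\<^bsub>Q\<^esub>" if "f \<in> N" for f using that by (simp only: coset_eq_zero_iff)
  then show "coset ` torsion j = {\<zero>\<^bsub>Q\<^esub>}" using * dop_closed_zero[OF N_closed] by blast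
qed

lemma torsion_add:
  assumes "j \<le> n" "f \<in> torsion j" "g \<in> torsion j"
  shows "f + g \<in> torsion j"
proof -
  obtain u v where uv: "u \<in> DR j" "u \<noteq> 0" "smul u f \<in> N" "v \<in> DR j" "v \<noteq> 0" "smul v g \<in> N" "f \<in> Dyc n m" "g \<in> Dyc n m"
    using assms unfolding torsion_def by blast
  have jn: "DR j \<subseteq> (DR n :: 'k dop set)" by (rule DR_mono) fact
  have "smul v (smul u f) + smul u (smul v g) \<in> N"
    using uv jn by (intro dop_closed_add[OF N_closed] dop_closed_smul[OF N_closed _ uv(3)] dop_closed_smul[OF N_closed _ uv(6)]) auto
  then have "smul (u * v) (f + g) \<in> N" by (simp add: smul.scale_right_distrib mult.commute)
  moreover have "u * v \<in> DR j" "u * v \<noteq> 0" using uv by auto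
  ultimately show ?thesis unfolding torsion_def using Dyc_add uv(7,8) by blast
qed

lemma torsion_uminus:
  assumes "f \<in> torsion j"
  shows "- f \<in> torsion j"
proof -
  obtain u where u: "u \<in> DR j" "u \<noteq> 0" "smul u f \<in> N" "f \<in> Dyc n m"
    using assms unfolding torsion_def by blast
  have "smul u (- f) \<in> N" using dop_closed_uminus[OF N_closed u(3)] by simp
  then show ?thesis by (rule torsionI[OF Dyc_uminus[OF u(4)] u(1,2)])
qed

definition eval_torsion :: "nat \<Rightarrow> ('k dop fract \<times> (nat \<Rightarrow> 'k dop) set \<Rightarrow>\<^sub>0 int) \<Rightarrow> bool"
  where "eval_torsion j z \<longleftrightarrow> (\<exists>s\<in>DR j. s \<noteq> 0 \<and> (\<forall>t\<in>DR j. t \<noteq> 0 \<longrightarrow> evalf j (s * t) z \<in> torsion j))"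

text \<open>The product of the two denominators serves the sum, because \<open>eval_torsion\<close>
  demands all nonzero multiples of a denominator.\<close>

lemma eval_torsion_add:
  assumes "j \<le> n" "eval_torsion j y" "eval_torsion j z"
  shows "eval_torsion j (y + z)"
proof -
  obtain s where s: "s \<in> DR j" "s \<noteq> 0" "\<And>t. t \<in> DR j \<Longrightarrow> t \<noteq> 0 \<Longrightarrow> evalf j (s * t) y \<in> torsion j"
    using assms(2) unfolding eval_torsion_def by blast
  obtain s' where s': "s' \<in> DR j" "s' \<noteq> 0" "\<And>t. t \<in> DR j \<Longrightarrow> t \<noteq> 0 \<Longrightarrow> evalf j (s' * t) z \<in> torsion j"
    using assms(3) unfolding eval_torsion_def by blast
  have "evalf j (s * s' * t) (y + z) \<in> torsion j" if t: "t \<in> DR j" "t \<noteq> 0" for t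
  proof -
    have "evalf j (s * (s' * t)) y \<in> torsion j" "evalf j (s' * (s * t)) z \<in> torsion j"
      using s s' t by (auto intro!: s(3) s'(3))
    then show ?thesis unfolding evalf_add using torsion_add[OF assms(1)] by (simp add: algebra_simps)
  qed
  moreover have "s * s' \<in> DR j" "s * s' \<noteq> 0" using s s' by auto
  ultimately show ?thesis unfolding eval_torsion_def by blast
qed

lemma eval_torsion_uminus:
  assumes "eval_torsion j z"
  shows "eval_torsion j (- z)"
proof -
  obtain s where s: "s \<in> DR j" "s \<noteq> 0" "\<And>t. t \<in> DR j \<Longrightarrow> t \<noteq> 0 \<Longrightarrow> evalf j (s * t) z \<in> torsion j"
    using assms unfolding eval_torsion_def by blast
  have "evalf j (s * t) (- z) \<in> torsion j" if "t \<in> DR j" "t \<noteq> 0" for t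
    unfolding evalf_uminus by (rule torsion_uminus[OF s(3)[OF that]])
  then show ?thesis using s(1,2) unfolding eval_torsion_def by blast
qed

lemma den_mult:
  assumes "b \<in> DR j" "b \<noteq> 0" "a \<in> DR j" "t \<in> DR j"
  shows "den j (b * t) (Fract a b)"
proof -
  have "Fract (a * t) 1 = Fract (b * t) 1 * Fract a b"
    using assms(2) by (simp add: eq_fract ac_simps)
  then show ?thesis unfolding den_def using DR_mult[OF assms(3,4)] by blast
qed

text \<open>Once \<open>s\<close> clears all denominators, \<open>num\<close> is additive in the
  fraction and linear over \<open>k[d_1,...,d_j]\<close>, and \<open>rep\<close> is additive and
  linear modulo \<open>N\<close>. So each bilinearity relation evaluates to 0 or into
  \<open>N\<close>.\<close>

lemma eval_torsion_relation:
  assumes jn: "j \<le> n" and z: "z \<in> tensor_relations (diff_ring j) (chi_field j) Q"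
  shows "eval_torsion j z"
proof -
  have sub: "DR j \<subseteq> (DR n :: 'k dop set)" using jn by (rule DR_mono)
  from z show ?thesis
  proof (cases rule: tensor_relations_cases)
    case (add_left p p' x)
    obtain a b c d where p: "p = Fract a b" "a \<in> DR j" "b \<in> DR j" "b \<noteq> 0"
      and p': "p' = Fract c d" "c \<in> DR j" "d \<in> DR j" "d \<noteq> 0"
      using add_left(2,3) by (auto simp: chi_field_def)
    have "evalf j (b * d * t) z \<in> torsion j" if t: "t \<in> DR j" for t
    proof -
      have "den j (b * (d * t)) p" "den j (d * (b * t)) p'"
        unfolding p(1) p'(1) using p p' t by (auto intro!: den_mult)
      then have dn: "den j (b * d * t) p" "den j (b * d * t) p'" by (simp_all add: algebra_simps)
      note spec = num_spec[OF dn(1)] num_spec[OF dn(2)]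
      have "num j (b * d * t) (p + p') = num j (b * d * t) p + num j (b * d * t) p'"
      proof (rule num_eqI)
        show "num j (b * d * t) p + num j (b * d * t) p' \<in> DR j" using spec by auto
        have "Fract (num j (b * d * t) p + num j (b * d * t) p') 1
          = Fract (num j (b * d * t) p) 1 + Fract (num j (b * d * t) p') 1" by simp
        then show "Fract (num j (b * d * t) p + num j (b * d * t) p') 1 = Fract (b * d * t) 1 * (p + p')"
          using spec by (simp only: distrib_left)
      qed
      then have "evalf j (b * d * t) z = 0"
        unfolding add_left(1) by (simp add: evalf_diff evalf_frag_of chi_field_def smul.scale_left_distrib)
      then show ?thesis using torsion_N dop_closed_zero[OF N_closed] by simp
    qed
    moreover have "b * d \<in> DR j" "b * d \<noteq> 0" using p p' by auto
    ultimately show ?thesis unfolding eval_torsion_def by blast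
  next
    case (add_right p x x')
    obtain a b where p: "p = Fract a b" "a \<in> DR j" "b \<in> DR j" "b \<noteq> 0"
      using add_right(2) by (auto simp: chi_field_def)
    have closed: "x \<oplus>\<^bsub>Q\<^esub> x' \<in> carrier Q"
      by (rule Q_add_closed[OF add_right(3,4)])
    have "coset (rep (x \<oplus>\<^bsub>Q\<^esub> x')) = coset (rep x + rep x')"
      using rep_spec(2)[OF closed] rep_spec(2)[OF add_right(3)] rep_spec(2)[OF add_right(4)] add_Q by metis
    then have inN: "rep (x \<oplus>\<^bsub>Q\<^esub> x') - (rep x + rep x') \<in> N" by (simp add: coset_eq_iff)
    have "evalf j (b * t) z \<in> torsion j" if t: "t \<in> DR j" for t
    proof -
      have "num j (b * t) p \<in> DR n" using num_spec den_mult[OF p(3,4,2) t] p(1) sub by blast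
      then have "smul (num j (b * t) p) (rep (x \<oplus>\<^bsub>Q\<^esub> x') - (rep x + rep x')) \<in> N"
        using dop_closed_smul[OF N_closed _ inN] by blast
      moreover have "evalf j (b * t) z = smul (num j (b * t) p) (rep (x \<oplus>\<^bsub>Q\<^esub> x') - (rep x + rep x'))"
        unfolding add_right(1) by (simp add: evalf_diff evalf_frag_of smul.scale_right_diff_distrib smul.scale_right_distrib)
      ultimately show ?thesis using torsion_N by simp
    qed
    then show ?thesis unfolding eval_torsion_def using p by blast
  next
    case (smult a p x)
    obtain c b where p: "p = Fract c b" "c \<in> DR j" "b \<in> DR j" "b \<noteq> 0"
      using smult(3) by (auto simp: chi_field_def)
    have an: "a \<in> DR n" using smult(2) sub by blast
    have x: "x = coset (rep x)" using rep_spec(2)[OF smult(4)] ..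
    have ax: "a \<odot>\<^bsub>Q\<^esub> x = coset (smul a (rep x))" by (subst x) (rule smult_Q[OF an])
    have closed: "a \<odot>\<^bsub>Q\<^esub> x \<in> carrier Q"
      unfolding ax carrier_Q using Dyc_smul[OF an rep_spec(1)[OF smult(4)]] by blast
    have "coset (smul a (rep x)) = coset (rep (a \<odot>\<^bsub>Q\<^esub> x))"
      using rep_spec(2)[OF closed] ax by simp
    then have inN: "smul a (rep x) - rep (a \<odot>\<^bsub>Q\<^esub> x) \<in> N" by (simp add: coset_eq_iff)
    have "evalf j (b * t) z \<in> torsion j" if t: "t \<in> DR j" for t
    proof -
      have spec: "num j (b * t) p \<in> DR j \<and> Fract (num j (b * t) p) 1 = Fract (b * t) 1 * p"
        using num_spec den_mult[OF p(3,4,2) t] p(1) by blast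
      then have "smul (num j (b * t) p) (smul a (rep x) - rep (a \<odot>\<^bsub>Q\<^esub> x)) \<in> N"
        using dop_closed_smul[OF N_closed _ inN] sub by blast
      moreover have "num j (b * t) (a \<odot>\<^bsub>chi_field j\<^esub> p) = num j (b * t) p * a"
      proof (rule num_eqI)
        show "num j (b * t) p * a \<in> DR j" using spec smult(2) by auto
        have "Fract (num j (b * t) p * a) 1 = Fract (num j (b * t) p) 1 * Fract a 1" by simp
        then show "Fract (num j (b * t) p * a) 1 = Fract (b * t) 1 * (a \<odot>\<^bsub>chi_field j\<^esub> p)"
          using spec by (simp only: chi_field_def module.simps) (simp only: mult_ac)
      qed
      ultimately show ?thesis using torsion_N
        unfolding smult(1) evalf_diff evalf_frag_of by (simp add: smul.scale_right_diff_distrib)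
    qed
    then show ?thesis unfolding eval_torsion_def using p by blast
  qed
qed

section \<open>The kernel of the localization map\<close>

context
  fixes j :: nat
  assumes jn: "j \<le> n"
begin

abbreviation FG where "FG \<equiv> free_Abelian_group (carrier (chi_field j :: ('k dop, 'k dop fract) module) \<times> carrier Q)"
abbreviation K where "K \<equiv> tensor_null (diff_ring j) (chi_field j) Q"

lemma chi_mem_iff:
  "p \<in> carrier (chi_field j) \<longleftrightarrow> (\<exists>a b. p = Fract a b \<and> a \<in> DR j \<and> b \<in> DR j \<and> b \<noteq> 0)"
  by (simp add: chi_field_def)

lemma chi_simps: "p \<oplus>\<^bsub>chi_field j\<^esub> p' = p + p'" "a \<odot>\<^bsub>chi_field j\<^esub> p = Fract a 1 * p"
  by (simp_all add: chi_field_def)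

lemma chi_one: "1 \<in> carrier (chi_field j)"
  unfolding chi_mem_iff One_fract_def using DR_one one_neq_zero by blast

lemma chi_add_closed:
  assumes "p \<in> carrier (chi_field j)" "p' \<in> carrier (chi_field j)"
  shows "p \<oplus>\<^bsub>chi_field j\<^esub> p' \<in> carrier (chi_field j)"
proof -
  obtain a b c d where "p = Fract a b" "a \<in> DR j" "b \<in> DR j" "b \<noteq> 0"
    "p' = Fract c d" "c \<in> DR j" "d \<in> DR j" "d \<noteq> 0" using assms unfolding chi_mem_iff by blast
  then have "p + p' = Fract (a * d + c * b) (b * d)" "a * d + c * b \<in> DR j" "b * d \<in> DR j" "b * d \<noteq> 0"
    by auto
  then show ?thesis unfolding chi_simps chi_mem_iff by blast
qed

lemma chi_smult_closed:
  assumes "a \<in> DR j" "p \<in> carrier (chi_field j)"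
  shows "a \<odot>\<^bsub>chi_field j\<^esub> p \<in> carrier (chi_field j)"
proof -
  obtain c d where "p = Fract c d" "c \<in> DR j" "d \<in> DR j" "d \<noteq> 0" using assms(2) unfolding chi_mem_iff by blast
  then have "Fract a 1 * p = Fract (a * c) d" "a * c \<in> DR j" "d \<in> DR j" "d \<noteq> 0" using assms(1) by auto
  then show ?thesis unfolding chi_simps chi_mem_iff by blast
qed

lemma Q_smult_closed:
  assumes "a \<in> DR j" "x \<in> carrier Q"
  shows "a \<odot>\<^bsub>Q\<^esub> x \<in> carrier Q"
proof -
  have a: "a \<in> DR n" using assms(1) DR_mono[OF jn] by blast
  obtain f where f: "f \<in> Dyc n m" "x = coset f" using assms(2) unfolding carrier_Q by blast
  show ?thesis unfolding f(2) smult_Q[OF a] carrier_Q using Dyc_smul[OF a f(1)] by blast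
qed

lemma relations_sub: "tensor_relations (diff_ring j) (chi_field j) Q \<subseteq> carrier FG"
proof
  fix z assume z: "z \<in> tensor_relations (diff_ring j) (chi_field j) Q"
  have three: "frag_of w - frag_of w' - frag_of w'' \<in> carrier FG"
    if "w \<in> carrier (chi_field j) \<times> carrier Q" "w' \<in> carrier (chi_field j) \<times> carrier Q"
      "w'' \<in> carrier (chi_field j) \<times> carrier Q" for w w' w'' :: "'k dop fract \<times> (nat \<Rightarrow> 'k dop) set"
    using that keys_diff[of "frag_of w - frag_of w'" "frag_of w''"] keys_diff[of "frag_of w" "frag_of w'"]
    unfolding carrier_free_Abelian_group_iff keys_frag_of by blast
  have two: "frag_of w - frag_of w' \<in> carrier FG"
    if "w \<in> carrier (chi_field j) \<times> carrier Q" "w' \<in> carrier (chi_field j) \<times> carrier Q"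
      for w w' :: "'k dop fract \<times> (nat \<Rightarrow> 'k dop) set"
    using that keys_diff[of "frag_of w" "frag_of w'"]
    unfolding carrier_free_Abelian_group_iff keys_frag_of by blast
  from z show "z \<in> carrier FG"
  proof (cases rule: tensor_relations_cases)
    case (add_left p p' x)
    show ?thesis unfolding add_left(1) by (rule three) (use add_left(2-4) chi_add_closed in auto)
  next
    case (add_right p x x')
    show ?thesis unfolding add_right(1) by (rule three) (use add_right(2-4) Q_add_closed in auto)
  next
    case (smult a p x)
    show ?thesis unfolding smult(1) by (rule two) (use smult(2-4) chi_smult_closed Q_smult_closed in auto)
  qed
qed

lemma subgroup_K: "subgroup K FG"
  unfolding tensor_null_def
  by (rule group.generate_is_subgroup[OF group_free_Abelian_group relations_sub])

lemma normal_K: "K \<lhd> FG"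
  by (rule comm_group.subgroup_imp_normal[OF abelian_free_Abelian_group subgroup_K])

lemma K_add: "y \<in> K \<Longrightarrow> z \<in> K \<Longrightarrow> y + z \<in> K"
  using subgroup.m_closed[OF subgroup_K] by simp

lemma K_uminus:
  assumes "z \<in> K"
  shows "- z \<in> K"
proof -
  have "z \<in> carrier FG" using subgroup.mem_carrier[OF subgroup_K assms] .
  then have "inv\<^bsub>FG\<^esub> z = - z" by simp
  then show ?thesis using subgroup.m_inv_closed[OF subgroup_K assms] by (simp only:)
qed

lemma K_zero: "0 \<in> K"
  using subgroup.one_closed[OF subgroup_K] by simp

lemma K_relation: "z \<in> tensor_relations (diff_ring j) (chi_field j) Q \<Longrightarrow> z \<in> K"
  unfolding tensor_null_def by (rule generate.incl)

lemma K_coset_eq: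
  assumes "a - b \<in> K"
  shows "K #>\<^bsub>FG\<^esub> a = K #>\<^bsub>FG\<^esub> b"
proof -
  have "x \<in> K #>\<^bsub>FG\<^esub> c \<longleftrightarrow> x - c \<in> K" for x c
  proof -
    have "K #>\<^bsub>FG\<^esub> c = (\<lambda>h. h + c) ` K" by (auto simp: r_coset_def)
    then show ?thesis by (auto simp: algebra_simps intro: image_eqI[of _ _ "x - c"])
  qed
  moreover have "x - a \<in> K \<longleftrightarrow> x - b \<in> K" for x
    using K_add[of "x - a" "a - b"] K_add[of "x - b" "- (a - b)"] K_uminus[OF assms] assms by auto
  ultimately show ?thesis by blast
qed

lemma K_coset_one_iff: "K #>\<^bsub>FG\<^esub> a = K \<longleftrightarrow> a \<in> K"
proof
  assume "K #>\<^bsub>FG\<^esub> a = K"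
  moreover have "a \<in> K #>\<^bsub>FG\<^esub> a" using K_zero by (auto simp: r_coset_def)
  ultimately show "a \<in> K" by simp
next
  assume "a \<in> K"
  then have "K #>\<^bsub>FG\<^esub> a = K #>\<^bsub>FG\<^esub> 0" using K_coset_eq[of a 0] by simp
  then show "K #>\<^bsub>FG\<^esub> a = K" by (simp add: r_coset_def)
qed

lemma K_eval_torsion:
  assumes "z \<in> K"
  shows "eval_torsion j z"
  using assms unfolding tensor_null_def
proof (induction rule: generate.induct)
  case one
  then show ?case unfolding eval_torsion_def
    using torsion_N[OF dop_closed_zero[OF N_closed]] DR_one
    by (auto simp: evalf_def intro!: bexI[of _ 1])
next
  case (incl h)
  then show ?case by (rule eval_torsion_relation[OF jn])
next
  case (inv h)
  then have "h \<in> carrier FG" using relations_sub by blast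
  then have "inv\<^bsub>FG\<^esub> h = - h" by simp
  then show ?case using eval_torsion_uminus[OF eval_torsion_relation[OF jn inv]] by simp
next
  case (eng h1 h2)
  then show ?case using eval_torsion_add[OF jn] by simp
qed

text \<open>If 1 tensor \<open>x\<close> vanishes, evaluation shows that a nonzero multiple of
  \<open>x\<close> is torsion, hence so is \<open>x\<close>. Conversely, if \<open>u\<close> kills
  \<open>x\<close>, then 1 tensor \<open>x\<close> equals \<open>1/u\<close> tensor
  \<open>u x\<close>, which is 0.\<close>

lemma frag_one_in_K_iff:
  assumes f: "f \<in> Dyc n m"
  shows "frag_of (1, coset f) \<in> K \<longleftrightarrow> f \<in> torsion j"
proof
  have x: "coset f \<in> carrier Q" using f by (simp add: carrier_Q)
  note rx = rep_spec[OF x]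
  have sub: "DR j \<subseteq> (DR n :: 'k dop set)" using jn by (rule DR_mono)
  assume "frag_of (1, coset f) \<in> K"
  then obtain s where s: "s \<in> DR j" "s \<noteq> 0" "evalf j (s * 1) (frag_of (1, coset f)) \<in> torsion j"
    using K_eval_torsion unfolding eval_torsion_def by (metis DR_one one_neq_zero)
  have "num j s 1 = s" using s(1) by (intro num_eqI) auto
  then have "smul s (rep (coset f)) \<in> torsion j" using s(3) by (simp add: evalf_frag_of)
  then obtain u where u: "u \<in> DR j" "u \<noteq> 0" "smul u (smul s (rep (coset f))) \<in> N"
    unfolding torsion_def by blast
  have us: "u * s \<in> DR j" "u * s \<noteq> 0" using u s by auto
  have "f - rep (coset f) \<in> N" using rx(2) by (metis coset_eq_iff)
  then have "smul (u * s) (f - rep (coset f)) \<in> N" using dop_closed_smul[OF N_closed] us sub by blast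
  then have "smul (u * s) (f - rep (coset f)) + smul u (smul s (rep (coset f))) \<in> N"
    using dop_closed_add[OF N_closed] u(3) by blast
  then have "smul (u * s) f \<in> N" by (simp add: smul.scale_right_diff_distrib)
  then show "f \<in> torsion j" unfolding torsion_def using f us by blast
next
  assume "f \<in> torsion j"
  then obtain u where u: "u \<in> DR j" "u \<noteq> 0" "smul u f \<in> N" unfolding torsion_def by blast
  have un: "u \<in> DR n" using u(1) DR_mono[OF jn] by blast
  have x: "coset f \<in> carrier Q" using f by (simp add: carrier_Q)
  define p where "p = Fract 1 u"
  have p: "p \<in> carrier (chi_field j)" unfolding p_def chi_field_def using u by auto
  have up: "u \<odot>\<^bsub>chi_field j\<^esub> p = 1" using u(2) by (simp add: chi_field_def p_def eq_fract One_fract_def)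
  have ux: "u \<odot>\<^bsub>Q\<^esub> coset f = \<zero>\<^bsub>Q\<^esub>" using smult_Q[OF un] u(3) coset_eq_zero_iff by metis
  have z: "\<zero>\<^bsub>Q\<^esub> \<in> carrier Q" "\<zero>\<^bsub>Q\<^esub> \<oplus>\<^bsub>Q\<^esub> \<zero>\<^bsub>Q\<^esub> = \<zero>\<^bsub>Q\<^esub>"
    unfolding zero_Q add_Q carrier_Q using Dyc_zero by auto
  \<comment> \<open>Additivity applied to 0 + 0 = 0 shows that \<open>p\<close> tensor 0
    vanishes.\<close>
  have "frag_of (p, \<zero>\<^bsub>Q\<^esub> \<oplus>\<^bsub>Q\<^esub> \<zero>\<^bsub>Q\<^esub>) - frag_of (p, \<zero>\<^bsub>Q\<^esub>) - frag_of (p, \<zero>\<^bsub>Q\<^esub>) \<in> K"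
    by (rule K_relation) (unfold tensor_relations_def, use p z(1) in blast)
  then have "- frag_of (p, \<zero>\<^bsub>Q\<^esub>) \<in> K" using z(2) by simp
  then have 1: "frag_of (p, \<zero>\<^bsub>Q\<^esub>) \<in> K" using K_uminus by fastforce
  have "frag_of (u \<odot>\<^bsub>chi_field j\<^esub> p, coset f) - frag_of (p, u \<odot>\<^bsub>Q\<^esub> coset f) \<in> K"
    by (rule K_relation) (unfold tensor_relations_def, use u(1) p x in blast)
  then have "frag_of (1, coset f) - frag_of (p, \<zero>\<^bsub>Q\<^esub>) \<in> K" unfolding up ux .
  then show "frag_of (1, coset f) \<in> K" using K_add[OF _ 1] by fastforce
qed

lemma localization_map_hom: "localization_map j Q \<in> hom (add_monoid Q) (partial_localization j Q)"
proof (rule homI)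
  fix x assume "x \<in> carrier (add_monoid Q)"
  then have "frag_of (1, x) \<in> carrier FG" using chi_one by (simp add: keys_frag_of)
  then show "localization_map j Q x \<in> carrier (partial_localization j Q)"
    unfolding tensor_product_def tensor_elem_def FactGroup_def RCOSETS_def by auto
next
  fix x y assume "x \<in> carrier (add_monoid Q)" "y \<in> carrier (add_monoid Q)"
  then have xy: "x \<in> carrier Q" "y \<in> carrier Q" by auto
  have c: "frag_of (1, x) \<in> carrier FG" "frag_of (1, y) \<in> carrier FG"
    using chi_one xy by (simp_all add: keys_frag_of)
  have "frag_of (1, x \<oplus>\<^bsub>Q\<^esub> y) - frag_of (1, x) - frag_of (1, y) \<in> K"
    by (rule K_relation) (unfold tensor_relations_def, use chi_one xy in blast)
  then have "K #>\<^bsub>FG\<^esub> frag_of (1, x \<oplus>\<^bsub>Q\<^esub> y) = K #>\<^bsub>FG\<^esub> (frag_of (1, x) + frag_of (1, y))"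
    by (intro K_coset_eq) (simp add: algebra_simps)
  also have "\<dots> = (K #>\<^bsub>FG\<^esub> frag_of (1, x)) <#>\<^bsub>FG\<^esub> (K #>\<^bsub>FG\<^esub> frag_of (1, y))"
    using normal.rcos_sum[OF normal_K c] by simp
  finally show "localization_map j Q (x \<otimes>\<^bsub>add_monoid Q\<^esub> y)
    = localization_map j Q x \<otimes>\<^bsub>partial_localization j Q\<^esub> localization_map j Q y"
    by (simp add: tensor_product_def tensor_elem_def FactGroup_def)
qed

lemma left_exact_iff_torsion_free:
  "left_exact (add_monoid Q) (partial_localization j Q) (localization_map j Q) \<longleftrightarrow> torsion j = N"
proof -
  have ker: "kernel (add_monoid Q) (partial_localization j Q) (localization_map j Q) = coset ` torsion j"
  proof -
    have one: "localization_map j Q (coset f) = \<one>\<^bsub>partial_localization j Q\<^esub> \<longleftrightarrow> f \<in> torsion j" if "f \<in> Dyc n m" for f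
      unfolding tensor_product_def tensor_elem_def one_FactGroup K_coset_one_iff frag_one_in_K_iff[OF that] ..
    have "torsion j \<subseteq> Dyc n m" by (auto simp: torsion_def)
    then show ?thesis unfolding kernel_def partial_object.simps monoid.simps carrier_Q using one by blast
  qed
  show ?thesis unfolding left_exact_def ker coset_torsion_trivial_iff[symmetric] using localization_map_hom by simp
qed

end

section \<open>Purity in terms of torsion\<close>

lemma cd_cyclic_submodule:
  assumes "f \<in> Dyc n m"
  shows "cd n (cyclic_submodule (diff_ring n) Q (coset f)) =
    (if f \<in> N then \<infinity> else enat n - krull_dim (diff_ring n Quot ann f))"
  unfolding cd_def carrier_cyclic_submodule_trivial_iff[OF assms] annihilator_cyclic_submodule[OF assms] ..

lemma is_pure_iff_torsion_free:
  assumes jn: "j \<le> n" and int: "integral_mod n j annQ" and r: "r = n - j"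
  shows "is_pure n r Q \<longleftrightarrow> torsion j = N"
proof -
  let ?c = "\<lambda>f. cd n (cyclic_submodule (diff_ring n) Q (coset f))"
  \<comment> \<open>The equation has content only outside \<open>torsion j\<close>, where the
    codimension is \<open>r\<close>. The second conjunct covers torsion elements, including those of
    \<open>N\<close>, where the codimension is infinite.\<close>
  have dims: "?c f = (if f \<in> torsion j then ?c f else enat r) \<and> (f \<in> torsion j \<longrightarrow> enat r < ?c f)"
    if f: "f \<in> Dyc n m" for f
  proof (cases "f \<in> N")
    case True
    then show ?thesis using torsion_N[of f j] by (simp add: cd_cyclic_submodule[OF f])
  next
    case False
    have int_f: "integral_mod n j (ann f)" using integral_mod_mono[OF int annQ_subset_ann[OF f]] .
    have "0 \<in> ann f" using ideal_ann by (simp add: ideal_diff_ring_iff)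
    have "1 \<notin> ann f" using False by (simp add: ann_def)
    have sub: "DR j \<subseteq> (DR n :: 'k dop set)" using jn by (rule DR_mono)
    have tors: "f \<in> torsion j \<longleftrightarrow> ann f \<inter> DR j \<noteq> {0}"
      using f sub \<open>0 \<in> ann f\<close> by (auto simp: torsion_def ann_def)
    have cd: "?c f = enat n - krull_dim (diff_ring n Quot ann f)"
      using False by (simp add: cd_cyclic_submodule[OF f])
    show ?thesis
    proof (cases "f \<in> torsion j")
      case True
      then have "krull_dim (diff_ring n Quot ann f) < enat j"
        using krull_dim_Quot_less[OF ideal_ann int_f jn \<open>1 \<notin> ann f\<close>] tors by blast
      then obtain l where "krull_dim (diff_ring n Quot ann f) = enat l" "l < j"
        by (cases "krull_dim (diff_ring n Quot ann f)") auto
      then show ?thesis using True jn by (simp add: cd r)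
    next
      case False
      then have "krull_dim (diff_ring n Quot ann f) = enat j"
        using krull_dim_Quot_eq[OF ideal_ann int_f jn] tors by blast
      then show ?thesis using False by (simp add: cd r)
    qed
  qed
  have "tsub n (int r) Q = coset ` torsion j"
  proof -
    have "?c f > enat r \<longleftrightarrow> f \<in> torsion j" if "f \<in> Dyc n m" for f
      using dims[OF that] by (metis less_irrefl)
    then show ?thesis unfolding tsub_def by (auto simp: carrier_Q torsion_def)
  qed
  moreover have "tsub n (int r - 1) Q = carrier Q"
  \<comment> \<open>For \<open>r = 0\<close> the index is negative and \<open>tsub\<close> is the
    whole module by convention; otherwise codimension at least \<open>r\<close> exceeds
    \<open>r - 1\<close>.\<close>
  proof (cases "r = 0")
    case True
    then show ?thesis by (simp add: tsub_def)
  next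
    case False
    have "?c f > enat (nat (int r - 1))" if "f \<in> Dyc n m" for f
    proof -
      have "enat (nat (int r - 1)) < enat r" using False by simp
      also have "enat r \<le> ?c f" using dims[OF that] by (metis order_le_less)
      finally show ?thesis .
    qed
    then show ?thesis using False unfolding tsub_def by (auto simp: carrier_Q)
  qed
  ultimately show ?thesis unfolding is_pure_def coset_torsion_trivial_iff[symmetric] by simp
qed

end

theorem corollary3p10:
  fixes n m q r :: nat
    and T :: "'i set"
    and \<Phi> :: "'i \<Rightarrow> nat \<Rightarrow> 'k::field_char_0 dop"
  defines "M \<equiv> system_module n m T \<Phi>"
  assumes "involutive_solved n m q T \<Phi>"
    and "cd n M = enat r"
  shows "is_pure n r M \<longleftrightarrow>
    left_exact (add_monoid M) (partial_localization (n - r) M) (localization_map (n - r) M)"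
proof -
  obtain pri where "involutive n m q T \<Phi> pri"
    using assms(2) unfolding involutive_solved_def involutive_def by blast
  then interpret involutive n m q T \<Phi> pri .
  have M: "M = quotient_module (Dy n m) N" unfolding M_def system_module_def N_def ..
  have cd: "cd n (quotient_module (Dy n m) N) = enat r" using assms(3) M by simp
  \<comment> \<open>The codimension of the module is finite, while that of the zero module is
    infinite.\<close>
  have nz: "\<not> Dyc n m \<subseteq> N"
  proof
    assume "Dyc n m \<subseteq> N"
    then show False using cd carrier_Q_trivial_iff by (simp add: cd_def)
  qed
  then obtain j where j: "j \<le> n" "integral_mod n j annQ" "annQ \<inter> DR j = {0}"
    by (rule noether_normalization)
  have "cd n (quotient_module (Dy n m) N) = enat n - krull_dim (diff_ring n Quot annQ)"
    using nz carrier_Q_trivial_iff by (simp add: cd_def annihilator_Q)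
  also have "krull_dim (diff_ring n Quot annQ) = enat j"
    by (rule krull_dim_Quot_eq[OF ideal_annQ j(2,1,3)])
  finally have r: "r = n - j" using cd by simp
  then have "n - r = j" using j(1) by simp
  then show ?thesis
    unfolding M using is_pure_iff_torsion_free[OF j(1,2) r] left_exact_iff_torsion_free[OF j(1)] by simp
qed

end
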